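(* Let $n\ge 1$ and let $f^1,f^2:Q\times\mathbb{R}^n\to\mathbb{R}^n$ and $A^1,A^2:Q\to\mathbb{R}^{n\times n}$ satisfy assumptions (C1), (C2) and (C3) listed in the context. Then for every $v\in L^2(Q,\mathbb{R}^n)$ there exists a unique $z_v\in AC_0^2(Q,\mathbb{R}^n)$ such that $z=z_v$ satisfies, for a.e. $(x,y)\in Q$, $$z_{xy}(x,y)+f^1(x,y,z(x,y))+\int_0^x\int_0^y\Big(f^2(s,t,z(s,t))+A^1(s,t)z_x(s,t)+A^2(s,t)z_y(s,t)\Big)\,ds\,dt=v(x,y)$$ (the boundary conditions $z(x,0)=0$ for $x\in[0,1]$ and $z(0,y)=0$ for $y\in[0,1]$ being part of the definition of $AC_0^2(Q,\mathbb{R}^n)$). The solution $z_v$ depends continuously on $v$ with respect to the norm topologies of $L^2(Q,\mathbb{R}^n)$ and $AC_0^2(Q,\mathbb{R}^n)$. Moreover, the operator $L^2(Q,\mathbb{R}^n)\ni v\mapsto z_v\in AC_0^2(Q,\mathbb{R}^n)$ is Fréchet differentiable.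
   Context: $Q=[0,1]\times[0,1]\subset\mathbb{R}^2$. Function space. $AC_0^2(Q,\mathbb{R}^n)$ is the space of absolutely continuous functions $z:Q\to\mathbb{R}^n$ of two variables with $z(x,0)=z(0,y)=0$ for all $x,y\in[0,1]$ and $z_{xy}\in L^2(Q,\mathbb{R}^n)$. Equivalently, it is the set of functions of the form $z(x,y)=\int_0^x\int_0^y l(s,t)\,ds\,dt$ with $l\in L^2(Q,\mathbb{R}^n)$; for such $z$ one has, for a.e. $(x,y)\in Q$, $z_{xy}(x,y)=l(x,y)$, $z_x(x,y)=\int_0^y l(x,t)\,dt$, $z_y(x,y)=\int_0^x l(s,y)\,ds$. It is a Hilbert space with inner product $\langle z^1,z^2\rangle=\int_0^1\int_0^1\langle z^1_{xy}(x,y),z^2_{xy}(x,y)\rangle\,dx\,dy$ and norm $\|z\|_{AC_0^2}=\|z_{xy}\|_{L^2}$. Assumptions. (C1) $f^1(\cdot,\cdot,z)$ and $f^2(\cdot,\cdot,z)$ are measurable on $Q$ for every $z\in\mathbb{R}^n$; $f^1(x,y,\cdot)$ and $f^2(x,y,\cdot)$ are continuously differentiable on $\mathbb{R}^n$ for a.e. $(x,y)\in Q$; $A^1(\cdot,y)$ is differentiable on $[0,1]$ for a.e. $y\in[0,1]$; $A^2(x,\cdot)$ is differentiable on $[0,1]$ for a.e. $x\in[0,1]$; the functions $A^1,A^2$ and the partial derivatives $A^1_x,A^2_y$ are measurable and essentially bounded on $Q$. (C2) There exist a constant $B>0$ and a function $b\in L^2(Q,\mathbb{R}^+)$ such that $|f^1(x,y,z)|,|f^2(x,y,z)|\le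 B|z|+b(x,y)$ and $|A^1(x,y)|,|A^2(x,y)|,|A^1_x(x,y)|,|A^2_y(x,y)|\le B$ for all $z\in\mathbb{R}^n$ and a.e. $(x,y)\in Q$. (C3) For every $\varrho>0$ there exists a constant $M_\varrho$ such that $|f^1_z(x,y,z)|,|f^2_z(x,y,z)|\le M_\varrho$ for a.e. $(x,y)\in Q$ and all $|z|\le\varrho$, where $f^i_z$ denotes the derivative of $f^i$ with respect to $z$. *)

theory Defs
  imports "HOL-Analysis.Analysis"
begin

lemma AE_has_vector_derivative_indefinite_integral:
  fixes h :: "real \<Rightarrow> 'a::euclidean_space"
  assumes h: "\<And>a b. h integrable_on {a..b}"
  shows "AE x in lborel. 0 < x \<longrightarrow> ((\<lambda>x. integral {0..x} h) has_vector_derivative h x) (at x)"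
proof -
  have h': "\<And>a b. (\<lambda>x. h (- x)) integrable_on {a..b}"
    using Henstock_Kurzweil_Integration.integrable_reflect_real[of h "- b" "- a" for a b] h by simp
  obtain N1 where N1: "negligible N1"
    "\<And>x e. \<lbrakk>x \<notin> N1; 0 < e\<rbrakk> \<Longrightarrow> \<exists>d>0. \<forall>k. 0 < k \<and> k < d \<longrightarrow> norm (integral {x..x+k} h /\<^sub>R k - h x) < e"
    using integrable_ccontinuous_explicit[of h] h by (auto simp: cbox_interval)
  obtain N2 where N2: "negligible N2"
    "\<And>x e. \<lbrakk>x \<notin> N2; 0 < e\<rbrakk> \<Longrightarrow> \<exists>d>0. \<forall>k. 0 < k \<and> k < d \<longrightarrow> norm (integral {x..x+k} (\<lambda>x. h (- x)) /\<^sub>R k - h (- x)) < e"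
    using integrable_ccontinuous_explicit[of "\<lambda>x. h (- x)"] h' by (auto simp: cbox_interval)
  have neg: "negligible (N1 \<union> uminus ` N2)"
    using N1(1) N2(1)
    by (intro negligible_Un negligible_differentiable_image_negligible) (auto intro!: derivative_intros simp: differentiable_on_def)
  have "((\<lambda>x. integral {0..x} h) has_vector_derivative h x) (at x)"
    if x: "x \<notin> N1 \<union> uminus ` N2" "0 < x" for x
    unfolding has_vector_derivative_def has_derivative_at_alt
  proof (intro conjI allI impI)
    show "bounded_linear (\<lambda>k. k *\<^sub>R h x)" by (rule bounded_linear_scaleR_left)
  next
    fix e :: real assume e: "e > 0"
    have nx: "- x \<notin> N2" using x by (metis UnI2 image_eqI minus_minus)
    obtain d1 where d1: "d1 > 0" "\<And>k. 0 < k \<Longrightarrow> k < d1 \<Longrightarrow> norm (integral {x..x+k} h /\<^sub>R k - h x) < e"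
      using N1(2)[of x e] x e by auto
    obtain d2 where d2: "d2 > 0" "\<And>k. 0 < k \<Longrightarrow> k < d2 \<Longrightarrow> norm (integral {-x..-x+k} (\<lambda>x. h (- x)) /\<^sub>R k - h x) < e"
      using N2(2)[OF nx e] by auto
    show "\<exists>d>0. \<forall>y. norm (y - x) < d \<longrightarrow> norm (integral {0..y} h - integral {0..x} h - (y - x) *\<^sub>R h x) \<le> e * norm (y - x)"
    proof (intro exI[of _ "min x (min d1 d2)"] conjI allI impI)
      show "0 < min x (min d1 d2)" using x d1 d2 by auto
      fix y assume y: "norm (y - x) < min x (min d1 d2)"
      consider "y = x" | "y > x" | "y < x" by linarith
      then show "norm (integral {0..y} h - integral {0..x} h - (y - x) *\<^sub>R h x) \<le> e * norm (y - x)"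
      proof cases
        case 1 then show ?thesis by simp
      next
        case 2
        have eq: "integral {0..y} h - integral {0..x} h = integral {x..y} h"
          using Henstock_Kurzweil_Integration.integral_combine[of 0 x y h] 2 x(2) h[of 0 y]
          by (simp add: algebra_simps)
        have "norm (integral {x..x+(y-x)} h /\<^sub>R (y-x) - h x) < e"
          using d1(2)[of "y-x"] 2 y by auto
        moreover have "integral {x..y} h - (y - x) *\<^sub>R h x = (y-x) *\<^sub>R (integral {x..x+(y-x)} h /\<^sub>R (y-x) - h x)"
          using 2 by (simp add: scaleR_right_diff_distrib)
        ultimately have "norm (integral {x..y} h - (y - x) *\<^sub>R h x) \<le> (y-x) * e" using 2
          by (simp only: norm_scaleR) (intro mult_mono, auto)
        then show ?thesis using 2 by (simp add: eq mult.commute)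
      next
        case 3
        have eq: "integral {0..x} h - integral {0..y} h = integral {y..x} h"
          using Henstock_Kurzweil_Integration.integral_combine[of 0 y x h] 3 y h[of 0 x]
          by (simp add: algebra_simps)
        have "integral {-x..-x+(x-y)} (\<lambda>x. h (- x)) = integral {y..x} h" 
          using Henstock_Kurzweil_Integration.integral_reflect_real[of x y h] by simp
        then have "norm (integral {y..x} h /\<^sub>R (x-y) - h x) < e"
          using d2(2)[of "x-y"] 3 y by auto
        moreover have "integral {0..y} h - integral {0..x} h - (y - x) *\<^sub>R h x = - ((x-y) *\<^sub>R (integral {y..x} h /\<^sub>R (x-y) - h x))"
          using 3 by (simp add: scaleR_right_diff_distrib eq[symmetric]) (simp add: algebra_simps)
        ultimately have "norm (integral {0..y} h - integral {0..x} h - (y - x) *\<^sub>R h x) \<le> (x-y) * e" using 3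
          by (simp only: norm_minus_cancel norm_scaleR) (intro mult_mono, auto)
        then show ?thesis using 3 by (simp add: mult.commute)
      qed
    qed
  qed
  then have "AE x in lebesgue. 0 < x \<longrightarrow> ((\<lambda>x. integral {0..x} h) has_vector_derivative h x) (at x)"
    by (intro AE_I'[of "N1 \<union> uminus ` N2"]) (use neg in \<open>auto simp: negligible_iff_null_sets\<close>)
  then show ?thesis by (simp add: AE_completion_iff)
qed

lemma ex_borel_AE_eq:
  fixes f :: "'b \<Rightarrow> 'a::euclidean_space"
  assumes f: "f \<in> borel_measurable (completion M)"
  shows "\<exists>g\<in>borel_measurable M. AE x in M. f x = g x"
proof -
  have "\<exists>g\<in>borel_measurable M. AE x in M. f x \<bullet> b = g x" for b
    by (rule completion_ex_borel_measurable_real, rule borel_measurable_inner[OF f borel_measurable_const])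
  then have "\<forall>b. \<exists>g. g \<in> borel_measurable M \<and> (AE x in M. f x \<bullet> b = g x)" by blast
  from choice[OF this]
  obtain g where g: "\<And>b. g b \<in> borel_measurable M" "\<And>b. AE x in M. f x \<bullet> b = g b x"
    by auto
  have "AE x in M. \<forall>b\<in>Basis. f x \<bullet> b = g b x"
    by (rule AE_finite_allI[OF finite_Basis g(2)])
  then have "AE x in M. f x = (\<Sum>b\<in>Basis. g b x *\<^sub>R b)"
  proof eventually_elim
    case (elim x)
    have "f x = (\<Sum>b\<in>Basis. (f x \<bullet> b) *\<^sub>R b)" by (simp add: euclidean_representation)
    also have "\<dots> = (\<Sum>b\<in>Basis. g b x *\<^sub>R b)" using elim by (intro sum.cong) auto
    finally show ?case .
  qed
  moreover have "(\<lambda>x. \<Sum>b\<in>Basis. g b x *\<^sub>R b) \<in> borel_measurable M"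
    by (rule borel_measurable_sum, rule borel_measurable_scaleR[OF g(1) borel_measurable_const])
  ultimately show ?thesis by (rule rev_bexI[rotated])
qed

definition rect_integral :: "(real \<times> real \<Rightarrow> 'a::euclidean_space) \<Rightarrow> real \<Rightarrow> real \<Rightarrow> 'a" where
  "rect_integral f x y = (LINT p|lborel. indicator ({0..x} \<times> {0..y}) p *\<^sub>R f p)"

definition slice_integral :: "(real \<times> real \<Rightarrow> 'a::euclidean_space) \<Rightarrow> real \<Rightarrow> real \<Rightarrow> 'a" where
  "slice_integral f x y = (LINT t|lborel. indicator {0..y} t *\<^sub>R f (x, t))"

lemma integrable_rect:
  fixes f :: "real \<times> real \<Rightarrow> 'a::euclidean_space"
  assumes "integrable lborel f"
  shows "integrable lborel (\<lambda>p. indicator ({0..x} \<times> {0..y}) p *\<^sub>R f p)"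
  by (rule integrable_mult_indicator[OF _ assms])
     (auto intro!: borel_closed closed_Times)

lemma integrable_slice_integral:
  fixes f :: "real \<times> real \<Rightarrow> 'a::euclidean_space"
  assumes f: "integrable lborel f"
  shows "integrable lborel (\<lambda>s. slice_integral f s y)"
proof -
  have "integrable (lborel \<Otimes>\<^sub>M lborel) (\<lambda>p. indicator (UNIV \<times> {0..y}) p *\<^sub>R f p)"
    unfolding lborel_prod by (rule integrable_mult_indicator[OF _ f]) (auto intro!: borel_closed closed_Times)
  from lborel_pair.integrable_fst'[OF this]
  show ?thesis by (simp add: slice_integral_def indicator_times)
qed

lemma integrable_set_lborel_real:
  fixes g :: "real \<Rightarrow> 'a::euclidean_space"
  assumes "integrable lborel g"
  shows "set_integrable lborel {a..b} g"
  unfolding set_integrable_def by (rule integrable_mult_indicator[OF _ assms]) simp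

lemma rect_integral_eq_integral_slice:
  fixes f :: "real \<times> real \<Rightarrow> 'a::euclidean_space"
  assumes f: "integrable lborel f"
  shows "rect_integral f x y = integral {0..x} (\<lambda>s. slice_integral f s y)"
proof -
  have "integrable (lborel \<Otimes>\<^sub>M lborel) (\<lambda>p. indicator ({0..x} \<times> {0..y}) p *\<^sub>R f p)"
    unfolding lborel_prod by (rule integrable_rect[OF f])
  from lborel_pair.integral_fst'[OF this]
  have "rect_integral f x y = (LINT s|lborel. LINT t|lborel. indicator ({0..x} \<times> {0..y}) (s, t) *\<^sub>R f (s, t))"
    by (simp add: rect_integral_def lborel_prod)
  also have "\<dots> = (LINT s|lborel. indicator {0..x} s *\<^sub>R slice_integral f s y)"
    by (intro Bochner_Integration.integral_cong)
       (auto simp: slice_integral_def indicator_times simp flip: scaleR_scaleR)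
  also have "\<dots> = integral {0..x} (\<lambda>s. slice_integral f s y)"
    using set_borel_integral_eq_integral(2)[OF integrable_set_lborel_real[OF integrable_slice_integral[OF f]]]
    by (simp add: set_lebesgue_integral_def)
  finally show ?thesis .
qed

lemma AE_rect_integral_derivative:
  fixes f :: "real \<times> real \<Rightarrow> 'a::euclidean_space"
  assumes f: "integrable lborel f"
  shows "AE x in lborel. 0 < x \<longrightarrow> ((\<lambda>x. rect_integral f x q) has_vector_derivative slice_integral f x q) (at x)"
  unfolding rect_integral_eq_integral_slice[OF f]
  by (intro AE_has_vector_derivative_indefinite_integral set_borel_integral_eq_integral(1)
        integrable_set_lborel_real integrable_slice_integral[OF f])

lemma isCont_indefinite_lborel:
  fixes g :: "real \<Rightarrow> 'a::euclidean_space"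
  assumes g: "integrable lborel g"
  shows "isCont (\<lambda>y. LINT t|lborel. indicator {0..y} t *\<^sub>R g t) y"
proof -
  define h where "h = (\<lambda>t. indicator {0..} t *\<^sub>R g t)"
  have h: "integrable lborel h"
    unfolding h_def by (rule integrable_mult_indicator[OF _ g]) simp
  define c where "c = min (-1) (y - 1)"
  have eq: "(LINT t|lborel. indicator {0..y'} t *\<^sub>R g t) = integral {c..y'} h" if "y' \<in> {c..y+1}" for y'
  proof -
    have "(LINT t|lborel. indicator {0..y'} t *\<^sub>R g t) = (LINT t|lborel. indicator {c..y'} t *\<^sub>R h t)"
      by (intro Bochner_Integration.integral_cong) (auto simp: h_def c_def indicator_def)
    then show ?thesis
      using set_borel_integral_eq_integral(2)[OF integrable_set_lborel_real[OF h], of c y']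
      by (simp add: set_lebesgue_integral_def)
  qed
  have "continuous_on {c..y+1} (\<lambda>y'. integral {c..y'} h)"
    by (intro indefinite_integral_continuous_1 set_borel_integral_eq_integral(1) integrable_set_lborel_real h)
  then have "continuous_on {c..y+1} (\<lambda>y'. LINT t|lborel. indicator {0..y'} t *\<^sub>R g t)"
    by (rule continuous_on_eq) (simp add: eq)
  then show ?thesis
    by (rule continuous_on_interior) (auto simp: c_def)
qed

lemma rect_integral_diff_bound:
  fixes f :: "real \<times> real \<Rightarrow> 'a::euclidean_space"
  assumes f: "integrable lborel f" and le: "a \<le> b" "q \<le> y" "y \<le> r"
  shows "norm ((rect_integral f b y - rect_integral f a y) - (rect_integral f b q - rect_integral f a q))
    \<le> (rect_integral (\<lambda>p. norm (f p)) b r - rect_integral (\<lambda>p. norm (f p)) a r)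
      - (rect_integral (\<lambda>p. norm (f p)) b q - rect_integral (\<lambda>p. norm (f p)) a q)"
proof -
  let ?i = "\<lambda>x y. indicator ({0..x} \<times> {0..y}) :: real \<times> real \<Rightarrow> real"
  let ?n = "\<lambda>p. norm (f p)"
  note i = integrable_rect[OF f] integrable_rect[OF integrable_norm[OF f]]
  have "norm ((rect_integral f b y - rect_integral f a y) - (rect_integral f b q - rect_integral f a q)) =
     norm (LINT p|lborel. ((?i b y p *\<^sub>R f p - ?i a y p *\<^sub>R f p) - (?i b q p *\<^sub>R f p - ?i a q p *\<^sub>R f p)))"
    unfolding rect_integral_def by (simp add: i)
  also have "\<dots> \<le> (LINT p|lborel. norm ((?i b y p *\<^sub>R f p - ?i a y p *\<^sub>R f p) - (?i b q p *\<^sub>R f p - ?i a q p *\<^sub>R f p)))"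
    by (rule integral_norm_bound)
  also have "\<dots> \<le> (LINT p|lborel. ((?i b r p *\<^sub>R ?n p - ?i a r p *\<^sub>R ?n p) - (?i b q p *\<^sub>R ?n p - ?i a q p *\<^sub>R ?n p)))"
  proof (rule integral_mono)
    show "integrable lborel (\<lambda>p. norm ((?i b y p *\<^sub>R f p - ?i a y p *\<^sub>R f p) - (?i b q p *\<^sub>R f p - ?i a q p *\<^sub>R f p)))"
      by (rule integrable_norm) (simp add: i(1))
    show "integrable lborel (\<lambda>p. (?i b r p *\<^sub>R ?n p - ?i a r p *\<^sub>R ?n p) - (?i b q p *\<^sub>R ?n p - ?i a q p *\<^sub>R ?n p))"
      using i(2) by simp
    fix p :: "real \<times> real"
    show "norm ((?i b y p *\<^sub>R f p - ?i a y p *\<^sub>R f p) - (?i b q p *\<^sub>R f p - ?i a q p *\<^sub>R f p))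
      \<le> (?i b r p *\<^sub>R ?n p - ?i a r p *\<^sub>R ?n p) - (?i b q p *\<^sub>R ?n p - ?i a q p *\<^sub>R ?n p)"
    proof (cases p)
      case (Pair s t)
      define A B C where "A = (indicator {0..b} s - indicator {0..a} s :: real)"
        and "B = (indicator {0..y} t - indicator {0..q} t :: real)"
        and "C = (indicator {0..r} t - indicator {0..q} t :: real)"
      have "0 \<le> A" "0 \<le> B" "B \<le> C"
        using le by (simp_all add: A_def B_def C_def indicator_def)
      then have "norm ((A * B) *\<^sub>R f p) \<le> (A * C) *\<^sub>R norm (f p)"
        by (simp add: mult_left_mono mult_right_mono)
      then show ?thesis
        by (simp add: Pair A_def B_def C_def indicator_times algebra_simps)
    qed
  qed
  also have "\<dots> = (rect_integral ?n b r - rect_integral ?n a r) - (rect_integral ?n b q - rect_integral ?n a q)"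
    unfolding rect_integral_def using i(2) by simp
  finally show ?thesis .
qed

lemma slice_integral_diff_bound:
  fixes f :: "real \<times> real \<Rightarrow> 'a::euclidean_space"
  assumes f: "integrable lborel (\<lambda>t. f (x, t))" and le: "q \<le> y" "y \<le> r"
  shows "norm (slice_integral f x y - slice_integral f x q)
    \<le> slice_integral (\<lambda>p. norm (f p)) x r - slice_integral (\<lambda>p. norm (f p)) x q"
proof -
  let ?i = "\<lambda>y. indicator {0..y} :: real \<Rightarrow> real"
  have i: "integrable lborel (\<lambda>t. ?i y t *\<^sub>R f (x,t))" "integrable lborel (\<lambda>t. ?i y t *\<^sub>R norm (f (x,t)))" for y
    by (intro integrable_mult_indicator[OF _ f] integrable_mult_indicator[OF _ integrable_norm[OF f]]; simp)+
  have "norm (slice_integral f x y - slice_integral f x q) =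
     norm (LINT t|lborel. (?i y t *\<^sub>R f (x,t) - ?i q t *\<^sub>R f (x,t)))"
    unfolding slice_integral_def by (simp add: i)
  also have "\<dots> \<le> (LINT t|lborel. norm (?i y t *\<^sub>R f (x,t) - ?i q t *\<^sub>R f (x,t)))"
    by (rule integral_norm_bound)
  also have "\<dots> \<le> (LINT t|lborel. (?i r t *\<^sub>R norm (f (x,t)) - ?i q t *\<^sub>R norm (f (x,t))))"
  proof (rule integral_mono)
    show "integrable lborel (\<lambda>t. norm (?i y t *\<^sub>R f (x,t) - ?i q t *\<^sub>R f (x,t)))"
      by (rule integrable_norm) (simp add: i(1))
    show "integrable lborel (\<lambda>t. ?i r t *\<^sub>R norm (f (x,t)) - ?i q t *\<^sub>R norm (f (x,t)))"
      using i(2) by simp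
    fix t :: real
    show "norm (?i y t *\<^sub>R f (x,t) - ?i q t *\<^sub>R f (x,t)) \<le> ?i r t *\<^sub>R norm (f (x,t)) - ?i q t *\<^sub>R norm (f (x,t))"
      using le by (auto simp: indicator_def)
  qed
  also have "\<dots> = slice_integral (\<lambda>p. norm (f p)) x r - slice_integral (\<lambda>p. norm (f p)) x q"
    unfolding slice_integral_def using i(2) by simp
  finally show ?thesis .
qed

lemma AE_rect_integral_derivative_all:
  fixes f :: "real \<times> real \<Rightarrow> 'a::euclidean_space"
  assumes f: "integrable lborel f"
  shows "AE x in lborel. 0 < x \<longrightarrow> (\<forall>y.
    ((\<lambda>x. rect_integral f x y) has_vector_derivative slice_integral f x y) (at x))"
proof -
  let ?n = "\<lambda>p. norm (f p)"
  have "AE x in lborel. \<forall>q\<in>\<rat>. 0 < x \<longrightarrow> ((\<lambda>x. rect_integral f x q) has_vector_derivative slice_integral f x q) (at x)"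
    by (intro AE_ball_countable' AE_rect_integral_derivative f countable_rat)
  moreover have "AE x in lborel. \<forall>q\<in>\<rat>. 0 < x \<longrightarrow> ((\<lambda>x. rect_integral ?n x q) has_vector_derivative slice_integral ?n x q) (at x)"
    by (intro AE_ball_countable' AE_rect_integral_derivative integrable_norm f countable_rat)
  moreover have "AE x in lborel. integrable lborel (\<lambda>t. f (x, t))"
    using lborel_pair.AE_integrable_fst'[of f] f by (simp add: lborel_prod)
  ultimately show ?thesis
  proof eventually_elim
    case (elim x)
    note df = elim(1)[rule_format] and dn = elim(2)[rule_format] and int = elim(3)
    show ?case
    proof (intro impI allI)
      fix y assume x: "0 < x"
      let ?D = "\<lambda>\<phi> x'. \<phi> x' - \<phi> x"
      show "((\<lambda>x. rect_integral f x y) has_vector_derivative slice_integral f x y) (at x)"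
        unfolding has_vector_derivative_def has_derivative_at_alt
      proof (intro conjI allI impI)
        show "bounded_linear (\<lambda>k. k *\<^sub>R slice_integral f x y)" by (rule bounded_linear_scaleR_left)
      next
        fix e' :: real assume e': "e' > 0"
        define e where "e = e' / 4"
        have e: "e > 0" using e' by (simp add: e_def)
        have "isCont (slice_integral ?n x) y"
          using isCont_indefinite_lborel[OF integrable_norm[OF int]] unfolding slice_integral_def by simp
        then obtain d where d: "d > 0" "\<And>y'. \<bar>y' - y\<bar> < d \<Longrightarrow> \<bar>slice_integral ?n x y' - slice_integral ?n x y\<bar> < e / 2"
          using e unfolding continuous_at_eps_delta by (metis half_gt_zero dist_real_def)
        obtain q where q: "q \<in> \<rat>" "y - d < q" "q < y" using Rats_dense_in_real[of "y - d" y] d by auto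
        obtain r where r: "r \<in> \<rat>" "y < r" "r < y + d" using Rats_dense_in_real[of y "y + d"] d by auto
        define W where "W = slice_integral ?n x r - slice_integral ?n x q"
        have W: "norm (slice_integral f x y - slice_integral f x q) \<le> W"
          unfolding W_def using q r by (intro slice_integral_diff_bound int) auto
        have We: "W < e"
        proof -
          have "\<bar>slice_integral ?n x q - slice_integral ?n x y\<bar> < e / 2" "\<bar>slice_integral ?n x r - slice_integral ?n x y\<bar> < e / 2"
            by (rule d(2), use q r in linarith)+
          then show ?thesis unfolding W_def by linarith
        qed
        have W0: "0 \<le> W" using W norm_ge_zero order_trans by blast
        define w where "w = (\<lambda>x. rect_integral ?n x r - rect_integral ?n x q)"
        have "(w has_vector_derivative W) (at x)"
          unfolding w_def W_def using x q r by (intro has_vector_derivative_diff dn) auto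
        then obtain d1 where d1: "d1 > 0" "\<And>x'. norm (x' - x) < d1 \<Longrightarrow> norm (w x' - w x - (x' - x) *\<^sub>R W) \<le> e * norm (x' - x)"
          using e unfolding has_vector_derivative_def has_derivative_at_alt by blast
        obtain d2 where d2: "d2 > 0" "\<And>x'. norm (x' - x) < d2 \<Longrightarrow>
            norm (rect_integral f x' q - rect_integral f x q - (x' - x) *\<^sub>R slice_integral f x q) \<le> e * norm (x' - x)"
          using df[OF q(1) x] e unfolding has_vector_derivative_def has_derivative_at_alt by blast
        show "\<exists>d>0. \<forall>x'. norm (x' - x) < d \<longrightarrow>
          norm (rect_integral f x' y - rect_integral f x y - (x' - x) *\<^sub>R slice_integral f x y) \<le> e' * norm (x' - x)"
        proof (intro exI[of _ "min d1 d2"] conjI allI impI)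
          show "0 < min d1 d2" using d1 d2 by auto
          fix x' assume x': "norm (x' - x) < min d1 d2"
          let ?Y = "rect_integral f x' y - rect_integral f x y"
          let ?Q = "rect_integral f x' q - rect_integral f x q"
          have 1: "norm (?Y - ?Q) \<le> \<bar>w x' - w x\<bar>"
          proof (cases "x \<le> x'")
            case True
            then show ?thesis
              using rect_integral_diff_bound[OF f True, of q y r] q r by (simp add: w_def)
          next
            case False
            have "- (?Y - ?Q) = (rect_integral f x y - rect_integral f x' y) - (rect_integral f x q - rect_integral f x' q)"
              by simp
            also have "norm \<dots> \<le> w x - w x'"
              using rect_integral_diff_bound[OF f, of x' x q y r] False q r by (simp add: w_def)
            finally have "norm (- (?Y - ?Q)) \<le> \<bar>w x' - w x\<bar>" by linarith
            then show ?thesis by (simp only: norm_minus_cancel)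
          qed
          have "\<bar>w x' - w x - (x' - x) * W\<bar> \<le> e * \<bar>x' - x\<bar>" using d1(2)[of x'] x' by simp
          moreover have "\<bar>(x' - x) * W\<bar> \<le> e * \<bar>x' - x\<bar>"
            using We W0 by (simp add: abs_mult mult.commute mult_right_mono)
          ultimately have 2: "\<bar>w x' - w x\<bar> \<le> 2 * e * \<bar>x' - x\<bar>" by linarith
          have 3: "norm (?Q - (x' - x) *\<^sub>R slice_integral f x q) \<le> e * \<bar>x' - x\<bar>" using d2(2)[of x'] x' by simp
          have 4: "norm ((x' - x) *\<^sub>R (slice_integral f x q - slice_integral f x y)) \<le> e * \<bar>x' - x\<bar>"
            using mult_left_mono[of "norm (slice_integral f x q - slice_integral f x y)" e "\<bar>x' - x\<bar>"] W We
            by (simp add: norm_minus_commute mult.commute)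
          have eqY: "?Y - (x' - x) *\<^sub>R slice_integral f x y = (?Y - ?Q) + (?Q - (x' - x) *\<^sub>R slice_integral f x q)
             + (x' - x) *\<^sub>R (slice_integral f x q - slice_integral f x y)"
            by (simp add: algebra_simps)
          have "norm (?Y - (x' - x) *\<^sub>R slice_integral f x y) \<le> norm (?Y - ?Q) + norm (?Q - (x' - x) *\<^sub>R slice_integral f x q)
             + norm ((x' - x) *\<^sub>R (slice_integral f x q - slice_integral f x y))"
            unfolding eqY by (rule norm_triangle_le[OF add_right_mono[OF norm_triangle_ineq]])
          also have "\<dots> \<le> 4 * e * \<bar>x' - x\<bar>"
            using 1 2 3 4 by linarith
          finally show "norm (?Y - (x' - x) *\<^sub>R slice_integral f x y) \<le> e' * norm (x' - x)"
            by (simp add: e_def)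
        qed
      qed
    qed
  qed
qed


lemma measurable_slice_integral:
  fixes f :: "real \<times> real \<Rightarrow> 'a::euclidean_space"
  assumes f: "f \<in> borel_measurable borel"
  shows "(\<lambda>p. slice_integral f (fst p) (snd p)) \<in> borel_measurable (borel :: (real \<times> real) measure)"
proof -
  have [measurable]: "f \<in> borel_measurable (borel \<Otimes>\<^sub>M borel)"
    using f by (simp add: borel_prod)
  have "(\<lambda>p. LINT t|lborel. (if 0 \<le> t \<and> t \<le> snd p then f (fst p, t) else 0))
      \<in> borel_measurable (borel \<Otimes>\<^sub>M borel :: (real \<times> real) measure)"
    by measurable
  moreover have "slice_integral f (fst p) (snd p) = (LINT t|lborel. (if 0 \<le> t \<and> t \<le> snd p then f (fst p, t) else 0))" for p
    unfolding slice_integral_def by (intro Bochner_Integration.integral_cong) (auto simp: indicator_def)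
  ultimately show ?thesis by (simp add: borel_prod)
qed

lemma AE_fst_lborel:
  assumes "AE x in lborel. P x"
  shows "AE p in (lborel :: (real \<times> real) measure). P (fst p)"
proof -
  obtain N :: "real set" where N: "N \<in> null_sets lborel" "{x \<in> space lborel. \<not> P x} \<subseteq> N"
    using assms by (auto simp: eventually_ae_filter)
  have NN: "N \<in> sets borel" using N(1) by auto
  have "AE x in lborel. x \<notin> N" using N(1) by (rule AE_not_in)
  moreover have "{p \<in> space (lborel \<Otimes>\<^sub>M lborel). fst p \<notin> N} = (- N) \<times> (UNIV :: real set)"
    by (auto simp: space_pair_measure)
  then have "{p \<in> space (lborel \<Otimes>\<^sub>M lborel). fst p \<notin> N} \<in> sets (lborel \<Otimes>\<^sub>M lborel :: (real \<times> real) measure)"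
    using NN by (auto intro!: pair_measureI)
  ultimately have "AE p in (lborel \<Otimes>\<^sub>M lborel :: (real \<times> real) measure). fst p \<notin> N"
    by (intro lborel_pair.AE_pair_measure) auto
  then show ?thesis
    unfolding lborel_prod by eventually_elim (use N in auto)
qed

lemma AE_slice_integral_derivative:
  fixes f :: "real \<times> real \<Rightarrow> 'a::euclidean_space"
  assumes f: "integrable lborel f"
  shows "AE p in lborel. 0 < snd p \<longrightarrow> (slice_integral f (fst p) has_vector_derivative f p) (at (snd p))"
proof -
  define G where "G = (\<lambda>p. slice_integral f (fst p) (snd p))"
  have fm: "f \<in> borel_measurable borel" using f by auto
  have [measurable]: "f \<in> borel_measurable (lborel \<Otimes>\<^sub>M lborel)" "G \<in> borel_measurable (lborel \<Otimes>\<^sub>M lborel)"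
    using fm measurable_slice_integral[OF fm] unfolding G_def lborel_prod by simp_all
  (* Difference quotients along rational increments suffice, by continuity; this makes the
     set of points of differentiability measurable. *)
  define P where "P = (\<lambda>p. \<forall>n::nat. \<exists>m::nat. \<forall>r::rat. \<bar>of_rat r\<bar> < 1 / (real m + 1) \<longrightarrow>
      norm (G (fst p, snd p + of_rat r) - G p - of_rat r *\<^sub>R f p) \<le> \<bar>of_rat r\<bar> / (real n + 1))"
  have int: "AE x in lborel. integrable lborel (\<lambda>t. f (x, t))"
    using lborel_pair.AE_integrable_fst'[of f] f by (simp add: lborel_prod)
  have Pm: "{p \<in> space (lborel \<Otimes>\<^sub>M lborel). 0 < snd p \<longrightarrow> P p} \<in> sets (lborel \<Otimes>\<^sub>M lborel)"
    unfolding P_def by measurable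
  have "AE x in lborel. AE y in lborel. 0 < snd (x, y) \<longrightarrow> P (x, y)"
    using int
  proof eventually_elim
    case (elim x)
    have "AE y in lborel. 0 < y \<longrightarrow> ((\<lambda>y. integral {0..y} (\<lambda>t. f (x, t))) has_vector_derivative f (x, y)) (at y)"
      by (intro AE_has_vector_derivative_indefinite_integral set_borel_integral_eq_integral(1)
        integrable_set_lborel_real elim)
    then show ?case
    proof eventually_elim
      case (elim y)
      have sl: "integral {0..y} (\<lambda>t. f (x, t)) = slice_integral f x y" for y
        using set_borel_integral_eq_integral(2)[OF integrable_set_lborel_real[OF \<open>integrable lborel (\<lambda>t. f (x, t))\<close>], of 0 y]
        by (simp add: slice_integral_def set_lebesgue_integral_def)
      show ?case
      proof
        assume y: "0 < snd (x, y)"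
        then have D: "(slice_integral f x has_vector_derivative f (x, y)) (at y)"
          using elim by (simp add: sl)
        show "P (x, y)"
          unfolding P_def
        proof
          fix n :: nat
          obtain d where d: "d > 0" "\<And>y'. norm (y' - y) < d \<Longrightarrow>
             norm (slice_integral f x y' - slice_integral f x y - (y' - y) *\<^sub>R f (x, y)) \<le> 1 / (real n + 1) * norm (y' - y)"
          proof -
            have "0 < 1 / (real n + 1)" by simp
            with D show thesis
              using that unfolding has_vector_derivative_def has_derivative_at_alt by blast
          qed
          obtain m :: nat where m: "1 / (real m + 1) < d"
            using d(1) by (metis nat_approx_posE of_nat_Suc add.commute)
          show "\<exists>m::nat. \<forall>r::rat. \<bar>of_rat r\<bar> < 1 / (real m + 1) \<longrightarrow>
             norm (G (fst (x, y), snd (x, y) + of_rat r) - G (x, y) - of_rat r *\<^sub>R f (x, y)) \<le> \<bar>of_rat r\<bar> / (real n + 1)"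
          proof (intro exI[of _ m] allI impI)
            fix r :: rat assume "\<bar>of_rat r\<bar> < 1 / (real m + 1)"
            then show "norm (G (fst (x, y), snd (x, y) + of_rat r) - G (x, y) - of_rat r *\<^sub>R f (x, y)) \<le> \<bar>of_rat r\<bar> / (real n + 1)"
              using d(2)[of "y + of_rat r"] m by (simp add: G_def)
          qed
        qed
      qed
    qed
  qed
  then have "AE p in lborel. 0 < snd p \<longrightarrow> P p"
    using lborel_pair.AE_pair_measure[OF Pm] unfolding lborel_prod by blast
  moreover have "AE p in (lborel :: (real \<times> real) measure). integrable lborel (\<lambda>t. f (fst p, t))"
    by (rule AE_fst_lborel[OF int])
  ultimately show ?thesis
  proof eventually_elim
    case (elim p)
    obtain x y where p: "p = (x, y)" by (cases p)
    have cont: "isCont (slice_integral f x) y'" for y'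
      using isCont_indefinite_lborel[of "\<lambda>t. f (x, t)"] elim(2) p unfolding slice_integral_def by simp
    show ?case
    proof
      assume "0 < snd p"
      then have P: "P (x, y)" using elim(1) p by simp
      have "(slice_integral f x has_vector_derivative f (x, y)) (at y)"
        unfolding has_vector_derivative_def has_derivative_at_alt
      proof (intro conjI allI impI)
        show "bounded_linear (\<lambda>k. k *\<^sub>R f (x, y))" by (rule bounded_linear_scaleR_left)
      next
        fix e :: real assume "e > 0"
        then obtain n :: nat where n: "1 / (real n + 1) < e"
          by (metis nat_approx_posE of_nat_Suc add.commute)
        obtain m :: nat where m: "\<And>r::rat. \<bar>of_rat r\<bar> < 1 / (real m + 1) \<Longrightarrow>
           norm (slice_integral f x (y + of_rat r) - slice_integral f x y - of_rat r *\<^sub>R f (x, y)) \<le> \<bar>of_rat r\<bar> / (real n + 1)"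
          using P unfolding P_def by (auto simp: G_def)
        define \<phi> where "\<phi> = (\<lambda>k. norm (slice_integral f x (y + k) - slice_integral f x y - k *\<^sub>R f (x, y)) - \<bar>k\<bar> / (real n + 1))"
        have c\<phi>: "isCont \<phi> k" for k
          unfolding \<phi>_def by (intro continuous_intros isCont_o2[OF _ cont]) auto
        have le: "\<phi> k \<le> 0" if k: "\<bar>k\<bar> < 1 / (real m + 1)" for k
        proof (rule ccontr)
          assume "\<not> \<phi> k \<le> 0"
          then have pos: "\<phi> k > 0" by simp
          have "eventually (\<lambda>k'. \<phi> k' > 0) (at k)"
            using c\<phi>[of k] pos unfolding isCont_def by (rule order_tendstoD(1))
          then obtain d where d: "d > 0" "\<And>k'. k' \<noteq> k \<Longrightarrow> dist k' k < d \<Longrightarrow> \<phi> k' > 0"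
            unfolding eventually_at by auto
          define d' where "d' = min d (1 / (real m + 1) - \<bar>k\<bar>)"
          have "d' > 0" using d k by (simp add: d'_def)
          then obtain r :: rat where r: "k < of_rat r" "of_rat r < k + d'"
            using of_rat_dense[of k "k + d'"] by auto
          have "\<phi> (of_rat r) > 0" using r by (intro d(2)) (auto simp: dist_real_def d'_def)
          moreover have "\<bar>of_rat r :: real\<bar> < 1 / (real m + 1)" using r unfolding d'_def by linarith
          ultimately show False using m[of r] by (simp add: \<phi>_def)
        qed
        show "\<exists>d>0. \<forall>y'. norm (y' - y) < d \<longrightarrow>
          norm (slice_integral f x y' - slice_integral f x y - (y' - y) *\<^sub>R f (x, y)) \<le> e * norm (y' - y)"
        proof (intro exI[of _ "1 / (real m + 1)"] conjI allI impI)
          show "0 < 1 / (real m + 1)" by simp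
          fix y' assume "norm (y' - y) < 1 / (real m + 1)"
          then have "norm (slice_integral f x y' - slice_integral f x y - (y' - y) *\<^sub>R f (x, y)) \<le> 1 / (real n + 1) * \<bar>y' - y\<bar>"
            using le[of "y' - y"] by (simp add: \<phi>_def)
          also have "\<dots> \<le> e * \<bar>y' - y\<bar>" using n by (intro mult_right_mono) auto
          finally show "norm (slice_integral f x y' - slice_integral f x y - (y' - y) *\<^sub>R f (x, y)) \<le> e * norm (y' - y)"
            by simp
        qed
      qed
      then show "(slice_integral f (fst p) has_vector_derivative f p) (at (snd p))" by (simp add: p)
    qed
  qed
qed

definition unit_square :: "(real \<times> real) set" where
  "unit_square = {0..1} \<times> {0..1}"

definition square_integrable :: "(real \<times> real \<Rightarrow> 'a::euclidean_space) \<Rightarrow> bool" where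
  "square_integrable f \<longleftrightarrow> f \<in> borel_measurable (lebesgue_on unit_square) \<and>
     integrable (lebesgue_on unit_square) (\<lambda>p. (norm (f p))\<^sup>2)"

lemma rectangle_eq_cbox: "{a..b} \<times> {c..d} = cbox (a, c) (b, d :: real)" for a b :: real
  by (simp add: cbox_Pair_eq)

lemma rectangle_sets [simp]: "{a..b} \<times> {c..d} \<in> sets (lebesgue :: (real \<times> real) measure)"
  unfolding rectangle_eq_cbox by simp

lemma unit_square_sets [simp]: "unit_square \<in> sets lebesgue"
  by (simp add: unit_square_def)

lemma finite_measure_unit_square: "finite_measure (lebesgue_on unit_square)"
proof -
  have "unit_square \<in> lmeasurable"
    unfolding unit_square_def rectangle_eq_cbox by simp
  then show ?thesis by (rule finite_measure_lebesgue_on)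
qed

lemma square_integrable_cong_AE:
  assumes "square_integrable f" "AE p in lebesgue_on unit_square. f p = g p"
  shows "square_integrable g"
proof -
  have "(\<lambda>p. indicator unit_square p *\<^sub>R f p) \<in> borel_measurable lebesgue"
    using assms(1) by (simp add: square_integrable_def borel_measurable_restrict_space_iff)
  moreover have "AE p in lebesgue. p \<in> unit_square \<longrightarrow> f p = g p"
    using assms(2) by (simp add: AE_restrict_space_iff)
  then have "AE p in lebesgue. indicator unit_square p *\<^sub>R f p = indicator unit_square p *\<^sub>R g p"
    by eventually_elim (auto simp: indicator_def)
  ultimately have "(\<lambda>p. indicator unit_square p *\<^sub>R g p) \<in> borel_measurable lebesgue"
    by (rule borel_measurable_AE)
  then have g: "g \<in> borel_measurable (lebesgue_on unit_square)"
    by (simp add: borel_measurable_restrict_space_iff)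
  have "integrable (lebesgue_on unit_square) (\<lambda>p. (norm (g p))\<^sup>2)"
  proof (rule integrable_cong_AE_imp)
    show "integrable (lebesgue_on unit_square) (\<lambda>p. (norm (f p))\<^sup>2)"
      using assms(1) by (simp add: square_integrable_def)
    show "(\<lambda>p. (norm (g p))\<^sup>2) \<in> borel_measurable (lebesgue_on unit_square)"
      using g by simp
    show "AE p in lebesgue_on unit_square. (norm (f p))\<^sup>2 = (norm (g p))\<^sup>2"
      using assms(2) by eventually_elim simp
  qed
  with g show ?thesis by (simp add: square_integrable_def)
qed

lemma square_integrable_inner:
  assumes "square_integrable f" "square_integrable g"
  shows "integrable (lebesgue_on unit_square) (\<lambda>p. f p \<bullet> g p)"
proof (rule Bochner_Integration.integrable_bound)
  show "integrable (lebesgue_on unit_square) (\<lambda>p. (norm (f p))\<^sup>2 + (norm (g p))\<^sup>2)"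
    using assms by (simp add: square_integrable_def)
  show "(\<lambda>p. f p \<bullet> g p) \<in> borel_measurable (lebesgue_on unit_square)"
    using assms by (intro borel_measurable_inner) (auto simp: square_integrable_def)
  have "norm (f p \<bullet> g p) \<le> norm ((norm (f p))\<^sup>2 + (norm (g p))\<^sup>2)" for p
  proof -
    have "\<bar>f p \<bullet> g p\<bar> \<le> norm (f p) * norm (g p)" by (rule Cauchy_Schwarz_ineq2)
    moreover have "2 * (norm (f p) * norm (g p)) \<le> (norm (f p))\<^sup>2 + (norm (g p))\<^sup>2"
      using sum_squares_bound[of "norm (f p)" "norm (g p)"] by simp
    moreover have "0 \<le> norm (f p) * norm (g p)" by simp
    ultimately show ?thesis unfolding real_norm_def by linarith
  qed
  then show "AE p in lebesgue_on unit_square. norm (f p \<bullet> g p) \<le> norm ((norm (f p))\<^sup>2 + (norm (g p))\<^sup>2)"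
    by (intro AE_I2)
qed

lemma square_integrable_0 [simp]: "square_integrable (\<lambda>p. 0)"
  by (simp add: square_integrable_def)

lemma square_integrable_add:
  assumes "square_integrable f" "square_integrable g"
  shows "square_integrable (\<lambda>p. f p + g p)"
proof -
  have "(norm (f p + g p))\<^sup>2 = f p \<bullet> f p + 2 * (f p \<bullet> g p) + g p \<bullet> g p" for p
    by (simp add: power2_norm_eq_inner algebra_simps inner_commute)
  then have "integrable (lebesgue_on unit_square) (\<lambda>p. (norm (f p + g p))\<^sup>2)"
    using square_integrable_inner[OF assms(1) assms(1)] square_integrable_inner[OF assms]
      square_integrable_inner[OF assms(2) assms(2)] by simp
  moreover have "f \<in> borel_measurable (lebesgue_on unit_square)" "g \<in> borel_measurable (lebesgue_on unit_square)"
    using assms by (simp_all add: square_integrable_def)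
  then have "(\<lambda>p. f p + g p) \<in> borel_measurable (lebesgue_on unit_square)"
    by (rule borel_measurable_add)
  ultimately show ?thesis by (simp add: square_integrable_def)
qed

lemma square_integrable_scaleR:
  assumes "square_integrable f"
  shows "square_integrable (\<lambda>p. c *\<^sub>R f p)"
proof -
  have "f \<in> borel_measurable (lebesgue_on unit_square)"
    using assms by (simp add: square_integrable_def)
  then have "(\<lambda>p. c *\<^sub>R f p) \<in> borel_measurable (lebesgue_on unit_square)"
    by (rule borel_measurable_scaleR[OF borel_measurable_const])
  then show ?thesis
    using assms by (simp add: square_integrable_def power_mult_distrib)
qed

lemma square_integrable_uminus:
  assumes "square_integrable f"
  shows "square_integrable (\<lambda>p. - f p)"
  using square_integrable_scaleR[OF assms, of "-1"] by simp

lemma square_integrable_imp_integrable: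
  assumes "square_integrable f"
  shows "integrable (lebesgue_on unit_square) f"
proof (rule Bochner_Integration.integrable_bound)
  interpret finite_measure "lebesgue_on unit_square" by (rule finite_measure_unit_square)
  show "integrable (lebesgue_on unit_square) (\<lambda>p. 1 + (norm (f p))\<^sup>2)"
    using assms by (simp add: square_integrable_def)
  show "f \<in> borel_measurable (lebesgue_on unit_square)"
    using assms by (simp add: square_integrable_def)
  have "norm (f p) \<le> norm (1 + (norm (f p))\<^sup>2)" for p
  proof -
    have "2 * norm (f p) \<le> 1 + (norm (f p))\<^sup>2"
      using sum_squares_bound[of 1 "norm (f p)"] by simp
    moreover have "0 \<le> norm (f p)" by simp
    ultimately show ?thesis unfolding real_norm_def by linarith
  qed
  then show "AE p in lebesgue_on unit_square. norm (f p) \<le> norm (1 + (norm (f p))\<^sup>2)"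
    by (intro AE_I2)
qed

lemma integral_norm_square_eq_0_iff:
  assumes "square_integrable f"
  shows "(LINT p|lebesgue_on unit_square. f p \<bullet> f p) = 0 \<longleftrightarrow> (AE p in lebesgue_on unit_square. f p = 0)"
  using integral_nonneg_eq_0_iff_AE[OF square_integrable_inner[OF assms assms]] by simp

definition L2_eq :: "(real \<times> real \<Rightarrow> 'a::euclidean_space) \<Rightarrow> (real \<times> real \<Rightarrow> 'a) \<Rightarrow> bool" where
  "L2_eq f g \<longleftrightarrow> square_integrable f \<and> square_integrable g \<and> (AE p in lebesgue_on unit_square. f p = g p)"

(* The Hilbert space L^2(Q, 'a) of a.e. equivalence classes; rep_L2 picks a representative,
   which is determined only up to a null set. *)
quotient_type (overloaded) 'a L2 = "real \<times> real \<Rightarrow> 'a::euclidean_space" / partial: L2_eq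
proof (rule part_equivpI)
  show "\<exists>f :: real \<times> real \<Rightarrow> 'a. L2_eq f f"
    by (intro exI[of _ "\<lambda>p. 0"]) (simp add: L2_eq_def)
  show "symp (L2_eq :: (real \<times> real \<Rightarrow> 'a) \<Rightarrow> _)"
    by (auto simp: symp_def L2_eq_def elim: AE_mp)
  show "transp (L2_eq :: (real \<times> real \<Rightarrow> 'a) \<Rightarrow> _)"
    by (auto simp: transp_def L2_eq_def elim: AE_mp)
qed

instantiation L2 :: (euclidean_space) real_vector
begin

lift_definition zero_L2 :: "'a L2" is "\<lambda>p. 0"
  by (simp add: L2_eq_def)

lift_definition plus_L2 :: "'a L2 \<Rightarrow> 'a L2 \<Rightarrow> 'a L2" is "\<lambda>f g p. f p + g p"
  unfolding L2_eq_def by (auto intro: square_integrable_add)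

lift_definition uminus_L2 :: "'a L2 \<Rightarrow> 'a L2" is "\<lambda>f p. - f p"
  unfolding L2_eq_def by (auto intro: square_integrable_uminus)

lift_definition scaleR_L2 :: "real \<Rightarrow> 'a L2 \<Rightarrow> 'a L2" is "\<lambda>c f p. c *\<^sub>R f p"
  unfolding L2_eq_def by (auto intro: square_integrable_scaleR elim: AE_mp)

definition minus_L2 :: "'a L2 \<Rightarrow> 'a L2 \<Rightarrow> 'a L2" where "minus_L2 f g = f + - g"

instance
proof
  fix f g h :: "'a L2" and c d :: real
  show "f + g + h = f + (g + h)"
    by transfer (auto simp: L2_eq_def add.assoc intro!: square_integrable_add)
  show "f + g = g + f"
    by transfer (auto simp: L2_eq_def add.commute intro!: square_integrable_add)
  show "0 + f = f"
    by transfer (auto simp: L2_eq_def)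
  show "- f + f = 0"
    by transfer (auto simp: L2_eq_def)
  show "f - g = f + - g" by (simp add: minus_L2_def)
  show "c *\<^sub>R (f + g) = c *\<^sub>R f + c *\<^sub>R g"
    by transfer (auto simp: L2_eq_def scaleR_add_right intro!: square_integrable_add square_integrable_scaleR)
  show "(c + d) *\<^sub>R f = c *\<^sub>R f + d *\<^sub>R f"
    by transfer (auto simp: L2_eq_def scaleR_add_left intro!: square_integrable_add square_integrable_scaleR)
  show "c *\<^sub>R d *\<^sub>R f = (c * d) *\<^sub>R f"
    by transfer (auto simp: L2_eq_def intro!: square_integrable_scaleR)
  show "1 *\<^sub>R f = f"
    by transfer (auto simp: L2_eq_def)
qed

end

instantiation L2 :: (euclidean_space) real_inner
begin

lift_definition inner_L2 :: "'a L2 \<Rightarrow> 'a L2 \<Rightarrow> real" is "\<lambda>f g. LINT p|lebesgue_on unit_square. f p \<bullet> g p"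
proof -
  fix f f' g g' :: "real \<times> real \<Rightarrow> 'a"
  assume a: "L2_eq f f'" "L2_eq g g'"
  then have "AE p in lebesgue_on unit_square. f p \<bullet> g p = f' p \<bullet> g' p"
    by (auto simp: L2_eq_def)
  with a show "(LINT p|lebesgue_on unit_square. f p \<bullet> g p) = (LINT p|lebesgue_on unit_square. f' p \<bullet> g' p)"
    by (intro integral_cong_AE borel_measurable_integrable square_integrable_inner) (auto simp: L2_eq_def)
qed

definition norm_L2 :: "'a L2 \<Rightarrow> real" where "norm_L2 f = sqrt (f \<bullet> f)"
definition dist_L2 :: "'a L2 \<Rightarrow> 'a L2 \<Rightarrow> real" where "dist_L2 f g = norm (f - g)"
definition sgn_L2 :: "'a L2 \<Rightarrow> 'a L2" where "sgn_L2 f = f /\<^sub>R norm f"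
definition uniformity_L2 :: "('a L2 \<times> 'a L2) filter" where
  "uniformity_L2 = (INF e\<in>{0<..}. principal {(f, g). dist f g < e})"
definition open_L2 :: "'a L2 set \<Rightarrow> bool" where
  "open_L2 U = (\<forall>f\<in>U. \<forall>\<^sub>F (f', g) in uniformity. f' = f \<longrightarrow> g \<in> U)"

instance
proof
  fix f g h :: "'a L2" and c :: real
  show "f \<bullet> g = g \<bullet> f"
    by transfer (simp add: inner_commute)
  show "(f + g) \<bullet> h = f \<bullet> h + g \<bullet> h"
    by transfer (auto simp: L2_eq_def inner_add_left square_integrable_inner)
  show "c *\<^sub>R f \<bullet> g = c * (f \<bullet> g)"
    by transfer simp
  show "0 \<le> f \<bullet> f"
    by transfer simp
  show "f \<bullet> f = 0 \<longleftrightarrow> f = 0"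
    by transfer (auto simp: L2_eq_def integral_norm_square_eq_0_iff)
qed (fact norm_L2_def dist_L2_def sgn_L2_def uniformity_L2_def open_L2_def)+

end

(* One-sided at the edges of the square; vector_derivative yields an unspecified value where the
   derivative does not exist. *)
definition pdx :: "(real \<times> real \<Rightarrow> 'b::real_normed_vector) \<Rightarrow> real \<times> real \<Rightarrow> 'b" where
  "pdx z = (\<lambda>(x, y). vector_derivative (\<lambda>s. z (s, y)) (at x within {0..1}))"

definition pdy :: "(real \<times> real \<Rightarrow> 'b::real_normed_vector) \<Rightarrow> real \<times> real \<Rightarrow> 'b" where
  "pdy z = (\<lambda>(x, y). vector_derivative (\<lambda>t. z (x, t)) (at y within {0..1}))"

(* z_xy = (z_x)_y *)
abbreviation pdxy :: "(real \<times> real \<Rightarrow> 'b::real_normed_vector) \<Rightarrow> real \<times> real \<Rightarrow> 'b" where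
  "pdxy z \<equiv> pdy (pdx z)"

definition primitive :: "(real \<times> real \<Rightarrow> 'a::euclidean_space) \<Rightarrow> real \<times> real \<Rightarrow> 'a" where
  "primitive l = (\<lambda>(x, y). if (x, y) \<in> unit_square
     then LINT p|lebesgue_on ({0..x} \<times> {0..y}). l p else 0)"

lemma primitive_eq_rect_integral:
  assumes l: "square_integrable l"
  obtains g where "integrable lborel g"
    "\<And>x y. (x, y) \<in> unit_square \<Longrightarrow> primitive l (x, y) = rect_integral g x y"
    "AE p in lborel. p \<in> unit_square \<longrightarrow> l p = g p"
proof -
  let ?l = "\<lambda>p. indicator unit_square p *\<^sub>R l p"
  have il: "integrable lebesgue ?l"
    using square_integrable_imp_integrable[OF l] by (simp add: integrable_restrict_space)
  obtain g where g: "g \<in> borel_measurable lborel" "AE p in lborel. ?l p = g p"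
    using ex_borel_AE_eq[OF borel_measurable_integrable[OF il]] by auto
  have gl: "AE p in lebesgue. ?l p = g p" using g(2) by (simp add: AE_completion_iff)
  have gm: "g \<in> borel_measurable lebesgue" using g(1) by (rule measurable_completion)
  have "integrable lebesgue g" by (rule integrable_cong_AE_imp[OF il gm gl])
  then have ig: "integrable lborel g" using integrable_completion[OF g(1)] by simp
  have "primitive l (x, y) = rect_integral g x y" if xy: "(x, y) \<in> unit_square" for x y
  proof -
    let ?i = "indicator ({0..x} \<times> {0..y}) :: real \<times> real \<Rightarrow> real"
    have "primitive l (x, y) = (LINT p|lebesgue. ?i p *\<^sub>R l p)"
      using xy by (simp add: primitive_def integral_restrict_space)
    also have "\<dots> = (LINT p|lebesgue. ?i p *\<^sub>R ?l p)"
      using xy by (intro Bochner_Integration.integral_cong) (auto simp: unit_square_def indicator_def)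
    also have "\<dots> = (LINT p|lebesgue. ?i p *\<^sub>R g p)"
    proof (rule integral_cong_AE)
      show "(\<lambda>p. ?i p *\<^sub>R ?l p) \<in> borel_measurable lebesgue"
        by (rule borel_measurable_scaleR[OF borel_measurable_indicator borel_measurable_integrable[OF il]]) simp
      show "(\<lambda>p. ?i p *\<^sub>R g p) \<in> borel_measurable lebesgue"
        by (rule borel_measurable_scaleR[OF borel_measurable_indicator gm]) simp
      show "AE p in lebesgue. ?i p *\<^sub>R ?l p = ?i p *\<^sub>R g p" using gl by eventually_elim simp
    qed
    also have "\<dots> = rect_integral g x y"
      unfolding rect_integral_def
      by (rule integral_completion, rule borel_measurable_scaleR[OF borel_measurable_indicator g(1)])
         (auto intro!: borel_closed closed_Times)
    finally show ?thesis .
  qed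
  moreover have "AE p in lborel. p \<in> unit_square \<longrightarrow> l p = g p"
    using g(2) by eventually_elim (auto simp: indicator_def split: if_splits)
  ultimately show thesis using that ig by blast
qed

(* The density of an AC_0^2 function is its iterated partial derivative, a.e.  This makes the
   inner product below, which is written with z_xy itself, well behaved. *)
lemma AE_pdxy_primitive:
  assumes l: "square_integrable l"
  shows "AE p in lebesgue_on unit_square. pdxy (primitive l) p = l p"
proof -
  obtain g where g: "integrable lborel g"
    "\<And>x y. (x, y) \<in> unit_square \<Longrightarrow> primitive l (x, y) = rect_integral g x y"
    "AE p in lborel. p \<in> unit_square \<longrightarrow> l p = g p"
    using primitive_eq_rect_integral[OF l] by blast
  have "AE p :: real \<times> real in lborel. p \<bullet> (1, 0) \<noteq> 0" "AE p :: real \<times> real in lborel. p \<bullet> (0, 1) \<noteq> 0"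
    by (intro AE_lborel_inner_neq; simp add: Basis_prod_def)+
  moreover note AE_fst_lborel[OF AE_rect_integral_derivative_all[OF g(1)]] AE_slice_integral_derivative[OF g(1)] g(3)
  ultimately have "AE p in lborel. p \<in> unit_square \<longrightarrow> pdxy (primitive l) p = l p"
  proof eventually_elim
    case (elim p)
    obtain x y where p: "p = (x, y)" by (cases p)
    show ?case
    proof
      assume Q: "p \<in> unit_square"
      then have xy: "0 < x" "x \<le> 1" "0 < y" "y \<le> 1"
        using elim(1,2) by (auto simp: p unit_square_def)
      have dx: "pdx (primitive l) (x, t) = slice_integral g x t" if t: "t \<in> {0..1}" for t
      proof -
        have "((\<lambda>s. rect_integral g s t) has_vector_derivative slice_integral g x t) (at x within {0..1})"
          using elim(3) xy p by (auto intro: has_vector_derivative_at_within)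
        then have "((\<lambda>s. primitive l (s, t)) has_vector_derivative slice_integral g x t) (at x within {0..1})"
          by (rule has_vector_derivative_transform[rotated 2]) (use g(2) xy t in \<open>auto simp: unit_square_def\<close>)
        then have "vector_derivative (\<lambda>s. primitive l (s, t)) (at x within {0..1}) = slice_integral g x t"
          by (rule vector_derivative_within_closed_interval[rotated 2]) (use xy in auto)
        then show ?thesis by (simp add: pdx_def)
      qed
      have "(slice_integral g x has_vector_derivative g (x, y)) (at y within {0..1})"
        using elim(4) xy p by (auto intro: has_vector_derivative_at_within)
      then have "((\<lambda>t. pdx (primitive l) (x, t)) has_vector_derivative g (x, y)) (at y within {0..1})"
        by (rule has_vector_derivative_transform[rotated 2]) (use dx xy in auto)
      then have "vector_derivative (\<lambda>t. pdx (primitive l) (x, t)) (at y within {0..1}) = g (x, y)"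
        by (rule vector_derivative_within_closed_interval[rotated 2]) (use xy in auto)
      then show "pdxy (primitive l) p = l p"
        using elim(5) Q by (simp add: pdy_def p)
    qed
  qed
  then have "AE p in lebesgue. p \<in> unit_square \<longrightarrow> pdxy (primitive l) p = l p"
    by (simp add: AE_completion_iff)
  then show ?thesis by (simp add: AE_restrict_space_iff)
qed

lemma integrable_on_rectangle:
  assumes l: "square_integrable l" and xy: "(x, y) \<in> unit_square"
  shows "integrable (lebesgue_on ({0..x} \<times> {0..y})) l"
proof -
  have il: "integrable lebesgue (\<lambda>p. indicator unit_square p *\<^sub>R l p)"
    using square_integrable_imp_integrable[OF l] by (simp add: integrable_restrict_space)
  have "integrable lebesgue (\<lambda>p. indicator ({0..x} \<times> {0..y}) p *\<^sub>R indicator unit_square p *\<^sub>R l p)"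
    by (rule integrable_mult_indicator[OF _ il]) simp
  moreover have "(\<lambda>p. indicator ({0..x} \<times> {0..y}) p *\<^sub>R indicator unit_square p *\<^sub>R l p)
      = (\<lambda>p. indicator ({0..x} \<times> {0..y}) p *\<^sub>R l p)"
    by (rule ext) (use xy in \<open>auto simp: unit_square_def indicator_def\<close>)
  ultimately have "integrable lebesgue (\<lambda>p. indicator ({0..x} \<times> {0..y}) p *\<^sub>R l p)"
    by (simp only:)
  then show ?thesis by (simp add: integrable_restrict_space)
qed

lemma primitive_0: "primitive (\<lambda>p. 0) = (\<lambda>p. 0)"
  by (auto simp: primitive_def)

lemma primitive_add:
  assumes "square_integrable l" "square_integrable m"
  shows "primitive (\<lambda>p. l p + m p) p = primitive l p + primitive m p"
  using assms by (cases p) (simp add: primitive_def integrable_on_rectangle)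

lemma primitive_scaleR: "primitive (\<lambda>p. c *\<^sub>R l p) p = c *\<^sub>R primitive l p"
  by (cases p) (simp add: primitive_def)

lemma primitive_uminus: "primitive (\<lambda>p. - l p) p = - primitive l p"
  using primitive_scaleR[of "-1"] by simp

lemma primitive_eq_0:
  assumes l: "square_integrable l" "AE p in lebesgue_on unit_square. l p = 0"
  shows "primitive l p = 0"
proof (cases p)
  case (Pair x y)
  have "AE p in lebesgue. p \<in> unit_square \<longrightarrow> l p = 0"
    using l(2) by (simp add: AE_restrict_space_iff)
  then have "AE p in lebesgue_on ({0..x} \<times> {0..y}). l p = 0" if "(x, y) \<in> unit_square"
    using that by (subst AE_restrict_space_iff) (auto simp: unit_square_def elim!: eventually_mono)
  then show ?thesis
    by (auto simp: Pair primitive_def intro!: integral_eq_zero_AE)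
qed

(* AC_0^2(Q, 'a), as the functions z(x, y) = int_0^x int_0^y l with l in L^2(Q, 'a).  They are
   extended by 0 outside Q, so that equality of elements is equality of functions on Q. *)
typedef (overloaded) 'a AC02 = "{primitive l | l :: real \<times> real \<Rightarrow> 'a::euclidean_space. square_integrable l}"
  by (auto intro: square_integrable_0)

setup_lifting type_definition_AC02

lemma AC02_square_integrable_pdxy:
  fixes z :: "'a::euclidean_space AC02"
  shows "square_integrable (pdxy (Rep_AC02 z))" "primitive (pdxy (Rep_AC02 z)) = Rep_AC02 z"
proof -
  obtain l where l: "square_integrable l" "Rep_AC02 z = primitive l"
    using Rep_AC02[of z] by auto
  have AE: "AE p in lebesgue_on unit_square. l p = pdxy (Rep_AC02 z) p"
    using AE_pdxy_primitive[OF l(1)] unfolding l(2) by eventually_elim simp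
  show sq: "square_integrable (pdxy (Rep_AC02 z))"
    by (rule square_integrable_cong_AE[OF l(1) AE])
  show "primitive (pdxy (Rep_AC02 z)) = Rep_AC02 z"
  proof
    fix p
    have "primitive (\<lambda>p. pdxy (Rep_AC02 z) p + - l p) p = 0"
      using AE by (intro primitive_eq_0 square_integrable_add sq square_integrable_uminus l(1)) (auto elim: eventually_mono)
    then show "primitive (pdxy (Rep_AC02 z)) p = Rep_AC02 z p"
      unfolding primitive_add[OF sq square_integrable_uminus[OF l(1)]] primitive_uminus by (simp add: l(2))
  qed
qed

instantiation AC02 :: (euclidean_space) real_vector
begin

lift_definition zero_AC02 :: "'a AC02" is "\<lambda>p. 0"
  by (intro exI[of _ "\<lambda>p. 0"]) (simp add: primitive_0)

lift_definition plus_AC02 :: "'a AC02 \<Rightarrow> 'a AC02 \<Rightarrow> 'a AC02" is "\<lambda>z w p. z p + w p"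
proof -
  fix z w :: "real \<times> real \<Rightarrow> 'a"
  assume "\<exists>l. z = primitive l \<and> square_integrable l" "\<exists>l. w = primitive l \<and> square_integrable l"
  then obtain l m where "square_integrable l" "z = primitive l" "square_integrable m" "w = primitive m"
    by auto
  then show "\<exists>l. (\<lambda>p. z p + w p) = primitive l \<and> square_integrable l"
    by (auto intro!: exI[of _ "\<lambda>p. l p + m p"] simp: primitive_add square_integrable_add)
qed

lift_definition scaleR_AC02 :: "real \<Rightarrow> 'a AC02 \<Rightarrow> 'a AC02" is "\<lambda>c z p. c *\<^sub>R z p"
proof -
  fix c :: real and z :: "real \<times> real \<Rightarrow> 'a"
  assume "\<exists>l. z = primitive l \<and> square_integrable l"
  then obtain l where "square_integrable l" "z = primitive l"
    by auto
  then show "\<exists>l. (\<lambda>p. c *\<^sub>R z p) = primitive l \<and> square_integrable l"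
    by (auto intro!: exI[of _ "\<lambda>p. c *\<^sub>R l p"] simp: primitive_scaleR square_integrable_scaleR)
qed

definition uminus_AC02 :: "'a AC02 \<Rightarrow> 'a AC02" where "uminus_AC02 z = (- 1) *\<^sub>R z"
definition minus_AC02 :: "'a AC02 \<Rightarrow> 'a AC02 \<Rightarrow> 'a AC02" where "minus_AC02 z w = z + - w"

instance
proof
  fix u z w :: "'a AC02" and c d :: real
  show "u + z + w = u + (z + w)" by transfer (simp add: add.assoc)
  show "z + w = w + z" by transfer (simp add: add.commute)
  show "0 + z = z" by transfer simp
  show "- z + z = 0" unfolding uminus_AC02_def by transfer simp
  show "z - w = z + - w" by (simp add: minus_AC02_def)
  show "c *\<^sub>R (z + w) = c *\<^sub>R z + c *\<^sub>R w" by transfer (simp add: scaleR_add_right)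
  show "(c + d) *\<^sub>R z = c *\<^sub>R z + d *\<^sub>R z" by transfer (simp add: scaleR_add_left)
  show "c *\<^sub>R d *\<^sub>R z = (c * d) *\<^sub>R z" by transfer simp
  show "1 *\<^sub>R z = z" by transfer simp
qed

end

lemma AE_pdxy_add:
  "AE p in lebesgue_on unit_square. pdxy (Rep_AC02 (z + w)) p = pdxy (Rep_AC02 z) p + pdxy (Rep_AC02 w) p"
proof -
  let ?l = "\<lambda>p. pdxy (Rep_AC02 z) p + pdxy (Rep_AC02 w) p"
  have "Rep_AC02 (z + w) = primitive ?l"
    by (rule ext) (simp add: plus_AC02.rep_eq primitive_add AC02_square_integrable_pdxy)
  then show ?thesis
    using AE_pdxy_primitive[OF square_integrable_add[OF AC02_square_integrable_pdxy(1)[of z] AC02_square_integrable_pdxy(1)[of w]]]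
    by simp
qed

lemma AE_pdxy_scaleR:
  "AE p in lebesgue_on unit_square. pdxy (Rep_AC02 (c *\<^sub>R z)) p = c *\<^sub>R pdxy (Rep_AC02 z) p"
proof -
  let ?l = "\<lambda>p. c *\<^sub>R pdxy (Rep_AC02 z) p"
  have "Rep_AC02 (c *\<^sub>R z) = primitive ?l"
    by (rule ext) (simp add: scaleR_AC02.rep_eq primitive_scaleR AC02_square_integrable_pdxy)
  then show ?thesis
    using AE_pdxy_primitive[OF square_integrable_scaleR[OF AC02_square_integrable_pdxy(1)[of z], of c]]
    by simp
qed

instantiation AC02 :: (euclidean_space) real_inner
begin

definition inner_AC02 :: "'a AC02 \<Rightarrow> 'a AC02 \<Rightarrow> real" where
  "inner_AC02 z w = (LINT p|lebesgue_on unit_square. pdxy (Rep_AC02 z) p \<bullet> pdxy (Rep_AC02 w) p)"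

definition norm_AC02 :: "'a AC02 \<Rightarrow> real" where "norm_AC02 z = sqrt (z \<bullet> z)"
definition dist_AC02 :: "'a AC02 \<Rightarrow> 'a AC02 \<Rightarrow> real" where "dist_AC02 z w = norm (z - w)"
definition sgn_AC02 :: "'a AC02 \<Rightarrow> 'a AC02" where "sgn_AC02 z = z /\<^sub>R norm z"
definition uniformity_AC02 :: "('a AC02 \<times> 'a AC02) filter" where
  "uniformity_AC02 = (INF e\<in>{0<..}. principal {(z, w). dist z w < e})"
definition open_AC02 :: "'a AC02 set \<Rightarrow> bool" where
  "open_AC02 U = (\<forall>z\<in>U. \<forall>\<^sub>F (z', w) in uniformity. z' = z \<longrightarrow> w \<in> U)"

instance
proof
  fix u z w :: "'a AC02" and c :: real
  note sq = AC02_square_integrable_pdxy(1)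
  note meas = borel_measurable_integrable[OF square_integrable_inner[OF sq sq]]
  show "z \<bullet> w = w \<bullet> z" by (simp add: inner_AC02_def inner_commute)
  have "(z + w) \<bullet> u = (LINT p|lebesgue_on unit_square.
      pdxy (Rep_AC02 z) p \<bullet> pdxy (Rep_AC02 u) p + pdxy (Rep_AC02 w) p \<bullet> pdxy (Rep_AC02 u) p)"
    unfolding inner_AC02_def
  proof (rule integral_cong_AE[OF meas])
    show "(\<lambda>p. pdxy (Rep_AC02 z) p \<bullet> pdxy (Rep_AC02 u) p + pdxy (Rep_AC02 w) p \<bullet> pdxy (Rep_AC02 u) p)
        \<in> borel_measurable (lebesgue_on unit_square)"
      by (rule borel_measurable_add[OF meas meas])
    show "AE p in lebesgue_on unit_square. pdxy (Rep_AC02 (z + w)) p \<bullet> pdxy (Rep_AC02 u) p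
        = pdxy (Rep_AC02 z) p \<bullet> pdxy (Rep_AC02 u) p + pdxy (Rep_AC02 w) p \<bullet> pdxy (Rep_AC02 u) p"
      using AE_pdxy_add[of z w] by eventually_elim (simp add: inner_add_left)
  qed
  then show "(z + w) \<bullet> u = z \<bullet> u + w \<bullet> u"
    by (simp add: inner_AC02_def square_integrable_inner sq)
  have "c *\<^sub>R z \<bullet> w = (LINT p|lebesgue_on unit_square. c * (pdxy (Rep_AC02 z) p \<bullet> pdxy (Rep_AC02 w) p))"
    unfolding inner_AC02_def
  proof (rule integral_cong_AE[OF meas])
    show "(\<lambda>p. c * (pdxy (Rep_AC02 z) p \<bullet> pdxy (Rep_AC02 w) p)) \<in> borel_measurable (lebesgue_on unit_square)"
      by (rule borel_measurable_times[OF borel_measurable_const meas])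
    show "AE p in lebesgue_on unit_square. pdxy (Rep_AC02 (c *\<^sub>R z)) p \<bullet> pdxy (Rep_AC02 w) p
        = c * (pdxy (Rep_AC02 z) p \<bullet> pdxy (Rep_AC02 w) p)"
      using AE_pdxy_scaleR[of c z] by eventually_elim simp
  qed
  then show "c *\<^sub>R z \<bullet> w = c * (z \<bullet> w)"
    by (simp add: inner_AC02_def)
  show "0 \<le> z \<bullet> z" by (simp add: inner_AC02_def)
  show "z \<bullet> z = 0 \<longleftrightarrow> z = 0"
  proof
    assume "z \<bullet> z = 0"
    then have "AE p in lebesgue_on unit_square. pdxy (Rep_AC02 z) p = 0"
      unfolding inner_AC02_def using integral_norm_square_eq_0_iff[OF sq] by blast
    then have "Rep_AC02 z p = 0" for p
      using primitive_eq_0[OF sq, of z p] by (simp add: AC02_square_integrable_pdxy(2))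
    then show "z = 0" by (simp add: zero_AC02.rep_eq fun_eq_iff flip: Rep_AC02_inject)
  next
    assume "z = 0"
    then have "z = 0 *\<^sub>R z" by simp
    then have "AE p in lebesgue_on unit_square. pdxy (Rep_AC02 z) p = 0"
      using AE_pdxy_scaleR[of 0 z] by simp
    then show "z \<bullet> z = 0"
      unfolding inner_AC02_def using integral_norm_square_eq_0_iff[OF sq] by blast
  qed
qed (fact norm_AC02_def dist_AC02_def sgn_AC02_def uniformity_AC02_def open_AC02_def)+

end

lemma AC02_boundary:
  fixes z :: "'a::euclidean_space AC02"
  shows "Rep_AC02 z (x, 0) = 0" "Rep_AC02 z (0, y) = 0"
proof -
  have null: "{0..a} \<times> {0..0} \<in> null_sets (lebesgue :: (real \<times> real) measure)"
    "{0..0} \<times> {0..a} \<in> null_sets (lebesgue :: (real \<times> real) measure)" for a :: real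
    unfolding rectangle_eq_cbox negligible_iff_null_sets[symmetric] negligible_interval(1)
    by (auto simp: box_eq_empty Basis_prod_def)
  have zero: "(LINT p|lebesgue_on N. l p) = 0" if "N \<in> null_sets lebesgue"
    for N and l :: "real \<times> real \<Rightarrow> 'a"
    by (rule integral_eq_zero_AE, subst AE_restrict_space_iff)
       (use that AE_not_in[OF that] in \<open>auto elim: eventually_mono\<close>)
  obtain l where l: "Rep_AC02 z = primitive l" using Rep_AC02[of z] by auto
  show "Rep_AC02 z (x, 0) = 0"
    using zero[OF null(1)[of x]] unfolding l primitive_def by simp
  show "Rep_AC02 z (0, y) = 0"
    using zero[OF null(2)[of y]] unfolding l primitive_def by simp
qed

definition continuously_differentiable :: "('a::real_normed_vector \<Rightarrow> 'b::real_normed_vector) \<Rightarrow> bool" where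
  "continuously_differentiable g \<longleftrightarrow>
     (\<exists>g' :: 'a \<Rightarrow> 'a \<Rightarrow>\<^sub>L 'b. (\<forall>z. (g has_derivative blinfun_apply (g' z)) (at z)) \<and> continuous_on UNIV g')"

definition regular_data ::
  "(real \<times> real \<Rightarrow> real^'n \<Rightarrow> real^'n) \<Rightarrow> (real \<times> real \<Rightarrow> real^'n \<Rightarrow> real^'n) \<Rightarrow>
   (real \<times> real \<Rightarrow> real^'n^'n) \<Rightarrow> (real \<times> real \<Rightarrow> real^'n^'n) \<Rightarrow> bool" where
  "regular_data f1 f2 A1 A2 \<longleftrightarrow>
     (\<forall>z. (\<lambda>p. f1 p z) \<in> borel_measurable (lebesgue_on unit_square) \<and>
          (\<lambda>p. f2 p z) \<in> borel_measurable (lebesgue_on unit_square)) \<and>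
     (AE p in lebesgue_on unit_square. continuously_differentiable (f1 p) \<and> continuously_differentiable (f2 p)) \<and>
     (AE y in lebesgue_on {0..1}. \<forall>x\<in>{0..1}. (\<lambda>s. A1 (s, y)) differentiable (at x within {0..1})) \<and>
     (AE x in lebesgue_on {0..1}. \<forall>y\<in>{0..1}. (\<lambda>t. A2 (x, t)) differentiable (at y within {0..1})) \<and>
     (\<forall>A\<in>{A1, A2, pdx A1, pdy A2}.
        A \<in> borel_measurable (lebesgue_on unit_square) \<and>
        (\<exists>K. AE p in lebesgue_on unit_square. norm (A p) \<le> K))"

(* norm on matrices is the Frobenius norm; the constant is existential, so any norm would do. *)
definition growth_bounded ::
  "(real \<times> real \<Rightarrow> real^'n \<Rightarrow> real^'n) \<Rightarrow> (real \<times> real \<Rightarrow> real^'n \<Rightarrow> real^'n) \<Rightarrow>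
   (real \<times> real \<Rightarrow> real^'n^'n) \<Rightarrow> (real \<times> real \<Rightarrow> real^'n^'n) \<Rightarrow> bool" where
  "growth_bounded f1 f2 A1 A2 \<longleftrightarrow>
     (\<exists>B > 0. \<exists>b. square_integrable b \<and> (\<forall>p\<in>unit_square. 0 \<le> b p) \<and>
        (AE p in lebesgue_on unit_square.
           (\<forall>z. norm (f1 p z) \<le> B * norm z + b p \<and> norm (f2 p z) \<le> B * norm z + b p) \<and>
           norm (A1 p) \<le> B \<and> norm (A2 p) \<le> B \<and> norm (pdx A1 p) \<le> B \<and> norm (pdy A2 p) \<le> B))"

definition derivatives_locally_bounded ::
  "(real \<times> real \<Rightarrow> real^'n \<Rightarrow> real^'n) \<Rightarrow> (real \<times> real \<Rightarrow> real^'n \<Rightarrow> real^'n) \<Rightarrow> bool" where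
  "derivatives_locally_bounded f1 f2 \<longleftrightarrow>
     (\<forall>\<rho> > 0. \<exists>M. AE p in lebesgue_on unit_square. \<forall>z. norm z \<le> \<rho> \<longrightarrow>
        onorm (frechet_derivative (f1 p) (at z)) \<le> M \<and> onorm (frechet_derivative (f2 p) (at z)) \<le> M)"

(* The double integral is the planar Lebesgue integral over [0,x] x [0,y]. *)
definition solves ::
  "(real \<times> real \<Rightarrow> real^'n \<Rightarrow> real^'n) \<Rightarrow> (real \<times> real \<Rightarrow> real^'n \<Rightarrow> real^'n) \<Rightarrow>
   (real \<times> real \<Rightarrow> real^'n^'n) \<Rightarrow> (real \<times> real \<Rightarrow> real^'n^'n) \<Rightarrow>
   (real \<times> real \<Rightarrow> real^'n) \<Rightarrow> (real \<times> real \<Rightarrow> real^'n) \<Rightarrow> bool" where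
  "solves f1 f2 A1 A2 v z \<longleftrightarrow>
     (AE (x, y) in lebesgue_on unit_square.
        pdxy z (x, y) + f1 (x, y) (z (x, y))
          + (LINT q|lebesgue_on ({0..x} \<times> {0..y}). f2 q (z q) + A1 q *v pdx z q + A2 q *v pdy z q)
        = v (x, y))"

definition solution_operator ::
  "(real \<times> real \<Rightarrow> real^'n \<Rightarrow> real^'n) \<Rightarrow> (real \<times> real \<Rightarrow> real^'n \<Rightarrow> real^'n) \<Rightarrow>
   (real \<times> real \<Rightarrow> real^'n^'n) \<Rightarrow> (real \<times> real \<Rightarrow> real^'n^'n) \<Rightarrow> (real^'n) L2 \<Rightarrow> (real^'n) AC02" where
  "solution_operator f1 f2 A1 A2 v = (THE z. solves f1 f2 A1 A2 (rep_L2 v) (Rep_AC02 z))"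

end

theory Submission
  imports Defs
begin

text \<open>
  In terms of the density \<open>l = z\<^sub>x\<^sub>y\<close> the equation reads \<open>l + V l = v\<close>, where \<open>V\<close> is of Volterra type:
  writing \<open>P\<close> for the double integral over \<open>[0,x] \<times> [0,y]\<close>, one has \<open>P |z\<^sub>x| \<le> P |l|\<close>, \<open>P |z\<^sub>y| \<le> P |l|\<close> and
  \<open>P (P |l|) \<le> P |l|\<close> on the unit square, so that almost everywhere \<open>|V l| \<le> \<beta> + 4B P |l|\<close>, and
  \<open>|V l - V m| \<le> K P |l - m|\<close> as long as \<open>P |l|\<close> and \<open>P |m|\<close> stay below a fixed bound.  A Gronwall inequality for
  \<open>P\<close> bounds all solutions and all Picard iterates a priori; this replaces a global Lipschitz condition.
  The Picard iterates then converge uniformly outside a null set, and the solution is unique and locally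
  Lipschitz in \<open>v\<close>.  The equation linearized along a solution satisfies the same hypotheses, hence has a bounded
  linear solution operator.  This is the derivative: the linearization error is \<open>o(\<parallel>h\<parallel>)\<close> pointwise and
  dominated by a multiple of \<open>\<parallel>h\<parallel>\<close>, and dominated convergence turns this into an \<open>L\<^sup>2\<close> estimate.
\<close>

section \<open>Double integrals over the unit square\<close>

text \<open>The derivatives z_x and z_y are single integrals of \<open>l\<close> and have no
  pointwise bound by P |l|; only their double integrals do. Hence every estimate is phrased through
  the one scalar function P |l|: it bounds |z| at each point and never exceeds the L1 norm of
  \<open>l\<close>. The order of choices matters: linear growth alone gives a radius R for P |l|,
  and only then is a Lipschitz constant K on that ball fixed. This is why the Picard iterates and
  their limit must all be shown to obey the same R. A superposition operator need not be Frechet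
  differentiable from L2 into L2. Here the increment of z is P w with |P w| at most a multiple of
  the norm of h at every point, so the arguments of f1 and f2 move in the sup norm, and the local
  bound on the derivatives supplies the majorant for dominated convergence. Planar Lebesgue measure
  is a completion, not a product measure, so Fubini arguments pass through Borel representatives.
  Statements about y come from those about x by reflection in the diagonal.\<close>

abbreviation square_measure :: "(real \<times> real) measure" where
  "square_measure \<equiv> lebesgue_on unit_square"

section \<open>Reflection in the diagonal\<close>

text \<open>The product measure \<open>lborel\<close> is invariant under the exchange of
  coordinates, and this passes to its completion. It allows every fact about \<open>pdy\<close> to
  be transported from \<open>pdx\<close>.\<close>

lemma swap_lebesgue:
  shows "prod.swap \<in> (lebesgue :: (real \<times> real) measure) \<rightarrow>\<^sub>M lebesgue"
    and "distr (lebesgue :: (real \<times> real) measure) lebesgue prod.swap = lebesgue"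
proof -
  have sw: "prod.swap \<in> (lborel :: (real \<times> real) measure) \<rightarrow>\<^sub>M lborel"
    by (simp add: borel_measurable_continuous_onI continuous_on_swap)
  have "prod.swap = (\<lambda>(x, y). (y, x :: real) :: real \<times> real)" by (auto simp: fun_eq_iff)
  then have eq: "distr (lborel :: (real \<times> real) measure) lborel prod.swap = lborel"
    using lborel_pair.distr_pair_swap by (metis lborel_prod)
  have eq': "distr (lebesgue :: (real \<times> real) measure) lborel prod.swap = lborel"
    using distr_completion[OF sw] eq by simp
  show "prod.swap \<in> (lebesgue :: (real \<times> real) measure) \<rightarrow>\<^sub>M lebesgue"
    by (rule completion.measurable_completion2[OF measurable_completion[OF sw]]) (simp add: eq')
  show "distr (lebesgue :: (real \<times> real) measure) lebesgue prod.swap = lebesgue"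
    using completion.completion_distr_eq[OF measurable_completion[OF sw]] eq' by simp
qed

lemma swap_square_measure:
  shows "prod.swap \<in> square_measure \<rightarrow>\<^sub>M square_measure"
    and "distr square_measure square_measure prod.swap = square_measure"
proof -
  show m: "prod.swap \<in> square_measure \<rightarrow>\<^sub>M square_measure"
    by (rule measurable_restrict_space3[OF swap_lebesgue(1)]) (auto simp: unit_square_def)
  show "distr square_measure square_measure prod.swap = square_measure"
  proof (rule measure_eqI)
    fix A assume "A \<in> sets (distr square_measure square_measure prod.swap)"
    then have A: "A \<in> sets lebesgue" "A \<subseteq> unit_square"
      by (simp_all add: sets_restrict_space_iff)
    have sub: "prod.swap -` A \<subseteq> unit_square" using A(2) by (auto simp: unit_square_def)
    have "emeasure (distr square_measure square_measure prod.swap) A = emeasure square_measure (prod.swap -` A)"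
      using A sub by (subst emeasure_distr[OF m]) (auto simp: sets_restrict_space_iff Int_absorb2)
    also have "\<dots> = emeasure lebesgue (prod.swap -` A)"
      using sub by (simp add: emeasure_restrict_space)
    also have "\<dots> = emeasure (distr lebesgue lebesgue prod.swap) A"
      using A by (simp add: emeasure_distr[OF swap_lebesgue(1)])
    also have "\<dots> = emeasure square_measure A"
      using A by (simp add: swap_lebesgue(2) emeasure_restrict_space)
    finally show "emeasure (distr square_measure square_measure prod.swap) A = emeasure square_measure A" .
  qed simp
qed

lemma AE_square_swap:
  assumes "AE p in square_measure. P p"
  shows "AE p in square_measure. P (prod.swap p)"
proof (rule AE_distrD[OF swap_square_measure(1)])
  show "AE p in distr square_measure square_measure prod.swap. P p"
    using assms by (simp only: swap_square_measure(2))
qed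

interpretation square: finite_measure square_measure
  by (rule finite_measure_unit_square)

lemma measure_unit_square [simp]: "measure square_measure unit_square = 1"
proof -
  have "measure square_measure unit_square = measure lebesgue unit_square"
    by (simp add: measure_restrict_space)
  also have "\<dots> = 1"
    by (simp add: unit_square_def rectangle_eq_cbox content_Pair)
  finally show ?thesis .
qed

section \<open>Measurability up to null sets\<close>

text \<open>Completeness of \<open>lebesgue\<close> is carried over to the square by extending both
  functions by zero.\<close>

lemma measurable_square_AE:
  fixes f g :: "real \<times> real \<Rightarrow> 'a::euclidean_space"
  assumes "f \<in> borel_measurable square_measure" "AE p in square_measure. f p = g p"
  shows "g \<in> borel_measurable square_measure"
proof -
  have "(\<lambda>p. indicator unit_square p *\<^sub>R f p) \<in> borel_measurable lebesgue"
    using assms(1) by (simp add: borel_measurable_restrict_space_iff)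
  moreover have "AE p in lebesgue. p \<in> unit_square \<longrightarrow> f p = g p"
    using assms(2) by (simp add: AE_restrict_space_iff)
  then have "AE p in lebesgue. indicator unit_square p *\<^sub>R f p = indicator unit_square p *\<^sub>R g p"
    by eventually_elim (auto simp: indicator_def)
  ultimately have "(\<lambda>p. indicator unit_square p *\<^sub>R g p) \<in> borel_measurable lebesgue"
    by (rule borel_measurable_AE)
  then show ?thesis by (simp add: borel_measurable_restrict_space_iff)
qed

lemma measurable_square_LIMSEQ:
  fixes f :: "nat \<Rightarrow> real \<times> real \<Rightarrow> 'a::euclidean_space"
  assumes f: "\<And>i. f i \<in> borel_measurable square_measure"
    and lim: "AE p in square_measure. (\<lambda>i. f i p) \<longlonglongrightarrow> g p"
  shows "g \<in> borel_measurable square_measure"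
proof (rule measurable_square_AE)
  show "(\<lambda>p. lim (\<lambda>i. f i p)) \<in> borel_measurable square_measure"
    using f by (rule borel_measurable_lim_metric)
  show "AE p in square_measure. lim (\<lambda>i. f i p) = g p"
    using lim by eventually_elim (rule limI)
qed

section \<open>Calculus of the double integral\<close>

text \<open>With one fixed measure and the corner only in the indicator, comparison, linearity and
  measurability of \<open>primitive\<close> become statements about ordinary integrals.\<close>

lemma primitive_eq_square_integral:
  assumes "(x, y) \<in> unit_square"
  shows "primitive l (x, y) = (LINT q|square_measure. indicator ({0..x} \<times> {0..y}) q *\<^sub>R l q)"
proof -
  have "primitive l (x, y) = (LINT q|lebesgue. indicator ({0..x} \<times> {0..y}) q *\<^sub>R l q)"
    using assms by (simp add: primitive_def integral_restrict_space)
  also have "\<dots> = (LINT q|lebesgue. indicator unit_square q *\<^sub>R indicator ({0..x} \<times> {0..y}) q *\<^sub>R l q)"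
    using assms by (intro Bochner_Integration.integral_cong) (auto simp: unit_square_def indicator_def)
  finally show ?thesis by (simp add: integral_restrict_space)
qed

lemma rectangle_in_square [measurable]: "unit_square \<inter> {0..x} \<times> {0..y} \<in> sets square_measure"
  by (auto simp: sets_restrict_space)

lemma integrable_square_rectangle:
  fixes l :: "real \<times> real \<Rightarrow> 'a::euclidean_space"
  assumes "integrable square_measure l"
  shows "integrable square_measure (\<lambda>q. indicator ({0..x} \<times> {0..y}) q *\<^sub>R l q)"
proof -
  have "integrable square_measure (\<lambda>q. indicator (unit_square \<inter> {0..x} \<times> {0..y}) q *\<^sub>R l q)"
    by (rule integrable_mult_indicator[OF rectangle_in_square assms])
  then show ?thesis
    by (rule Bochner_Integration.integrable_cong[THEN iffD1, rotated 2]) (auto simp: indicator_def)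
qed

lemma primitive_outside: "p \<notin> unit_square \<Longrightarrow> primitive l p = 0"
  by (cases p) (simp add: primitive_def)

lemma primitive_add_integrable:
  assumes "integrable square_measure l" "integrable square_measure m"
  shows "primitive (\<lambda>p. l p + m p) p = primitive l p + primitive m p"
  by (cases p; cases "p \<in> unit_square")
    (simp_all add: primitive_eq_square_integral scaleR_add_right integrable_square_rectangle assms primitive_outside)

lemma primitive_diff_integrable:
  assumes "integrable square_measure l" "integrable square_measure m"
  shows "primitive (\<lambda>p. l p - m p) p = primitive l p - primitive m p"
  by (cases p; cases "p \<in> unit_square")
    (simp_all add: primitive_eq_square_integral scaleR_diff_right integrable_square_rectangle assms primitive_outside)

lemma primitive_mono_AE:
  fixes l m :: "real \<times> real \<Rightarrow> real"
  assumes "integrable square_measure l" "integrable square_measure m"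
    and "AE p in square_measure. l p \<le> m p"
  shows "primitive l p \<le> primitive m p"
proof (cases "p \<in> unit_square")
  case True
  obtain x y where p: "p = (x, y)" by (cases p)
  show ?thesis
    using True unfolding p
    by (simp only: primitive_eq_square_integral)
       (intro integral_mono_AE integrable_square_rectangle assms(1,2),
        use assms(3) in \<open>auto elim!: eventually_mono simp: indicator_def\<close>)
qed (simp add: primitive_outside)

lemma primitive_cong_AE:
  fixes l m :: "real \<times> real \<Rightarrow> 'a::euclidean_space"
  assumes "l \<in> borel_measurable square_measure" "AE p in square_measure. l p = m p"
  shows "primitive l p = primitive m p"
proof (cases "p \<in> unit_square")
  case True
  obtain x y where p: "p = (x, y)" by (cases p)
  have m: "(\<lambda>q. indicator ({0..x} \<times> {0..y}) q *\<^sub>R k q) \<in> borel_measurable square_measure"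
    if [measurable]: "k \<in> borel_measurable square_measure" for k :: "real \<times> real \<Rightarrow> 'a"
  proof -
    have "(\<lambda>q. indicator (unit_square \<inter> {0..x} \<times> {0..y}) q *\<^sub>R k q) \<in> borel_measurable square_measure"
      by measurable
    then show ?thesis
      by (rule measurable_cong[THEN iffD1, rotated]) (auto simp: indicator_def)
  qed
  show ?thesis
    using True unfolding p
    by (simp only: primitive_eq_square_integral)
       (intro integral_cong_AE m assms(1) measurable_square_AE[OF assms],
        use assms(2) in \<open>auto elim!: eventually_mono\<close>)
qed (simp add: primitive_outside)

lemma norm_primitive_le:
  assumes "integrable square_measure l"
  shows "norm (primitive l p) \<le> primitive (\<lambda>p. norm (l p)) p"
proof (cases "p \<in> unit_square")
  case True
  obtain x y where p: "p = (x, y)" by (cases p)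
  have "norm (primitive l p) \<le> (LINT q|square_measure. norm (indicator ({0..x} \<times> {0..y}) q *\<^sub>R l q))"
    using True unfolding p by (simp only: primitive_eq_square_integral integral_norm_bound)
  also have "\<dots> = primitive (\<lambda>p. norm (l p)) p"
    using True unfolding p by (simp add: primitive_eq_square_integral)
  finally show ?thesis .
qed (simp add: primitive_outside)

lemma primitive_nonneg:
  fixes d :: "real \<times> real \<Rightarrow> real"
  assumes "AE p in square_measure. 0 \<le> d p"
  shows "0 \<le> primitive d p"
proof (cases "p \<in> unit_square")
  case True
  obtain x y where p: "p = (x, y)" by (cases p)
  show ?thesis
    using True unfolding p
    by (simp only: primitive_eq_square_integral)
       (intro integral_nonneg_AE, use assms in \<open>auto elim!: eventually_mono\<close>)
qed (simp add: primitive_outside)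

lemma primitive_le_integral:
  fixes d :: "real \<times> real \<Rightarrow> real"
  assumes "integrable square_measure d" "AE p in square_measure. 0 \<le> d p"
  shows "primitive d p \<le> (LINT q|square_measure. d q)"
proof (cases "p \<in> unit_square")
  case True
  obtain x y where p: "p = (x, y)" by (cases p)
  show ?thesis
    using True unfolding p
    by (simp only: primitive_eq_square_integral)
       (intro integral_mono_AE integrable_square_rectangle assms(1),
        use assms in \<open>auto elim!: eventually_mono simp: indicator_def\<close>)
next
  case False
  then show ?thesis using integral_nonneg_AE[OF assms(2)] by (simp add: primitive_outside)
qed

lemma primitive_mono_corner:
  fixes d :: "real \<times> real \<Rightarrow> real"
  assumes "integrable square_measure d" "AE p in square_measure. 0 \<le> d p"
    and "(x, y) \<in> unit_square" "s \<in> {0..x}" "t \<in> {0..y}"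
  shows "primitive d (s, t) \<le> primitive d (x, y)"
proof -
  have "(s, t) \<in> unit_square" using assms(3-5) by (auto simp: unit_square_def)
  then show ?thesis
    using assms(3)
    by (simp only: primitive_eq_square_integral)
       (intro integral_mono_AE integrable_square_rectangle assms(1),
        use assms in \<open>auto elim!: eventually_mono simp: indicator_def\<close>)
qed

lemma measurable_primitive:
  fixes l :: "real \<times> real \<Rightarrow> 'a::euclidean_space"
  assumes [measurable]: "l \<in> borel_measurable square_measure"
  shows "primitive l \<in> borel_measurable square_measure"
proof -
  have [measurable]: "fst \<in> borel_measurable square_measure" "snd \<in> borel_measurable square_measure"
    by (intro measurable_restrict_space1 measurable_completion, simp add: borel_measurable_continuous_onI continuous_on_fst continuous_on_snd)+
  \<comment> \<open>Membership in the rectangle is spelled out as inequalities between coordinates,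
    which makes the integrand jointly measurable in \<open>p\<close> and \<open>q\<close>;
    integrating out \<open>q\<close> keeps measurability in \<open>p\<close>.\<close>
  have "(\<lambda>p. LINT q|square_measure. (if 0 \<le> fst q \<and> fst q \<le> fst p \<and> 0 \<le> snd q \<and> snd q \<le> snd p then l q else 0))
      \<in> borel_measurable square_measure"
    by measurable
  then show ?thesis
  proof (rule measurable_cong[THEN iffD1, rotated])
    fix p assume "p \<in> space square_measure"
    then show "(LINT q|square_measure. (if 0 \<le> fst q \<and> fst q \<le> fst p \<and> 0 \<le> snd q \<and> snd q \<le> snd p then l q else 0)) = primitive l p"
      by (cases p)
         (auto simp: primitive_eq_square_integral indicator_def mem_Times_iff intro!: Bochner_Integration.integral_cong)
  qed
qed

lemma square_integrable_bound:
  fixes f :: "real \<times> real \<Rightarrow> 'a::euclidean_space"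
  assumes "f \<in> borel_measurable square_measure" "square_integrable g"
    and "AE p in square_measure. norm (f p) \<le> norm (g p)"
  shows "square_integrable f"
  unfolding square_integrable_def
proof
  show "integrable square_measure (\<lambda>p. (norm (f p))\<^sup>2)"
  proof (rule Bochner_Integration.integrable_bound)
    show "integrable square_measure (\<lambda>p. (norm (g p))\<^sup>2)"
      using assms(2) by (simp add: square_integrable_def)
    show "AE p in square_measure. norm ((norm (f p))\<^sup>2) \<le> norm ((norm (g p))\<^sup>2)"
      using assms(3) by eventually_elim simp
  qed (use assms(1) in measurable)
qed fact

lemma square_integrable_const [simp]: "square_integrable (\<lambda>p. c)"
  by (simp add: square_integrable_def)

lemma square_integrable_norm:
  "square_integrable f \<Longrightarrow> square_integrable (\<lambda>p. norm (f p))"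
  by (auto simp: square_integrable_def intro: borel_measurable_norm)

text \<open>The primitive of an L1 function is bounded by its L1 norm, and the square has finite
  measure.\<close>

lemma square_integrable_primitive:
  assumes "integrable square_measure l"
  shows "square_integrable (primitive l)"
proof (rule square_integrable_bound)
  show "primitive l \<in> borel_measurable square_measure"
    using assms by (intro measurable_primitive) auto
  show "AE p in square_measure. norm (primitive l p) \<le> norm (LINT q|square_measure. norm (l q))"
  proof (rule AE_I2)
    fix p
    have "norm (primitive l p) \<le> primitive (\<lambda>p. norm (l p)) p"
      by (rule norm_primitive_le[OF assms])
    also have "\<dots> \<le> (LINT q|square_measure. norm (l q))"
      using assms by (intro primitive_le_integral) auto
    finally show "norm (primitive l p) \<le> norm (LINT q|square_measure. norm (l q))"
      by simp
  qed
qed simp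

lemma integrable_primitive:
  "integrable square_measure l \<Longrightarrow> integrable square_measure (primitive l)"
  by (rule square_integrable_imp_integrable[OF square_integrable_primitive])

text \<open>On the rectangle below \<open>p\<close> the inner primitive is at most its value at
  \<open>p\<close>. Integrating this constant over the square costs nothing, since the square has
  measure 1.\<close>

lemma primitive_primitive_le:
  fixes d :: "real \<times> real \<Rightarrow> real"
  assumes d: "integrable square_measure d" "AE p in square_measure. 0 \<le> d p"
  shows "primitive (primitive d) p \<le> primitive d p"
proof (cases "p \<in> unit_square")
  case True
  obtain x y where p: "p = (x, y)" by (cases p)
  have "primitive (primitive d) p \<le> (LINT q|square_measure. primitive d p)"
    using True unfolding p
    apply (simp only: primitive_eq_square_integral[of _ _ "primitive d"])
    apply (rule integral_mono)
      apply (intro integrable_square_rectangle integrable_primitive d)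
    using primitive_mono_corner[OF d, of x y] primitive_nonneg[OF d(2), of "(x,y)"] 
     by (auto simp: indicator_def)
  then show ?thesis by (simp)
qed (simp add: primitive_outside)

lemma primitive_swap:
  assumes l: "l \<in> borel_measurable square_measure"
  shows "primitive (l \<circ> prod.swap) p = primitive l (prod.swap p)"
proof (cases "p \<in> unit_square")
  case True
  obtain x y where p: "p = (x, y)" by (cases p)
  have yx: "(y, x) \<in> unit_square" using True p by (auto simp: unit_square_def)
  have [measurable]: "(\<lambda>q. indicator ({0..y} \<times> {0..x}) q *\<^sub>R l q) \<in> borel_measurable square_measure"
  proof -
    have "(\<lambda>q. indicator (unit_square \<inter> {0..y} \<times> {0..x}) q *\<^sub>R l q) \<in> borel_measurable square_measure"
      using l by measurable
    then show ?thesis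
      by (rule measurable_cong[THEN iffD1, rotated]) (auto simp: indicator_def)
  qed
  have "primitive l (y, x) = (LINT q|distr square_measure square_measure prod.swap. indicator ({0..y} \<times> {0..x}) q *\<^sub>R l q)"
    by (simp add: primitive_eq_square_integral[OF yx] swap_square_measure(2))
  also have "\<dots> = (LINT q|square_measure. indicator ({0..y} \<times> {0..x}) (prod.swap q) *\<^sub>R l (prod.swap q))"
    by (rule integral_distr[OF swap_square_measure(1)]) simp
  also have "\<dots> = (LINT q|square_measure. indicator ({0..x} \<times> {0..y}) q *\<^sub>R l (prod.swap q))"
    by (intro Bochner_Integration.integral_cong) (auto simp: indicator_def)
  also have "\<dots> = primitive (l \<circ> prod.swap) (x, y)"
    using True p by (simp add: primitive_eq_square_integral)
  finally show ?thesis by (simp add: p)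
next
  case False
  then show ?thesis by (cases p) (auto simp: primitive_def unit_square_def)
qed

section \<open>Coefficients and superposition\<close>

text \<open>Cauchy-Schwarz in each row; the norm of a matrix is the Frobenius norm.\<close>

lemma norm_matrix_vector_mult_le: "norm (A *v x) \<le> norm A * norm (x :: real^'n)" for A :: "real^'n^'m"
proof -
  have "norm (A *v x) = L2_set (\<lambda>i. norm (A $ i \<bullet> x)) UNIV"
    by (simp add: norm_vec_def matrix_vector_mul_component)
  also have "\<dots> \<le> L2_set (\<lambda>i. norm x * norm (A $ i)) UNIV"
    by (rule L2_set_mono) (auto simp: mult.commute[of "norm x"] Cauchy_Schwarz_ineq2)
  also have "\<dots> = norm x * norm A"
    by (simp add: norm_vec_def[of A] L2_set_right_distrib)
  finally show ?thesis by (simp add: mult.commute)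
qed

lemma bounded_bilinear_matrix_vector_mult:
  "bounded_bilinear (\<lambda>(A :: real^'n^'m) x. A *v x)"
proof
  show "\<exists>K. \<forall>(A :: real^'n^'m) x. norm (A *v x) \<le> norm A * norm x * K"
    by (intro exI[of _ 1]) (simp add: norm_matrix_vector_mult_le)
qed (simp_all add: matrix_vector_mult_add_rdistrib matrix_vector_right_distrib
      matrix_vector_mult_scaleR scaleR_matrix_vector_assoc)

lemma borel_measurable_matrix_vector_mult [measurable (raw)]:
  fixes A :: "'b \<Rightarrow> real^'n^'m"
  assumes [measurable]: "A \<in> borel_measurable M" "x \<in> borel_measurable M"
  shows "(\<lambda>p. A p *v x p) \<in> borel_measurable M"
  by (rule borel_measurable_continuous_Pair[OF assms])
    (intro bounded_bilinear.continuous_on[OF bounded_bilinear_matrix_vector_mult] continuous_intros)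

text \<open>The Caratheodory argument: for a simple function \<open>s i\<close> the composition is a
  finite sum of measurable pieces, and continuity of \<open>f p\<close> carries measurability to the
  limit \<open>h\<close>.\<close>

lemma measurable_superposition:
  fixes f :: "real \<times> real \<Rightarrow> 'a::euclidean_space \<Rightarrow> 'b::euclidean_space"
  assumes f: "\<And>z. (\<lambda>p. f p z) \<in> borel_measurable square_measure"
    and cont: "AE p in square_measure. continuous_on UNIV (f p)"
    and h: "h \<in> borel_measurable square_measure"
  shows "(\<lambda>p. f p (h p)) \<in> borel_measurable square_measure"
proof -
  obtain s where s: "\<And>i. simple_function square_measure (s i)"
      "\<And>p. p \<in> unit_square \<Longrightarrow> (\<lambda>i. s i p) \<longlonglongrightarrow> h p"
    using borel_measurable_implies_sequence_metric[OF h, of 0] by auto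
  show ?thesis
  proof (rule measurable_square_LIMSEQ)
    fix i
    have "finite (s i ` unit_square)"
      using simple_functionD(1)[OF s(1)[of i]] by simp
    moreover have "s i -` {z} \<inter> unit_square \<in> sets square_measure" for z
      using simple_functionD(2)[OF s(1)[of i], of "{z}"] by simp
    ultimately have "(\<lambda>p. \<Sum>z\<in>s i ` unit_square. indicator (s i -` {z} \<inter> unit_square) p *\<^sub>R f p z)
        \<in> borel_measurable square_measure"
      by (intro borel_measurable_sum borel_measurable_scaleR borel_measurable_indicator f)
    then show "(\<lambda>p. f p (s i p)) \<in> borel_measurable square_measure"
    proof (rule measurable_cong[THEN iffD1, rotated])
      fix p assume "p \<in> space square_measure"
      then have p: "p \<in> unit_square" by simp
      have "(\<Sum>z\<in>s i ` unit_square. indicator (s i -` {z} \<inter> unit_square) p *\<^sub>R f p z)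
          = (\<Sum>z\<in>s i ` unit_square. if z = s i p then f p z else 0)"
        using p by (intro sum.cong) (auto simp: indicator_def)
      also have "\<dots> = f p (s i p)"
        using p \<open>finite (s i ` unit_square)\<close> by (simp add: sum.delta)
      finally show "(\<Sum>z\<in>s i ` unit_square. indicator (s i -` {z} \<inter> unit_square) p *\<^sub>R f p z) = f p (s i p)" .
    qed
  next
    show "AE p in square_measure. (\<lambda>i. f p (s i p)) \<longlonglongrightarrow> f p (h p)"
      using cont AE_space
    proof eventually_elim
      case (elim p)
      then have "isCont (f p) (h p)"
        by (simp add: continuous_on_eq_continuous_at)
      then show ?case
        by (rule isCont_tendsto_compose) (use s(2) elim in auto)
    qed
  qed
qed

text \<open>This is nonnegativity of a variance: total mass 1 makes \<open>c\<close> the mean of the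
  norm.\<close>

lemma square_norm_integral_le:
  assumes f: "square_integrable f"
  shows "(LINT p|square_measure. norm (f p))\<^sup>2 \<le> (LINT p|square_measure. (norm (f p))\<^sup>2)"
proof -
  define c where "c = (LINT p|square_measure. norm (f p))"
  have i: "integrable square_measure (\<lambda>p. norm (f p))" "integrable square_measure (\<lambda>p. (norm (f p))\<^sup>2)"
    using f square_integrable_imp_integrable[OF f] by (auto simp: square_integrable_def)
  have "0 \<le> (LINT p|square_measure. (norm (f p) - c)\<^sup>2)"
    by simp
  also have "\<dots> = (LINT p|square_measure. (norm (f p))\<^sup>2 - 2 * c * norm (f p) + c\<^sup>2)"
    by (simp add: power2_diff algebra_simps)
  also have "\<dots> = (LINT p|square_measure. (norm (f p))\<^sup>2) - 2 * c * c + c\<^sup>2"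
    using i by (simp add: c_def)
  finally show ?thesis
    by (simp add: c_def[symmetric] power2_eq_square)
qed

text \<open>Fubini for a density that depends on the first coordinate only. Both majorants used
  below have this form: the exponential weight, and the slice integral at a frozen height that
  dominates \<open>pdx\<close>.\<close>

lemma primitive_fst:
  fixes h :: "real \<Rightarrow> real"
  assumes h: "integrable lborel h"
  shows "integrable square_measure (\<lambda>p. h (fst p))"
    and "(x, y) \<in> unit_square \<Longrightarrow> primitive (\<lambda>p. h (fst p)) (x, y) = y * (LINT s|lborel. indicator {0..x} s *\<^sub>R h s)"
proof -
  let ?F = "\<lambda>(x :: real) (y :: real) p. indicator ({0..x} \<times> {0..y}) p *\<^sub>R h (fst p)"
  have hm [measurable]: "h \<in> borel_measurable borel" using h by auto
  have m: "?F x y \<in> borel_measurable borel" for x y :: real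
  proof -
    have "(\<lambda>p. indicator {0..x} (fst p) * indicator {0..y} (snd p) * h (fst p)) \<in> borel_measurable (borel \<Otimes>\<^sub>M borel)"
      by measurable
    then show ?thesis by (simp add: borel_prod indicator_times)
  qed
  have i: "integrable (lborel \<Otimes>\<^sub>M lborel) (?F x y)" if "0 \<le> y" for x y :: real
  proof (rule lborel_pair.Fubini_integrable)
    show "?F x y \<in> borel_measurable (lborel \<Otimes>\<^sub>M lborel)" using m[of x y] by (simp add: lborel_prod)
    have "integrable lborel (\<lambda>s. y * norm (indicator {0..x} s *\<^sub>R h s))"
      by (intro integrable_mult_right integrable_norm integrable_mult_indicator h) simp
    then show "integrable lborel (\<lambda>s. LINT t|lborel. norm (?F x y (s, t)))"
      using that by (simp add: indicator_times abs_mult mult_ac)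
    have "integrable lborel (indicat_real {0..y})"
      by (rule integrable_real_indicator) (simp_all add: emeasure_lborel_Icc_eq)
    then show "AE s in lborel. integrable lborel (\<lambda>t. ?F x y (s, t))"
      by (simp add: indicator_times mult_ac)
  qed
  have "integrable lborel (?F 1 1)"
    using i[of 1 1] by (simp add: lborel_prod)
  then have "integrable lebesgue (?F 1 1)"
    using m[of 1 1] by (subst integrable_completion) auto
  then show "integrable square_measure (\<lambda>p. h (fst p))"
    by (simp add: integrable_restrict_space unit_square_def)
  assume xy: "(x, y) \<in> unit_square"
  then have "primitive (\<lambda>p. h (fst p)) (x, y) = (LINT p|lebesgue. ?F x y p)"
    by (simp add: primitive_def integral_restrict_space)
  also have "\<dots> = (LINT p|(lborel \<Otimes>\<^sub>M lborel). ?F x y p)"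
    using m[of x y] by (subst integral_completion) (auto simp: lborel_prod)
  also have "\<dots> = (LINT s|lborel. LINT t|lborel. ?F x y (s, t))"
    using xy by (intro lborel_pair.integral_fst'[symmetric] i) (simp add: unit_square_def)
  also have "\<dots> = (LINT s|lborel. y * (indicator {0..x} s *\<^sub>R h s))"
    using xy by (simp add: indicator_times unit_square_def mult_ac)
  finally show "primitive (\<lambda>p. h (fst p)) (x, y) = y * (LINT s|lborel. indicator {0..x} s *\<^sub>R h s)"
    by simp
qed

section \<open>A Gronwall inequality\<close>

text \<open>The weight \<open>exp (2 * K * x)\<close> makes the double integral a contraction with factor \<open>1/(2K)\<close>.\<close>

lemma primitive_exp_le:
  assumes "0 < K"
  shows "integrable square_measure (\<lambda>p. exp (2 * K * fst p))"
    and "p \<in> unit_square \<Longrightarrow> primitive (\<lambda>p. exp (2 * K * fst p)) p \<le> exp (2 * K * fst p) / (2 * K)"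
proof -
  \<comment> \<open>The weight is cut off outside the unit interval to become integrable on the
    line.\<close>
  define h where "h = (\<lambda>s. indicator {0..1} s * exp (2 * K * s))"
  have h: "has_bochner_integral lborel (\<lambda>s. indicator {0..x} s * exp (2 * K * s)) ((exp (2 * K * x) - 1) / (2 * K))"
    if "0 \<le> x" for x
  proof -
    have "has_bochner_integral lborel (\<lambda>s. exp (2 * K * s) * indicator {0..x} s) (exp (2 * K * x) / (2 * K) - exp (2 * K * 0) / (2 * K))"
      using assms that by (intro has_bochner_integral_FTC_Icc_real) (auto intro!: derivative_eq_intros)
    then show ?thesis by (simp add: diff_divide_distrib mult.commute)
  qed
  have ih: "integrable lborel h"
    using h[of 1] by (simp add: h_def has_bochner_integral_iff)
  have eq: "h (fst q) = exp (2 * K * fst q)" if "q \<in> unit_square" for q :: "real \<times> real"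
    using that by (auto simp: h_def unit_square_def)
  show i: "integrable square_measure (\<lambda>p. exp (2 * K * fst p))"
    using primitive_fst(1)[OF ih] by (rule Bochner_Integration.integrable_cong[THEN iffD1, rotated 2]) (simp_all add: eq)
  assume p: "p \<in> unit_square"
  obtain x y where xy: "p = (x, y)" by (cases p)
  have "0 \<le> x" "x \<le> 1" "0 \<le> y" "y \<le> 1" using p xy by (auto simp: unit_square_def)
  have "primitive (\<lambda>p. exp (2 * K * fst p)) p = primitive (\<lambda>p. h (fst p)) p"
  proof (rule primitive_cong_AE)
    show "AE p in square_measure. exp (2 * K * fst p) = h (fst p)"
      by (rule AE_I2) (simp add: eq)
  qed (use i in auto)
  also have "\<dots> = y * (LINT s|lborel. indicator {0..x} s *\<^sub>R h s)"
    using p by (simp only: xy primitive_fst(2)[OF ih])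
  also have "(LINT s|lborel. indicator {0..x} s *\<^sub>R h s) = (LINT s|lborel. indicator {0..x} s * exp (2 * K * s))"
    using \<open>x \<le> 1\<close> by (intro Bochner_Integration.integral_cong) (auto simp: h_def indicator_def)
  also have "\<dots> = (exp (2 * K * x) - 1) / (2 * K)"
    using h[OF \<open>0 \<le> x\<close>] by (simp add: has_bochner_integral_iff)
  also have "y * ((exp (2 * K * x) - 1) / (2 * K)) \<le> 1 * (exp (2 * K * x) / (2 * K))"
    using \<open>0 \<le> x\<close> \<open>0 \<le> y\<close> \<open>y \<le> 1\<close> assms by (intro mult_mono divide_right_mono) auto
  finally show "primitive (\<lambda>p. exp (2 * K * fst p)) p \<le> exp (2 * K * fst p) / (2 * K)"
    by (simp add: xy)
qed

text \<open>The factor 1/(2K) of the weight meets the constant \<open>K\<close>, so a bound with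
  constant \<open>c\<close> turns into one with \<open>c / 2\<close> plus the source term. Keeping
  \<open>u\<close> separate from \<open>d\<close> covers both the Gronwall argument, where
  \<open>u\<close> is the primitive of \<open>d\<close> itself, and the Picard iteration, where it
  is the primitive of the previous term.\<close>

lemma primitive_weight_step:
  fixes d g u :: "real \<times> real \<Rightarrow> real"
  assumes K: "0 < K" and i: "integrable square_measure d" "integrable square_measure g" "integrable square_measure u"
    and g: "AE p in square_measure. 0 \<le> g p"
    and d: "AE p in square_measure. d p \<le> g p + K * u p"
    and u: "\<And>p. p \<in> unit_square \<Longrightarrow> u p \<le> c * exp (2 * K * fst p)"
    and p: "p \<in> unit_square" and c: "0 \<le> c"
  shows "primitive d p \<le> (LINT q|square_measure. g q) + c / 2 * exp (2 * K * fst p)"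
proof -
  let ?E = "\<lambda>p. exp (2 * K * fst p) :: real"
  have iE: "integrable square_measure (\<lambda>p. (K * c) *\<^sub>R ?E p)"
    using primitive_exp_le(1)[OF K] by simp
  have "primitive d p \<le> primitive (\<lambda>p. g p + (K * c) *\<^sub>R ?E p) p"
  proof (rule primitive_mono_AE)
    show "AE p in square_measure. d p \<le> g p + (K * c) *\<^sub>R ?E p"
      using d AE_space
    proof eventually_elim
      case (elim p)
      have "K * u p \<le> K * (c * ?E p)" using K u[of p] elim(2) by simp
      then show ?case using elim(1) by simp
    qed
  qed (use i iE in auto)
  also have "\<dots> = primitive g p + primitive (\<lambda>p. (K * c) *\<^sub>R ?E p) p"
    using i iE by (simp add: primitive_add_integrable)
  also have "\<dots> = primitive g p + (K * c) * primitive ?E p"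
    using primitive_scaleR[of "K * c" ?E p] by simp
  also have "\<dots> \<le> (LINT q|square_measure. g q) + (K * c) * (?E p / (2 * K))"
    using K c p by (intro add_mono primitive_le_integral i g mult_left_mono primitive_exp_le) auto
  finally show ?thesis using K by simp
qed

lemma primitive_gronwall:
  fixes d g :: "real \<times> real \<Rightarrow> real"
  assumes K: "0 < K" and i: "integrable square_measure d" "integrable square_measure g"
    and g: "AE p in square_measure. 0 \<le> g p" and d0: "AE p in square_measure. 0 \<le> d p"
    and d: "AE p in square_measure. d p \<le> g p + K * primitive d p"
  shows "primitive d p \<le> 2 * exp (2 * K) * (LINT q|square_measure. g q)"
proof (cases "p \<in> unit_square")
  case p: True
  define G where "G = (LINT q|square_measure. g q)"
  define N where "N = (LINT q|square_measure. d q)"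
  have GN: "0 \<le> G" "0 \<le> N" unfolding G_def N_def by (intro integral_nonneg_AE g d0)+
  \<comment> \<open>Since the weight is at least 1, one step maps the constant c to G + c/2. The
    fixed point of this map is 2G, and the excess of the crude initial bound is halved each
    time.\<close>
  have *: "primitive d p \<le> (2 * G + N / 2 ^ j) * exp (2 * K * fst p)" if "p \<in> unit_square" for j p
    using that
  proof (induction j arbitrary: p)
    case 0
    have "primitive d p \<le> N" unfolding N_def by (rule primitive_le_integral[OF i(1) d0])
    also have "\<dots> \<le> (2 * G + N) * 1" using GN by simp
    also have "\<dots> \<le> (2 * G + N) * exp (2 * K * fst p)"
      using GN K 0 by (intro mult_left_mono) (auto simp: unit_square_def)
    finally show ?case by simp
  next
    case (Suc j)
    have "primitive d p \<le> G + (2 * G + N / 2 ^ j) / 2 * exp (2 * K * fst p)"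
      unfolding G_def
      by (rule primitive_weight_step[OF K i integrable_primitive[OF i(1)] g d Suc.IH[unfolded G_def] Suc.prems])
        (use GN in \<open>auto simp: G_def\<close>)
    moreover have "G * 1 \<le> G * exp (2 * K * fst p)"
      using GN K Suc.prems by (intro mult_left_mono) (auto simp: unit_square_def)
    ultimately have "primitive d p
        \<le> G * exp (2 * K * fst p) + (2 * G + N / 2 ^ j) / 2 * exp (2 * K * fst p)"
      by simp
    then show ?case by (simp add: field_simps)
  qed
  have lim: "(\<lambda>j. (2 * G + N / 2 ^ j) * exp (2 * K * fst p)) \<longlonglongrightarrow> (2 * G + 0) * exp (2 * K * fst p)"
    by (intro tendsto_intros LIMSEQ_divide_realpow_zero) simp
  have "primitive d p \<le> 2 * G * exp (2 * K * fst p)"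
    using LIMSEQ_le_const[OF lim] *[OF p] by auto
  also have "\<dots> \<le> 2 * G * exp (2 * K)"
    using GN K p by (intro mult_left_mono) (auto simp: unit_square_def)
  finally show ?thesis by (simp add: G_def mult_ac)
next
  case False
  then show ?thesis using integral_nonneg_AE[OF g] by (simp add: primitive_outside)
qed

section \<open>First derivatives of primitives\<close>

lemma rect_integral_norm_eq_primitive:
  assumes xy: "(x, y) \<in> unit_square" and g: "integrable lborel g"
    and eq: "AE p in lborel. p \<in> unit_square \<longrightarrow> l p = g p"
  shows "rect_integral (\<lambda>p. norm (g p)) x y = primitive (\<lambda>p. norm (l p)) (x, y)"
proof -
  let ?F = "\<lambda>p. indicator ({0..x} \<times> {0..y}) p *\<^sub>R norm (g p)"
  have gm: "(\<lambda>p. norm (g p)) \<in> borel_measurable lborel" using g by auto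
  have "rect_integral (\<lambda>p. norm (g p)) x y = (LINT p|lebesgue. ?F p)"
    unfolding rect_integral_def
    by (subst integral_completion)
       (use gm in \<open>auto intro!: borel_measurable_times borel_measurable_indicator borel_closed closed_Times\<close>)
  also have "\<dots> = primitive (\<lambda>p. norm (g p)) (x, y)"
    using xy by (simp add: primitive_def integral_restrict_space)
  also have "\<dots> = primitive (\<lambda>p. norm (l p)) (x, y)"
  proof (rule primitive_cong_AE)
    show "(\<lambda>p. norm (g p)) \<in> borel_measurable square_measure"
      using gm by (intro measurable_restrict_space1 measurable_completion)
    have "AE p in lebesgue. p \<in> unit_square \<longrightarrow> l p = g p" using eq by (simp add: AE_completion_iff)
    then have "AE p in square_measure. l p = g p" by (simp add: AE_restrict_space_iff)
    then show "AE p in square_measure. norm (g p) = norm (l p)" by eventually_elim simp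
  qed
  finally show ?thesis .
qed

text \<open>The Borel representative \<open>g\<close> is handed out together with the formula,
  because the later majorant of \<open>pdx\<close> is built from slices of \<open>g\<close>.\<close>

lemma AE_pdx_primitive_eq_slice:
  fixes l :: "real \<times> real \<Rightarrow> 'a::euclidean_space"
  assumes l: "square_integrable l"
  obtains g where "integrable lborel g" "AE p in lborel. p \<in> unit_square \<longrightarrow> l p = g p"
    "AE p in square_measure. ((\<lambda>s. primitive l (s, snd p)) has_vector_derivative slice_integral g (fst p) (snd p))
        (at (fst p) within {0..1})"
    "AE p in square_measure. pdx (primitive l) p = slice_integral g (fst p) (snd p)"
proof -
  obtain g where g: "integrable lborel g"
    "\<And>x y. (x, y) \<in> unit_square \<Longrightarrow> primitive l (x, y) = rect_integral g x y"
    "AE p in lborel. p \<in> unit_square \<longrightarrow> l p = g p"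
    using primitive_eq_rect_integral[OF l] by blast
  \<comment> \<open>The derivative of \<open>rect_integral\<close> is available for positive
    abscissa only; the edge x = 0 is a null set.\<close>
  have "AE p :: real \<times> real in lborel. p \<bullet> (1, 0) \<noteq> 0"
    by (intro AE_lborel_inner_neq; simp add: Basis_prod_def)
  moreover note AE_fst_lborel[OF AE_rect_integral_derivative_all[OF g(1)]]
  ultimately have "AE p in lborel. p \<in> unit_square \<longrightarrow>
     ((\<lambda>s. primitive l (s, snd p)) has_vector_derivative slice_integral g (fst p) (snd p)) (at (fst p) within {0..1})"
  proof eventually_elim
    case (elim p)
    obtain x y where p: "p = (x, y)" by (cases p)
    show ?case
    proof
      assume Q: "p \<in> unit_square"
      then have xy: "0 < x" "x \<le> 1" "0 \<le> y" "y \<le> 1"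
        using elim(1) by (auto simp: p unit_square_def)
      have "((\<lambda>s. rect_integral g s y) has_vector_derivative slice_integral g x y) (at x within {0..1})"
        using elim(2) xy p by (auto intro: has_vector_derivative_at_within)
      then have "((\<lambda>s. primitive l (s, y)) has_vector_derivative slice_integral g x y) (at x within {0..1})"
        by (rule has_vector_derivative_transform[rotated 2]) (use g(2) xy in \<open>auto simp: unit_square_def\<close>)
      then show "((\<lambda>s. primitive l (s, snd p)) has_vector_derivative slice_integral g (fst p) (snd p)) (at (fst p) within {0..1})"
        by (simp add: p)
    qed
  qed
  then have D: "AE p in square_measure. ((\<lambda>s. primitive l (s, snd p)) has_vector_derivative slice_integral g (fst p) (snd p))
        (at (fst p) within {0..1})"
    by (simp add: AE_restrict_space_iff AE_completion_iff)
  have E: "AE p in square_measure. pdx (primitive l) p = slice_integral g (fst p) (snd p)"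
    using D AE_space
  proof eventually_elim
    case (elim p)
    then have "vector_derivative (\<lambda>s. primitive l (s, snd p)) (at (fst p) within {0..1}) = slice_integral g (fst p) (snd p)"
      by (intro vector_derivative_within_closed_interval) (auto simp: unit_square_def)
    then show ?case by (cases p) (simp add: pdx_def)
  qed
  show thesis using that[OF g(1,3) D E] .
qed

text \<open>At all points of height at most y, z_x is dominated by the integral of |l| along the
  vertical segment from 0 to y, a function of the abscissa alone. Over the rectangle with corner (x,
  y) this majorant integrates to y times the double integral of |l|, and y is at most 1.\<close>

lemma pdx_primitive:
  fixes l :: "real \<times> real \<Rightarrow> 'a::euclidean_space"
  assumes l: "square_integrable l"
  shows "AE p in square_measure. ((\<lambda>s. primitive l (s, snd p)) has_vector_derivative pdx (primitive l) p)
        (at (fst p) within {0..1})"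
    and "integrable square_measure (pdx (primitive l))"
    and "primitive (\<lambda>p. norm (pdx (primitive l) p)) q \<le> primitive (\<lambda>p. norm (l p)) q"
proof -
  obtain g where g: "integrable lborel g" "AE p in lborel. p \<in> unit_square \<longrightarrow> l p = g p"
    "AE p in square_measure. ((\<lambda>s. primitive l (s, snd p)) has_vector_derivative slice_integral g (fst p) (snd p))
        (at (fst p) within {0..1})"
    and pdx: "AE p in square_measure. pdx (primitive l) p = slice_integral g (fst p) (snd p)"
    using AE_pdx_primitive_eq_slice[OF l] by blast
  show "AE p in square_measure. ((\<lambda>s. primitive l (s, snd p)) has_vector_derivative pdx (primitive l) p)
        (at (fst p) within {0..1})"
    using g(3) pdx by eventually_elim simp
  have gm: "g \<in> borel_measurable borel" using g(1) by auto
  define h where "h = (\<lambda>y s. slice_integral (\<lambda>p. norm (g p)) s y)"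
  have ih: "integrable lborel (h y)" for y
    unfolding h_def by (rule integrable_slice_integral[OF integrable_norm[OF g(1)]])
  have "(\<lambda>p. slice_integral g (fst p) (snd p)) \<in> borel_measurable square_measure"
    by (intro measurable_restrict_space1 measurable_completion) (simp add: measurable_slice_integral[OF gm])
  then have m: "pdx (primitive l) \<in> borel_measurable square_measure"
    by (rule measurable_square_AE) (use pdx in eventually_elim, simp)
  have "AE x in lborel. integrable lborel (\<lambda>t. g (x, t))"
    using lborel_pair.AE_integrable_fst'[of g] g(1) by (simp add: lborel_prod)
  then have "AE p in (lborel :: (real \<times> real) measure). integrable lborel (\<lambda>t. g (fst p, t))"
    by (rule AE_fst_lborel)
  then have "AE p in square_measure. integrable lborel (\<lambda>t. g (fst p, t))"
    by (auto simp: AE_restrict_space_iff AE_completion_iff elim!: eventually_mono)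
  \<comment> \<open>The quantifier over \<open>y\<close> stands inside, so that one null set serves
    every height.\<close>
  with pdx have bound: "AE p in square_measure. \<forall>y. snd p \<in> {0..y} \<longrightarrow> norm (pdx (primitive l) p) \<le> h y (fst p)"
  proof eventually_elim
    case (elim p)
    show ?case
    proof (intro allI impI)
      fix y assume "snd p \<in> {0..y}"
      then have "norm (slice_integral g (fst p) (snd p) - slice_integral g (fst p) 0) \<le> h y (fst p) - h 0 (fst p)"
        unfolding h_def by (intro slice_integral_diff_bound elim) auto
      moreover have "slice_integral g (fst p) 0 = 0" "h 0 (fst p) = 0"
        unfolding h_def slice_integral_def
        by (intro integral_eq_zero_AE, use AE_lborel_singleton[of "0::real"] in eventually_elim, simp)+
      ultimately show "norm (pdx (primitive l) p) \<le> h y (fst p)"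
        using elim(1) by simp
    qed
  qed
  show i: "integrable square_measure (pdx (primitive l))"
  proof (rule Bochner_Integration.integrable_bound[OF primitive_fst(1)[OF ih[of 1]] m])
    show "AE p in square_measure. norm (pdx (primitive l) p) \<le> norm (h 1 (fst p))"
      using bound AE_space
    proof eventually_elim
      case (elim p)
      then have "norm (pdx (primitive l) p) \<le> h 1 (fst p)" by (auto simp: unit_square_def)
      then show ?case by simp
    qed
  qed
  show "primitive (\<lambda>p. norm (pdx (primitive l) p)) q \<le> primitive (\<lambda>p. norm (l p)) q"
  proof (cases "q \<in> unit_square")
    case True
    obtain x y where q: "q = (x, y)" by (cases q)
    have xy: "(x, y) \<in> unit_square" "0 \<le> y" "y \<le> 1" using True q by (auto simp: unit_square_def)
    have "primitive (\<lambda>p. norm (pdx (primitive l) p)) (x, y) \<le> primitive (\<lambda>p. h y (fst p)) (x, y)"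
      unfolding primitive_eq_square_integral[OF xy(1)]
    proof (rule integral_mono_AE)
      show "AE p in square_measure. indicator ({0..x} \<times> {0..y}) p *\<^sub>R norm (pdx (primitive l) p)
         \<le> indicator ({0..x} \<times> {0..y}) p *\<^sub>R h y (fst p)"
        using bound by eventually_elim (auto simp: indicator_def)
    qed (intro integrable_square_rectangle integrable_norm i primitive_fst(1) ih)+
    also have "\<dots> = y * (LINT s|lborel. indicator {0..x} s *\<^sub>R h y s)"
      by (rule primitive_fst(2)[OF ih xy(1)])
    also have "(LINT s|lborel. indicator {0..x} s *\<^sub>R h y s) = integral {0..x} (h y)"
      using set_borel_integral_eq_integral(2)[OF integrable_set_lborel_real[OF ih]]
      by (simp add: set_lebesgue_integral_def)
    also have "\<dots> = rect_integral (\<lambda>p. norm (g p)) x y"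
      unfolding h_def by (rule rect_integral_eq_integral_slice[OF integrable_norm[OF g(1)], symmetric])
    also have "\<dots> = primitive (\<lambda>p. norm (l p)) (x, y)"
      by (rule rect_integral_norm_eq_primitive[OF xy(1) g(1,2)])
    also have "y * primitive (\<lambda>p. norm (l p)) (x, y) \<le> 1 * primitive (\<lambda>p. norm (l p)) (x, y)"
      using xy by (intro mult_right_mono primitive_nonneg) auto
    finally show ?thesis by (simp add: q)
  qed (simp add: primitive_outside)
qed

section \<open>Transfer from x to y\<close>

lemma integrable_square_swap:
  fixes l :: "real \<times> real \<Rightarrow> 'a::euclidean_space"
  assumes "integrable square_measure l"
  shows "integrable square_measure (l \<circ> prod.swap)"
  using integrable_distr[OF swap_square_measure(1), of l] assms
  by (simp add: swap_square_measure(2) o_def)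

lemma square_integrable_swap:
  assumes "square_integrable l"
  shows "square_integrable (l \<circ> prod.swap)"
  using assms measurable_comp[OF swap_square_measure(1), of l borel]
    integrable_square_swap[of "\<lambda>p. (norm (l p))\<^sup>2"]
  by (simp add: square_integrable_def o_def)

text \<open>Reflection turns one partial function of the primitive into the other, so the identity
  holds at every point, including those where \<open>vector_derivative\<close> takes an arbitrary
  value.\<close>

lemma pdy_primitive_eq:
  assumes l: "square_integrable l"
  shows "pdy (primitive l) = pdx (primitive (l \<circ> prod.swap)) \<circ> prod.swap"
  using l by (auto simp: pdx_def pdy_def square_integrable_def fun_eq_iff primitive_swap)

lemma pdy_primitive:
  fixes l :: "real \<times> real \<Rightarrow> 'a::euclidean_space"
  assumes l: "square_integrable l"
  shows "AE p in square_measure. ((\<lambda>t. primitive l (fst p, t)) has_vector_derivative pdy (primitive l) p)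
        (at (snd p) within {0..1})"
    and "integrable square_measure (pdy (primitive l))"
    and "primitive (\<lambda>p. norm (pdy (primitive l) p)) q \<le> primitive (\<lambda>p. norm (l p)) q"
proof -
  let ?l = "l \<circ> prod.swap"
  have lm: "l \<in> borel_measurable square_measure" using l by (simp add: square_integrable_def)
  note sw = pdx_primitive[OF square_integrable_swap[OF l]]
  have swap: "primitive ?l p = primitive l (prod.swap p)" for p
    by (rule primitive_swap[OF lm])
  show "AE p in square_measure. ((\<lambda>t. primitive l (fst p, t)) has_vector_derivative pdy (primitive l) p)
        (at (snd p) within {0..1})"
    using AE_square_swap[OF sw(1)] by (simp add: pdy_primitive_eq[OF l] swap[unfolded o_def] swap)
  show "integrable square_measure (pdy (primitive l))"
    unfolding pdy_primitive_eq[OF l] by (rule integrable_square_swap[OF sw(2)])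
  have "primitive (\<lambda>p. norm (pdy (primitive l) p)) q = primitive ((\<lambda>p. norm (pdx (primitive ?l) p)) \<circ> prod.swap) q"
    by (simp add: pdy_primitive_eq[OF l] o_def)
  also have "\<dots> = primitive (\<lambda>p. norm (pdx (primitive ?l) p)) (prod.swap q)"
    using sw(2) by (intro primitive_swap) auto
  also have "\<dots> \<le> primitive (\<lambda>p. norm (?l p)) (prod.swap q)"
    by (rule sw(3))
  also have "\<dots> = primitive ((\<lambda>p. norm (l p)) \<circ> prod.swap) (prod.swap q)"
    by (simp add: o_def)
  also have "\<dots> = primitive (\<lambda>p. norm (l p)) q"
    using lm by (subst primitive_swap) auto
  finally show "primitive (\<lambda>p. norm (pdy (primitive l) p)) q \<le> primitive (\<lambda>p. norm (l p)) q" .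
qed

lemma square_integrable_lincomb:
  "square_integrable l \<Longrightarrow> square_integrable m \<Longrightarrow> square_integrable (\<lambda>p. a *\<^sub>R l p + c *\<^sub>R m p)"
  by (intro square_integrable_add square_integrable_scaleR)

lemma primitive_lincomb:
  assumes "square_integrable l" "square_integrable m"
  shows "primitive (\<lambda>p. a *\<^sub>R l p + c *\<^sub>R m p) p = a *\<^sub>R primitive l p + c *\<^sub>R primitive m p"
  by (simp add: primitive_add primitive_scaleR square_integrable_scaleR assms)

text \<open>\<open>vector_derivative\<close> is linear only where the derivatives exist; this is why
  their existence almost everywhere is recorded in \<open>pdx_primitive\<close>.\<close>

lemma AE_pdx_primitive_lincomb:
  assumes l: "square_integrable l" and m: "square_integrable m"
  shows "AE p in square_measure.
    pdx (primitive (\<lambda>p. a *\<^sub>R l p + c *\<^sub>R m p)) p = a *\<^sub>R pdx (primitive l) p + c *\<^sub>R pdx (primitive m) p"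
  using pdx_primitive(1)[OF l] pdx_primitive(1)[OF m] AE_space
proof eventually_elim
  case (elim p)
  obtain x y where p: "p = (x, y)" by (cases p)
  have xy: "0 \<le> x" "x \<le> 1" using elim(3) by (auto simp: p unit_square_def)
  have "((\<lambda>s. a *\<^sub>R primitive l (s, y) + c *\<^sub>R primitive m (s, y)) has_vector_derivative
      a *\<^sub>R pdx (primitive l) p + c *\<^sub>R pdx (primitive m) p) (at x within {0..1})"
    using elim(1,2) by (auto simp: p intro!: has_vector_derivative_add bounded_linear.has_vector_derivative[OF bounded_linear_scaleR_right])
  then have "((\<lambda>s. primitive (\<lambda>p. a *\<^sub>R l p + c *\<^sub>R m p) (s, y)) has_vector_derivative
      a *\<^sub>R pdx (primitive l) p + c *\<^sub>R pdx (primitive m) p) (at x within {0..1})"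
    by (simp add: primitive_lincomb l m)
  then have "vector_derivative (\<lambda>s. primitive (\<lambda>p. a *\<^sub>R l p + c *\<^sub>R m p) (s, y)) (at x within {0..1})
      = a *\<^sub>R pdx (primitive l) p + c *\<^sub>R pdx (primitive m) p"
    using xy by (intro vector_derivative_within_closed_interval) auto
  then show ?case by (simp add: pdx_def p)
qed

lemma AE_pdy_primitive_lincomb:
  assumes l: "square_integrable l" and m: "square_integrable m"
  shows "AE p in square_measure.
    pdy (primitive (\<lambda>p. a *\<^sub>R l p + c *\<^sub>R m p)) p = a *\<^sub>R pdy (primitive l) p + c *\<^sub>R pdy (primitive m) p"
  using AE_square_swap[OF AE_pdx_primitive_lincomb[OF square_integrable_swap[OF l] square_integrable_swap[OF m]]]
  by (simp add: pdy_primitive_eq square_integrable_lincomb l m o_def)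

section \<open>The Volterra operator\<close>

text \<open>Continuous differentiability is replaced by continuity and a Lipschitz bound on each
  ball. In this form the nonlinear equation and its linearization, which has \<open>b\<close> equal
  to 0, are two instances of the same theory.\<close>

locale volterra_data =
  fixes f1 f2 :: "real \<times> real \<Rightarrow> real^'n \<Rightarrow> real^'n" and A1 A2 :: "real \<times> real \<Rightarrow> real^'n^'n"
    and B :: real and b :: "real \<times> real \<Rightarrow> real"
  assumes f_measurable: "(\<lambda>p. f1 p z) \<in> borel_measurable square_measure" "(\<lambda>p. f2 p z) \<in> borel_measurable square_measure"
    and A_measurable [measurable]: "A1 \<in> borel_measurable square_measure" "A2 \<in> borel_measurable square_measure"
    and f_continuous: "AE p in square_measure. continuous_on UNIV (f1 p) \<and> continuous_on UNIV (f2 p)"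
    and B_pos: "0 < B" and b: "square_integrable b" "\<And>p. p \<in> unit_square \<Longrightarrow> 0 \<le> b p"
    and growth: "AE p in square_measure. \<forall>z. norm (f1 p z) \<le> B * norm z + b p \<and> norm (f2 p z) \<le> B * norm z + b p"
    and A_bound: "AE p in square_measure. norm (A1 p) \<le> B \<and> norm (A2 p) \<le> B"
    and lipschitz: "\<exists>M. AE p in square_measure. \<forall>z w. norm z \<le> R \<longrightarrow> norm w \<le> R \<longrightarrow>
        norm (f1 p z - f1 p w) \<le> M * norm (z - w) \<and> norm (f2 p z - f2 p w) \<le> M * norm (z - w)"
begin

definition integrand :: "(real \<times> real \<Rightarrow> real^'n) \<Rightarrow> real \<times> real \<Rightarrow> real^'n" where
  "integrand l q = f2 q (primitive l q) + A1 q *v pdx (primitive l) q + A2 q *v pdy (primitive l) q"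

definition volterra :: "(real \<times> real \<Rightarrow> real^'n) \<Rightarrow> real \<times> real \<Rightarrow> real^'n" where
  "volterra l p = f1 p (primitive l p) + primitive (integrand l) p"

lemma solves_primitive_iff:
  assumes l: "square_integrable l"
  shows "solves f1 f2 A1 A2 v (primitive l) \<longleftrightarrow> (AE p in square_measure. l p + volterra l p = v p)"
proof -
  have eq: "pdxy (primitive l) p + f1 p (primitive l p)
      + (LINT q|lebesgue_on ({0..fst p} \<times> {0..snd p}). integrand l q) = l p + volterra l p"
    if "pdxy (primitive l) p = l p" "p \<in> unit_square" for p
    using that by (cases p) (simp add: volterra_def primitive_def[of "integrand l"])
  have "AE p in square_measure. (pdxy (primitive l) p + f1 p (primitive l p)
      + (LINT q|lebesgue_on ({0..fst p} \<times> {0..snd p}). integrand l q) = v p) \<longleftrightarrow> (l p + volterra l p = v p)"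
    using AE_pdxy_primitive[OF l] AE_space
  proof eventually_elim
    case (elim p)
    then have "p \<in> unit_square" by simp
    with elim(1) show ?case by (subst eq) simp_all
  qed
  then have "(AE p in square_measure. pdxy (primitive l) p + f1 p (primitive l p)
      + (LINT q|lebesgue_on ({0..fst p} \<times> {0..snd p}). integrand l q) = v p) \<longleftrightarrow>
    (AE p in square_measure. l p + volterra l p = v p)"
    by (rule eventually_subst)
  then show ?thesis
    by (simp add: solves_def split_beta' integrand_def)
qed

lemma A_mult_bound:
  "AE p in square_measure. \<forall>z. norm (A1 p *v z) \<le> B * norm z \<and> norm (A2 p *v z) \<le> B * norm z"
  using A_bound
proof eventually_elim
  case (elim p)
  then show ?case
    by (auto intro!: order_trans[OF norm_matrix_vector_mult_le] mult_right_mono)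
qed

lemma integrable_b: "integrable square_measure b"
  by (rule square_integrable_imp_integrable[OF b(1)])

lemma b_nonneg: "AE p in square_measure. 0 \<le> b p"
  by (rule AE_I2) (simp add: b(2))

context
  fixes l :: "real \<times> real \<Rightarrow> real^'n"
  assumes l: "square_integrable l"
begin

lemma f_primitive_measurable: 
  "(\<lambda>p. f1 p (primitive l p)) \<in> borel_measurable square_measure" "(\<lambda>p. f2 p (primitive l p)) \<in> borel_measurable square_measure"
proof -
  have "AE p in square_measure. continuous_on UNIV (f1 p)" "AE p in square_measure. continuous_on UNIV (f2 p)"
    using f_continuous by simp_all
  moreover have "primitive l \<in> borel_measurable square_measure"
    using square_integrable_imp_integrable[OF l] by (intro measurable_primitive) simp
  ultimately show "(\<lambda>p. f1 p (primitive l p)) \<in> borel_measurable square_measure"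
      "(\<lambda>p. f2 p (primitive l p)) \<in> borel_measurable square_measure"
    by (simp_all add: measurable_superposition f_measurable)
qed

lemma integrand_measurable: "integrand l \<in> borel_measurable square_measure"
proof -
  note [measurable] = f_primitive_measurable borel_measurable_integrable[OF pdx_primitive(2)[OF l]] borel_measurable_integrable[OF pdy_primitive(2)[OF l]]
  show ?thesis unfolding integrand_def by measurable
qed

lemma integrand_bound:
  "AE p in square_measure. norm (integrand l p) \<le>
     B * norm (primitive l p) + b p + B * norm (pdx (primitive l) p) + B * norm (pdy (primitive l) p)"
  using growth A_mult_bound
proof eventually_elim
  case (elim p)
  have "norm (integrand l p) \<le> norm (f2 p (primitive l p)) + norm (A1 p *v pdx (primitive l) p) + norm (A2 p *v pdy (primitive l) p)"
    unfolding integrand_def by (rule norm_triangle_le[OF add_right_mono[OF norm_triangle_ineq]])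
  also have "\<dots> \<le> (B * norm (primitive l p) + b p) + B * norm (pdx (primitive l) p) + B * norm (pdy (primitive l) p)"
    using elim by (intro add_mono) auto
  finally show ?case .
qed

lemma integrable_integrand: "integrable square_measure (integrand l)"
proof (rule Bochner_Integration.integrable_bound[OF _ integrand_measurable])
  let ?g = "\<lambda>p. B * norm (primitive l p) + b p + B * norm (pdx (primitive l) p) + B * norm (pdy (primitive l) p)"
  show "integrable square_measure ?g"
    using integrable_norm[OF integrable_primitive[OF square_integrable_imp_integrable[OF l]]] integrable_b integrable_norm[OF pdx_primitive(2)[OF l]]
      integrable_norm[OF pdy_primitive(2)[OF l]] by simp
  show "AE p in square_measure. norm (integrand l p) \<le> norm (?g p)"
    using integrand_bound by eventually_elim simp
qed

lemma volterra_measurable: "volterra l \<in> borel_measurable square_measure"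
proof -
  note [measurable] = f_primitive_measurable measurable_primitive[OF integrand_measurable]
  show ?thesis unfolding volterra_def by measurable
qed

end

section \<open>Growth and Lipschitz bounds\<close>

text \<open>The derivatives are comparable to P |l| only under a further double integral. One lemma
  serves two estimates: for growth \<open>M\<close> is \<open>B\<close> and \<open>g\<close> is
  \<open>b\<close>; for differences \<open>M\<close> is a Lipschitz constant and \<open>g\<close> is
  0.\<close>

lemma primitive_first_order_bound:
  fixes l :: "real \<times> real \<Rightarrow> real^'n" and g :: "real \<times> real \<Rightarrow> real"
  assumes l: "square_integrable l" and M: "0 \<le> M" 
    and g: "integrable square_measure g" "AE p in square_measure. 0 \<le> g p"
  shows "primitive (\<lambda>p. M * norm (primitive l p) + g p + B * norm (pdx (primitive l) p) + B * norm (pdy (primitive l) p)) p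
    \<le> (LINT q|square_measure. g q) + (M + 2 * B) * primitive (\<lambda>p. norm (l p)) p"
proof -
  let ?P = "\<lambda>p. norm (primitive l p)" and ?X = "\<lambda>p. norm (pdx (primitive l) p)" and ?Y = "\<lambda>p. norm (pdy (primitive l) p)"
    and ?D = "primitive (\<lambda>p. norm (l p)) p"
  have i: "integrable square_measure ?P" "integrable square_measure ?X" "integrable square_measure ?Y"
    by (intro integrable_norm integrable_primitive square_integrable_imp_integrable l pdx_primitive(2) pdy_primitive(2))+
  have "primitive (\<lambda>p. M * ?P p + g p + B * ?X p + B * ?Y p) p
      = M * primitive ?P p + primitive g p + B * primitive ?X p + B * primitive ?Y p"
    using i g primitive_scaleR[of M ?P p] primitive_scaleR[of B ?X p] primitive_scaleR[of B ?Y p]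
    by (simp add: primitive_add_integrable)
  also have "\<dots> \<le> M * ?D + (LINT q|square_measure. g q) + B * ?D + B * ?D"
  proof -
    have "primitive ?P p \<le> primitive (primitive (\<lambda>p. norm (l p))) p"
      using square_integrable_imp_integrable[OF l] by (intro primitive_mono_AE i integrable_primitive) (auto intro!: norm_primitive_le)
    also have "\<dots> \<le> ?D"
      using square_integrable_imp_integrable[OF l] by (intro primitive_primitive_le) auto
    finally show ?thesis
      using M B_pos by (intro add_mono mult_left_mono primitive_le_integral g pdx_primitive(3) pdy_primitive(3) l) auto
  qed
  finally show ?thesis by (simp add: algebra_simps)
qed

text \<open>The part of the bound that does not depend on the density: \<open>b\<close> enters
  pointwise through \<open>f1\<close> and through its integral by way of \<open>f2\<close>.\<close>

definition \<beta> :: "real \<times> real \<Rightarrow> real" where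
  "\<beta> p = b p + (LINT q|square_measure. b q)"

lemma square_integrable_\<beta>: "square_integrable \<beta>"
  unfolding \<beta>_def by (intro square_integrable_add b) simp

lemma \<beta>_nonneg: "AE p in square_measure. 0 \<le> \<beta> p"
  using b_nonneg
proof eventually_elim
  case (elim p)
  then show ?case using integral_nonneg_AE[OF b_nonneg] by (simp add: \<beta>_def)
qed

text \<open>The factor 4 counts the contributions of \<open>f1\<close>, \<open>f2\<close>,
  \<open>A1\<close> and \<open>A2\<close>, each of which costs one \<open>B\<close>.\<close>

lemma volterra_growth:
  assumes l: "square_integrable l"
  shows "AE p in square_measure. norm (volterra l p) \<le> \<beta> p + 4 * B * primitive (\<lambda>p. norm (l p)) p"
  using growth
proof eventually_elim
  case (elim p)
  let ?D = "primitive (\<lambda>p. norm (l p))"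
  let ?g = "\<lambda>p. B * norm (primitive l p) + b p + B * norm (pdx (primitive l) p) + B * norm (pdy (primitive l) p)"
  have 1: "norm (volterra l p) \<le> norm (f1 p (primitive l p)) + norm (primitive (integrand l) p)"
    unfolding volterra_def by (rule norm_triangle_ineq)
  have "norm (primitive (integrand l) p) \<le> primitive (\<lambda>p. norm (integrand l p)) p"
    by (rule norm_primitive_le[OF integrable_integrand[OF l]])
  also have "\<dots> \<le> primitive ?g p"
    using integrable_norm[OF integrable_primitive[OF square_integrable_imp_integrable[OF l]]] integrable_b integrable_norm[OF pdx_primitive(2)[OF l]]
      integrable_norm[OF pdy_primitive(2)[OF l]]
    by (intro primitive_mono_AE integrable_norm integrable_integrand l integrand_bound) simp
  also have "\<dots> \<le> (LINT q|square_measure. b q) + (B + 2 * B) * ?D p"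
    using B_pos by (intro primitive_first_order_bound l integrable_b b_nonneg) auto
  finally have 2: "norm (primitive (integrand l) p) \<le> (LINT q|square_measure. b q) + 3 * (B * ?D p)"
    by simp
  have "norm (f1 p (primitive l p)) \<le> B * norm (primitive l p) + b p"
    using elim by auto
  moreover have "B * norm (primitive l p) \<le> B * ?D p"
    using B_pos by (intro mult_left_mono norm_primitive_le[OF square_integrable_imp_integrable[OF l]]) simp
  ultimately show ?case using 1 2 unfolding \<beta>_def by linarith
qed

text \<open>A bound \<open>R\<close> on the primitives of the norms confines z to the ball of radius
  \<open>R\<close>, where \<open>lipschitz\<close> applies; the terms with \<open>A1\<close> and
  \<open>A2\<close> are linear and act on the difference directly. The constant is fixed before the
  two densities are given.\<close>

lemma volterra_lipschitz:
  obtains K where "0 < K" "\<And>l m. \<lbrakk>square_integrable l; square_integrable m;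
     \<And>p. primitive (\<lambda>p. norm (l p)) p \<le> R; \<And>p. primitive (\<lambda>p. norm (m p)) p \<le> R\<rbrakk> \<Longrightarrow>
     AE p in square_measure. norm (volterra l p - volterra m p) \<le> K * primitive (\<lambda>p. norm (l p - m p)) p"
proof -
  obtain M0 where M0: "AE p in square_measure. \<forall>z w. norm z \<le> R \<longrightarrow> norm w \<le> R \<longrightarrow>
        norm (f1 p z - f1 p w) \<le> M0 * norm (z - w) \<and> norm (f2 p z - f2 p w) \<le> M0 * norm (z - w)"
    using lipschitz by blast
  \<comment> \<open>Nothing forces \<open>M0\<close> to be nonnegative, which the multiplications
    below require.\<close>
  define M where "M = max M0 0"
  have M: "AE p in square_measure. \<forall>z w. norm z \<le> R \<longrightarrow> norm w \<le> R \<longrightarrow>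
        norm (f1 p z - f1 p w) \<le> M * norm (z - w) \<and> norm (f2 p z - f2 p w) \<le> M * norm (z - w)"
    using M0
  proof eventually_elim
    case (elim p)
    have "M0 * norm z \<le> M * norm z" for z :: "real^'n"
      by (rule mult_right_mono) (simp_all add: M_def)
    then show ?case using elim by (meson order_trans)
  qed
  have M': "0 \<le> M" by (simp add: M_def)
  show thesis
  proof (rule that)
    show "0 < 2 * M + 2 * B" using M' B_pos by simp
  next
    fix l m :: "real \<times> real \<Rightarrow> real^'n"
    assume l: "square_integrable l" and m: "square_integrable m"
      and R: "\<And>p. primitive (\<lambda>p. norm (l p)) p \<le> R" "\<And>p. primitive (\<lambda>p. norm (m p)) p \<le> R"
    define d where "d = (\<lambda>p. l p - m p)"
    have d: "square_integrable d"
      unfolding d_def using square_integrable_add[OF l square_integrable_uminus[OF m]] by simp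
    have pd: "primitive d p = primitive l p - primitive m p" for p
      unfolding d_def by (rule primitive_diff_integrable[OF square_integrable_imp_integrable[OF l] square_integrable_imp_integrable[OF m]])
    have R': "norm (primitive l p) \<le> R" "norm (primitive m p) \<le> R" for p
      using R[of p] norm_primitive_le[OF square_integrable_imp_integrable[OF l], of p] norm_primitive_le[OF square_integrable_imp_integrable[OF m], of p] by auto
    \<comment> \<open>The summand 0 gives this the shape of
      \<open>primitive_first_order_bound\<close> with source term zero.\<close>
    let ?g = "\<lambda>p. M * norm (primitive d p) + 0 + B * norm (pdx (primitive d) p) + B * norm (pdy (primitive d) p)"
    have ie: "integrable square_measure (\<lambda>p. integrand l p - integrand m p)"
      by (intro Bochner_Integration.integrable_diff integrable_integrand l m)
    have g: "AE p in square_measure. norm (integrand l p - integrand m p) \<le> ?g p"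
      using M A_mult_bound AE_pdx_primitive_lincomb[OF l m, of 1 "-1"] AE_pdy_primitive_lincomb[OF l m, of 1 "-1"]
    proof eventually_elim
      case (elim p)
      have "integrand l p - integrand m p = (f2 p (primitive l p) - f2 p (primitive m p))
          + A1 p *v pdx (primitive d) p + A2 p *v pdy (primitive d) p"
        using elim(3,4) by (simp add: integrand_def d_def matrix_vector_mult_diff_distrib)
      then have "norm (integrand l p - integrand m p) \<le> norm (f2 p (primitive l p) - f2 p (primitive m p))
          + norm (A1 p *v pdx (primitive d) p) + norm (A2 p *v pdy (primitive d) p)"
        by (simp only: norm_triangle_le[OF add_right_mono[OF norm_triangle_ineq]])
      also have "\<dots> \<le> M * norm (primitive d p) + B * norm (pdx (primitive d) p) + B * norm (pdy (primitive d) p)"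
        unfolding pd using elim(1,2) R' by (intro add_mono) auto
      finally show ?case by simp
    qed
    show "AE p in square_measure. norm (volterra l p - volterra m p) \<le> (2 * M + 2 * B) * primitive (\<lambda>p. norm (l p - m p)) p"
      using M
    proof eventually_elim
      case (elim p)
      let ?D = "primitive (\<lambda>p. norm (d p))"
      have "volterra l p - volterra m p = (f1 p (primitive l p) - f1 p (primitive m p)) + primitive (\<lambda>p. integrand l p - integrand m p) p"
        using integrable_integrand[OF l] integrable_integrand[OF m] by (simp add: volterra_def primitive_diff_integrable)
      then have 1: "norm (volterra l p - volterra m p) \<le> norm (f1 p (primitive l p) - f1 p (primitive m p))
          + norm (primitive (\<lambda>p. integrand l p - integrand m p) p)"
        by (simp only: norm_triangle_ineq)
      have "norm (f1 p (primitive l p) - f1 p (primitive m p)) \<le> M * norm (primitive d p)"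
        unfolding pd using elim R' by auto
      also have "\<dots> \<le> M * ?D p"
        using M' by (intro mult_left_mono norm_primitive_le square_integrable_imp_integrable d)
      finally have 2: "norm (f1 p (primitive l p) - f1 p (primitive m p)) \<le> M * ?D p" .
      have "norm (primitive (\<lambda>p. integrand l p - integrand m p) p) \<le> primitive (\<lambda>p. norm (integrand l p - integrand m p)) p"
        by (rule norm_primitive_le[OF ie])
      also have "\<dots> \<le> primitive ?g p"
        using integrable_norm[OF integrable_primitive[OF square_integrable_imp_integrable[OF d]]] integrable_norm[OF pdx_primitive(2)[OF d]]
          integrable_norm[OF pdy_primitive(2)[OF d]]
        by (intro primitive_mono_AE integrable_norm ie g) simp
      also have "\<dots> \<le> (LINT q|square_measure. 0) + (M + 2 * B) * ?D p"
        using M' by (intro primitive_first_order_bound d) auto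
      finally show ?case using 1 2 by (simp add: d_def algebra_simps)
    qed
  qed
qed

end

section \<open>A priori bounds, stability and Picard iteration\<close>

lemma geometric_increments_limit:
  fixes x :: "nat \<Rightarrow> 'a::banach"
  assumes x: "\<And>j. norm (x (Suc j) - x j) \<le> C / 2 ^ j"
  shows "convergent x" "norm (lim x - x j) \<le> 2 * C / 2 ^ j"
proof -
  have C: "0 \<le> C" using order_trans[OF norm_ge_zero x[of 0]] by simp
  \<comment> \<open>Subtracting the remaining geometric tail makes the induction close
    exactly.\<close>
  have tele: "norm (x (j + n) - x j) \<le> 2 * C / 2 ^ j - 2 * C / 2 ^ (j + n)" for j n
  proof (induction n)
    case (Suc n)
    have "norm (x (j + Suc n) - x j) \<le> norm (x (Suc (j + n)) - x (j + n)) + norm (x (j + n) - x j)"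
      using norm_triangle_ineq[of "x (Suc (j + n)) - x (j + n)" "x (j + n) - x j"] by simp
    also have "\<dots> \<le> C / 2 ^ (j + n) + (2 * C / 2 ^ j - 2 * C / 2 ^ (j + n))"
      using Suc x by (intro add_mono)
    also have "\<dots> = 2 * C / 2 ^ j - 2 * C / 2 ^ (j + Suc n)"
      by (simp add: field_simps)
    finally show ?case .
  qed simp
  have bound: "norm (x (j + n) - x j) \<le> 2 * C / 2 ^ j" for j n
    by (rule order_trans[OF tele]) (use C in simp)
  have lim0: "(\<lambda>j. 2 * C / 2 ^ j) \<longlonglongrightarrow> 0"
    by (rule LIMSEQ_divide_realpow_zero) simp
  have "Cauchy x"
  proof (rule CauchyI')
    fix e :: real assume "0 < e"
    then obtain N where N: "\<And>j. N \<le> j \<Longrightarrow> 2 * C / 2 ^ j < e"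
      using order_tendstoD(2)[OF lim0] by (auto simp: eventually_sequentially)
    have "dist (x m) (x n) < e" if "N \<le> m" "m < n" for m n
      using bound[of m "n - m"] N[of m] that by (simp add: dist_norm norm_minus_commute)
    then show "\<exists>M. \<forall>m\<ge>M. \<forall>n>m. dist (x m) (x n) < e" by blast
  qed
  then show conv: "convergent x" by (rule Cauchy_convergent)
  have "(\<lambda>n. x (j + n)) \<longlonglongrightarrow> lim x"
    using LIMSEQ_ignore_initial_segment[OF conv[unfolded convergent_LIMSEQ_iff], of j] by (simp add: add.commute)
  then have "(\<lambda>n. norm (x (j + n) - x j)) \<longlonglongrightarrow> norm (lim x - x j)"
    by (intro tendsto_intros)
  then show "norm (lim x - x j) \<le> 2 * C / 2 ^ j"
    by (rule LIMSEQ_le_const2) (use bound in auto)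
qed

lemma square_integrable_diff:
  assumes "square_integrable f" "square_integrable g"
  shows "square_integrable (\<lambda>p. f p - g p)"
  using square_integrable_add[OF assms(1) square_integrable_uminus[OF assms(2)]] by simp

text \<open>Passes from a pointwise stability estimate to an L2 estimate: the square of a sum is at
  most twice the sum of the squares, and the square of a mean is at most the mean of the
  squares.\<close>

lemma square_norm_integral_bound:
  assumes d: "square_integrable d" and g: "square_integrable g" and C: "0 \<le> C"
    and le: "AE p in square_measure. norm (d p) \<le> norm (g p) + C * (LINT q|square_measure. norm (g q))"
  shows "(LINT p|square_measure. (norm (d p))\<^sup>2) \<le> (2 + 2 * C\<^sup>2) * (LINT p|square_measure. (norm (g p))\<^sup>2)"
proof -
  define I where "I = (LINT q|square_measure. norm (g q))"
  have i: "integrable square_measure (\<lambda>p. (norm (d p))\<^sup>2)" "integrable square_measure (\<lambda>p. (norm (g p))\<^sup>2)"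
    using d g by (simp_all add: square_integrable_def)
  have "(LINT p|square_measure. (norm (d p))\<^sup>2) \<le> (LINT p|square_measure. 2 * (norm (g p))\<^sup>2 + 2 * C\<^sup>2 * I\<^sup>2)"
  proof (rule integral_mono_AE)
    show "AE p in square_measure. (norm (d p))\<^sup>2 \<le> 2 * (norm (g p))\<^sup>2 + 2 * C\<^sup>2 * I\<^sup>2"
      using le
    proof eventually_elim
      case (elim p)
      have "(norm (d p))\<^sup>2 \<le> (norm (g p) + C * I)\<^sup>2"
        using elim by (intro power_mono) (simp_all add: I_def)
      also have "\<dots> \<le> 2 * (norm (g p))\<^sup>2 + 2 * (C * I)\<^sup>2"
        using sum_squares_bound[of "norm (g p)" "C * I"] unfolding power2_sum by linarith
      finally show ?case by (simp add: power_mult_distrib)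
    qed
  qed (use i in auto)
  also have "\<dots> = 2 * (LINT p|square_measure. (norm (g p))\<^sup>2) + 2 * C\<^sup>2 * I\<^sup>2"
    using i by simp
  also have "\<dots> \<le> 2 * (LINT p|square_measure. (norm (g p))\<^sup>2) + 2 * C\<^sup>2 * (LINT p|square_measure. (norm (g p))\<^sup>2)"
    unfolding I_def by (intro add_left_mono mult_left_mono square_norm_integral_le g) simp
  finally show ?thesis by (simp add: algebra_simps)
qed

context volterra_data
begin

text \<open>Only linear growth enters: this is Gronwall with constant 4B, whence the exponent 8B.
  The radius obtained depends on \<open>v\<close> alone, so a Lipschitz constant can be chosen
  afterwards.\<close>

lemma volterra_a_priori:
  assumes l: "square_integrable l" and v: "square_integrable v"
    and eq: "AE p in square_measure. l p + volterra l p = v p"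
  shows "primitive (\<lambda>p. norm (l p)) p \<le>
    2 * exp (8 * B) * ((LINT q|square_measure. norm (v q)) + (LINT q|square_measure. \<beta> q))"
proof -
  note i\<beta> = square_integrable_imp_integrable[OF square_integrable_\<beta>]
  have "primitive (\<lambda>p. norm (l p)) p \<le> 2 * exp (2 * (4 * B)) * (LINT q|square_measure. norm (v q) + \<beta> q)"
  proof (rule primitive_gronwall)
    show "AE p in square_measure. norm (l p) \<le> norm (v p) + \<beta> p + 4 * B * primitive (\<lambda>p. norm (l p)) p"
      using eq volterra_growth[OF l]
    proof eventually_elim
      case (elim p)
      have "l p = v p - volterra l p" using elim(1) by (metis add_diff_cancel_right')
      then have "norm (l p) \<le> norm (v p) + norm (volterra l p)" by (simp add: norm_triangle_ineq4)
      then show ?case using elim(2) by linarith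
    qed
    show "AE p in square_measure. 0 \<le> norm (v p) + \<beta> p"
      using \<beta>_nonneg by eventually_elim simp
  qed (use B_pos square_integrable_imp_integrable[OF l] square_integrable_imp_integrable[OF v] i\<beta> in auto)
  then show ?thesis using square_integrable_imp_integrable[OF v] i\<beta> by simp
qed

lemma volterra_stability:
  obtains C where "0 \<le> C" "\<And>l m v w. \<lbrakk>square_integrable l; square_integrable m; square_integrable v; square_integrable w;
     AE p in square_measure. l p + volterra l p = v p; AE p in square_measure. m p + volterra m p = w p;
     \<And>p. primitive (\<lambda>p. norm (l p)) p \<le> R; \<And>p. primitive (\<lambda>p. norm (m p)) p \<le> R\<rbrakk> \<Longrightarrow>
     (\<forall>p. primitive (\<lambda>p. norm (l p - m p)) p \<le> C * (LINT p|square_measure. norm (v p - w p))) \<and>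
     (AE p in square_measure. norm (l p - m p) \<le> norm (v p - w p) + C * (LINT p|square_measure. norm (v p - w p)))"
proof -
  obtain K where K: "0 < K" "\<And>l m. \<lbrakk>square_integrable l; square_integrable m;
     \<And>p. primitive (\<lambda>p. norm (l p)) p \<le> R; \<And>p. primitive (\<lambda>p. norm (m p)) p \<le> R\<rbrakk> \<Longrightarrow>
     AE p in square_measure. norm (volterra l p - volterra m p) \<le> K * primitive (\<lambda>p. norm (l p - m p)) p"
    using volterra_lipschitz by blast
  \<comment> \<open>Large enough for the Gronwall factor and for \<open>K\<close> times that factor,
    which occur in the two conclusions.\<close>
  define C where "C = (1 + K) * (2 * exp (2 * K))"
  show thesis
  proof (rule that)
    show "0 \<le> C" using K by (simp add: C_def)
    fix l m v w :: "real \<times> real \<Rightarrow> real^'n"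
    assume sq: "square_integrable l" "square_integrable m" "square_integrable v" "square_integrable w"
      and eq: "AE p in square_measure. l p + volterra l p = v p" "AE p in square_measure. m p + volterra m p = w p"
      and R: "\<And>p. primitive (\<lambda>p. norm (l p)) p \<le> R" "\<And>p. primitive (\<lambda>p. norm (m p)) p \<le> R"
    define I where "I = (LINT p|square_measure. norm (v p - w p))"
    have I: "0 \<le> I" unfolding I_def by simp
    have d: "AE p in square_measure. norm (l p - m p) \<le> norm (v p - w p) + K * primitive (\<lambda>p. norm (l p - m p)) p"
      using eq K(2)[OF sq(1,2) R]
    proof eventually_elim
      case (elim p)
      have "l p - m p = (v p - w p) - (volterra l p - volterra m p)"
        by (simp add: elim(1,2)[symmetric])
      then have "norm (l p - m p) \<le> norm (v p - w p) + norm (volterra l p - volterra m p)"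
        by (simp only: norm_triangle_ineq4)
      then show ?case using elim(3) by linarith
    qed
    have P: "primitive (\<lambda>p. norm (l p - m p)) p \<le> 2 * exp (2 * K) * I" for p
      unfolding I_def
      by (rule primitive_gronwall[OF K(1) _ _ _ _ d])
        (intro integrable_norm Bochner_Integration.integrable_diff square_integrable_imp_integrable sq AE_I2 norm_ge_zero)+
    have le: "2 * exp (2 * K) * I \<le> C * I" "K * (2 * exp (2 * K) * I) \<le> C * I"
      using K(1) I by (simp_all add: C_def algebra_simps)
    have "AE p in square_measure. norm (l p - m p) \<le> norm (v p - w p) + C * I"
      using d
    proof eventually_elim
      case (elim p)
      have "K * primitive (\<lambda>p. norm (l p - m p)) p \<le> K * (2 * exp (2 * K) * I)"
        using K(1) P by (intro mult_left_mono) auto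
      then show ?case using elim le by linarith
    qed
    then show "(\<forall>p. primitive (\<lambda>p. norm (l p - m p)) p \<le> C * (LINT p|square_measure. norm (v p - w p))) \<and>
       (AE p in square_measure. norm (l p - m p) \<le> norm (v p - w p) + C * (LINT p|square_measure. norm (v p - w p)))"
      using order_trans[OF P le(1)] by (simp add: I_def)
  qed
qed

lemma square_integrable_volterra:
  assumes l: "square_integrable l"
  shows "square_integrable (volterra l)"
proof (rule square_integrable_bound[OF volterra_measurable[OF l]])
  define N where "N = (LINT q|square_measure. norm (l q))"
  show "square_integrable (\<lambda>p. \<beta> p + 4 * B * N)"
    by (intro square_integrable_add square_integrable_\<beta>) simp
  show "AE p in square_measure. norm (volterra l p) \<le> norm (\<beta> p + 4 * B * N)"
    using volterra_growth[OF l]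
  proof eventually_elim
    case (elim p)
    have "primitive (\<lambda>p. norm (l p)) p \<le> N"
      unfolding N_def using square_integrable_imp_integrable[OF l] by (intro primitive_le_integral) auto
    then have "4 * B * primitive (\<lambda>p. norm (l p)) p \<le> 4 * B * N" using B_pos by simp
    then show ?case using elim by simp
  qed
qed

primrec picard :: "(real \<times> real \<Rightarrow> real^'n) \<Rightarrow> nat \<Rightarrow> real \<times> real \<Rightarrow> real^'n" where
  "picard v 0 = (\<lambda>p. 0)"
| "picard v (Suc j) = (\<lambda>p. v p - volterra (picard v j) p)"

declare picard.simps(2) [simp del]

lemma picard_Suc: "picard v (Suc j) p = v p - volterra (picard v j) p"
  by (simp add: picard.simps(2))

lemma square_integrable_picard:
  "square_integrable v \<Longrightarrow> square_integrable (picard v j)"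
  by (induction j) (auto simp: picard.simps(2) intro: square_integrable_diff square_integrable_volterra)

text \<open>The constant 2G is a fixed point of the step c to G + c/2, hence the weighted bound is
  inherited by each iterate. One radius, and with it one Lipschitz constant, serves the whole
  iteration.\<close>

lemma primitive_picard_le:
  assumes v: "square_integrable v"
  shows "primitive (\<lambda>p. norm (picard v j p)) p \<le>
    2 * ((LINT q|square_measure. norm (v q)) + (LINT q|square_measure. \<beta> q)) * exp (8 * B)"
proof -
  define G where "G = (LINT q|square_measure. norm (v q) + \<beta> q)"
  note i\<beta> = square_integrable_imp_integrable[OF square_integrable_\<beta>]
  have g0: "AE p in square_measure. 0 \<le> norm (v p) + \<beta> p"
    using \<beta>_nonneg by eventually_elim simp
  have G0: "0 \<le> G" unfolding G_def by (rule integral_nonneg_AE[OF g0])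
  have *: "primitive (\<lambda>p. norm (picard v j p)) p \<le> (2 * G) * exp (2 * (4 * B) * fst p)" if "p \<in> unit_square" for j p
    using that
  proof (induction j arbitrary: p)
    case 0
    then show ?case using G0 by (simp add: primitive_0)
  next
    case (Suc j)
    have "primitive (\<lambda>p. norm (picard v (Suc j) p)) p \<le> G + (2 * G) / 2 * exp (2 * (4 * B) * fst p)"
      unfolding G_def
    proof (rule primitive_weight_step[OF _ _ _ _ g0 _ Suc.IH[unfolded G_def] Suc.prems])
      show "AE p in square_measure. norm (picard v (Suc j) p) \<le> norm (v p) + \<beta> p + 4 * B * primitive (\<lambda>p. norm (picard v j p)) p"
        using volterra_growth[OF square_integrable_picard[OF v, of j]]
      proof eventually_elim
        case (elim p)
        have "norm (picard v (Suc j) p) \<le> norm (v p) + norm (volterra (picard v j) p)"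
          by (simp add: picard_Suc norm_triangle_ineq4)
        then show ?case using elim by linarith
      qed
      show "integrable square_measure (\<lambda>p. norm (picard v (Suc j) p))" 
        by (rule integrable_norm[OF square_integrable_imp_integrable[OF square_integrable_picard[OF v]]])
      show "integrable square_measure (primitive (\<lambda>p. norm (picard v j p)))"
        by (rule integrable_primitive[OF integrable_norm[OF square_integrable_imp_integrable[OF square_integrable_picard[OF v]]]])
    qed (use B_pos square_integrable_imp_integrable[OF v] i\<beta> G0 in \<open>auto simp: G_def\<close>)
    moreover have "G * 1 \<le> G * exp (2 * (4 * B) * fst p)"
      using G0 B_pos Suc.prems by (intro mult_left_mono) (auto simp: unit_square_def)
    ultimately show ?case by simp
  qed
  have "primitive (\<lambda>p. norm (picard v j p)) p \<le> 2 * G * exp (8 * B)"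
  proof (cases "p \<in> unit_square")
    case True
    then have "2 * G * exp (2 * (4 * B) * fst p) \<le> 2 * G * exp (8 * B)"
      using G0 B_pos by (intro mult_left_mono) (auto simp: unit_square_def)
    then show ?thesis using *[OF True, of j] by linarith
  qed (use G0 in \<open>simp add: primitive_outside\<close>)
  then show ?thesis using square_integrable_imp_integrable[OF v] i\<beta> by (simp add: G_def)
qed

lemma volterra_solution_exists:
  assumes v: "square_integrable v"
  shows "\<exists>l. square_integrable l \<and> (AE p in square_measure. l p + volterra l p = v p)"
proof -
  let ?L = "picard v"
  note sq = square_integrable_picard[OF v]
  define R where "R = 2 * ((LINT q|square_measure. norm (v q)) + (LINT q|square_measure. \<beta> q)) * exp (8 * B)"
  have R: "primitive (\<lambda>p. norm (?L j p)) p \<le> R" for j p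
    unfolding R_def by (rule primitive_picard_le[OF v])
  obtain K where K: "0 < K" "\<And>l m. \<lbrakk>square_integrable l; square_integrable m;
     \<And>p. primitive (\<lambda>p. norm (l p)) p \<le> R; \<And>p. primitive (\<lambda>p. norm (m p)) p \<le> R\<rbrakk> \<Longrightarrow>
     AE p in square_measure. norm (volterra l p - volterra m p) \<le> K * primitive (\<lambda>p. norm (l p - m p)) p"
    using volterra_lipschitz by blast
  let ?d = "\<lambda>j p. norm (?L (Suc j) p - ?L j p)"
  have id: "integrable square_measure (?d j)" for j
    by (intro integrable_norm Bochner_Integration.integrable_diff square_integrable_imp_integrable sq)
  have step: "AE p in square_measure. ?d (Suc j) p \<le> 0 + K * primitive (?d j) p" for j
    using K(2)[OF sq sq R R, of "Suc j" j]
  proof eventually_elim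
    case (elim p)
    have "?L (Suc (Suc j)) p - ?L (Suc j) p = - (volterra (?L (Suc j)) p - volterra (?L j) p)"
      by (simp add: picard_Suc)
    then show ?case using elim by (simp only: norm_minus_cancel add_0)
  qed
  define N where "N = (LINT p|square_measure. ?d 0 p)"
  have N: "0 \<le> N" unfolding N_def by simp
  \<comment> \<open>Without a source term each step halves the constant in front of the
    weight.\<close>
  have *: "primitive (?d j) p \<le> N / 2 ^ j * exp (2 * K * fst p)" if "p \<in> unit_square" for j p
    using that
  proof (induction j arbitrary: p)
    case 0
    have "primitive (?d 0) p \<le> N * 1"
      unfolding N_def using primitive_le_integral[OF id[of 0]] by simp
    also have "\<dots> \<le> N * exp (2 * K * fst p)"
      using N K(1) 0 by (intro mult_left_mono) (auto simp: unit_square_def)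
    finally show ?case by simp
  next
    case (Suc j)
    have "primitive (?d (Suc j)) p \<le> (LINT q|square_measure. 0) + (N / 2 ^ j) / 2 * exp (2 * K * fst p)"
      by (rule primitive_weight_step[OF K(1) id _ _ _ step Suc.IH Suc.prems])
        (use N integrable_primitive[OF id] in auto)
    then show ?case by (simp add: field_simps)
  qed
  define C where "C = K * N * exp (2 * K)"
  \<comment> \<open>The count starts at the increment from the first to the second iterate. The very
    first increment is merely square integrable; each later one is bounded pointwise through the
    primitive of its predecessor.\<close>
  have inc: "AE p in square_measure. \<forall>j. norm (?L (Suc (Suc j)) p - ?L (Suc j) p) \<le> C / 2 ^ j"
    unfolding AE_all_countable
  proof
    fix j
    show "AE p in square_measure. norm (?L (Suc (Suc j)) p - ?L (Suc j) p) \<le> C / 2 ^ j"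
      using step[of j] AE_space
    proof eventually_elim
      case (elim p)
      have "K * primitive (?d j) p \<le> K * (N / 2 ^ j * exp (2 * K * fst p))"
        using K(1) *[of p j] elim(2) by (intro mult_left_mono) auto
      also have "\<dots> \<le> K * (N / 2 ^ j * exp (2 * K))"
        using K(1) N elim(2) by (intro mult_left_mono) (auto simp: unit_square_def)
      finally show ?case using elim(1) by (simp add: C_def)
    qed
  qed
  define l where "l = (\<lambda>p. lim (\<lambda>j. ?L (Suc j) p))"
  have lim: "AE p in square_measure. (\<lambda>j. ?L (Suc j) p) \<longlonglongrightarrow> l p"
    using inc
  proof eventually_elim
    case (elim p)
    then show ?case
      unfolding l_def using geometric_increments_limit(1)[of "\<lambda>j. ?L (Suc j) p" C] by (simp only: convergent_LIMSEQ_iff)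
  qed
  have err: "AE p in square_measure. norm (l p - ?L (Suc j) p) \<le> 2 * C / 2 ^ j" for j
    using inc
  proof eventually_elim
    case (elim p)
    then show ?case
      unfolding l_def using geometric_increments_limit(2)[of "\<lambda>j. ?L (Suc j) p" C j] by blast
  qed
  have lm: "l \<in> borel_measurable square_measure"
    by (rule measurable_square_LIMSEQ[OF _ lim]) (use sq in \<open>simp only: square_integrable_def\<close>)
  have l: "square_integrable l"
  \<comment> \<open>The limit stays within a constant of the first iterate, which is square
    integrable.\<close>
  proof (rule square_integrable_bound[OF lm])
    show "square_integrable (\<lambda>p. norm (?L 1 p) + 2 * C)"
      by (intro square_integrable_add square_integrable_norm sq) simp
    show "AE p in square_measure. norm (l p) \<le> norm (norm (?L 1 p) + 2 * C)"
      using err[of 0]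
    proof eventually_elim
      case (elim p)
      then show ?case using norm_triangle_sub[of "l p" "?L 1 p"] by simp
    qed
  qed
  have Perr: "primitive (\<lambda>p. norm (l p - ?L (Suc j) p)) p \<le> 2 * C / 2 ^ j" for j p
  proof -
    have i: "integrable square_measure (\<lambda>p. norm (l p - ?L (Suc j) p))"
      by (intro integrable_norm Bochner_Integration.integrable_diff square_integrable_imp_integrable sq l)
    have "primitive (\<lambda>p. norm (l p - ?L (Suc j) p)) p \<le> (LINT p|square_measure. norm (l p - ?L (Suc j) p))"
      by (rule primitive_le_integral[OF i]) simp
    also have "\<dots> \<le> (LINT p|square_measure. 2 * C / 2 ^ j)"
      by (rule integral_mono_AE[OF i _ err]) simp
    finally show ?thesis by simp
  qed
  have lim0: "(\<lambda>j. 2 * C / 2 ^ j) \<longlonglongrightarrow> 0"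
    by (rule LIMSEQ_divide_realpow_zero) simp
  \<comment> \<open>The radius must pass to the limit before the Lipschitz estimate may compare
    \<open>l\<close> with the iterates.\<close>
  have Rl: "primitive (\<lambda>p. norm (l p)) p \<le> R" for p
  proof -
    have "primitive (\<lambda>p. norm (l p)) p \<le> 2 * C / 2 ^ j + R" for j
    proof -
      have triangle: "norm (l p) \<le> norm (l p - ?L (Suc j) p) + norm (?L (Suc j) p)" for p
        using norm_triangle_ineq[of "l p - ?L (Suc j) p" "?L (Suc j) p"] by simp
      have "primitive (\<lambda>p. norm (l p)) p \<le> primitive (\<lambda>p. norm (l p - ?L (Suc j) p) + norm (?L (Suc j) p)) p"
        by (intro primitive_mono_AE AE_I2 Bochner_Integration.integrable_add integrable_norm
            Bochner_Integration.integrable_diff square_integrable_imp_integrable sq l triangle)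
      also have "\<dots> = primitive (\<lambda>p. norm (l p - ?L (Suc j) p)) p + primitive (\<lambda>p. norm (?L (Suc j) p)) p"
        by (intro primitive_add_integrable integrable_norm Bochner_Integration.integrable_diff square_integrable_imp_integrable sq l)
      also have "\<dots> \<le> 2 * C / 2 ^ j + R"
        by (intro add_mono Perr R)
      finally show ?thesis .
    qed
    moreover have "(\<lambda>j. 2 * C / 2 ^ j + R) \<longlonglongrightarrow> 0 + R"
      by (intro tendsto_intros lim0)
    ultimately show ?thesis
      using LIMSEQ_le_const[of "\<lambda>j. 2 * C / 2 ^ j + R" "0 + R"] by auto
  qed
  have "AE p in square_measure. \<forall>j. norm (volterra l p - volterra (?L (Suc j)) p) \<le> K * primitive (\<lambda>p. norm (l p - ?L (Suc j) p)) p"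
    unfolding AE_all_countable by (rule allI) (rule K(2)[OF l sq Rl R])
  then have "AE p in square_measure. l p + volterra l p = v p"
    using lim
  proof eventually_elim
    case (elim p)
    have bound: "norm (volterra l p - volterra (?L (Suc j)) p) \<le> K * (2 * C / 2 ^ j)" for j
    proof -
      have "norm (volterra l p - volterra (?L (Suc j)) p) \<le> K * primitive (\<lambda>p. norm (l p - ?L (Suc j) p)) p"
        using elim(1) by (rule spec)
      also have "\<dots> \<le> K * (2 * C / 2 ^ j)"
        by (rule mult_left_mono[OF Perr less_imp_le[OF K(1)]])
      finally show ?thesis .
    qed
    have "(\<lambda>j. volterra l p - volterra (?L (Suc j)) p) \<longlonglongrightarrow> 0"
      by (rule Lim_null_comparison[OF always_eventually[OF allI[OF bound]] tendsto_mult_right_zero[OF lim0]])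
    from tendsto_diff[OF tendsto_const this, of "volterra l p"]
    have "(\<lambda>j. volterra (?L (Suc j)) p) \<longlonglongrightarrow> volterra l p"
      by simp
    from tendsto_diff[OF tendsto_const this, of "v p"]
    have "(\<lambda>j. ?L (Suc (Suc j)) p) \<longlonglongrightarrow> v p - volterra l p"
      by (simp only: picard_Suc[of v "Suc j" for j])
    moreover have "(\<lambda>j. ?L (Suc (Suc j)) p) \<longlonglongrightarrow> l p"
      using elim(2) by (rule LIMSEQ_Suc)
    ultimately have "l p = v p - volterra l p" by (rule LIMSEQ_unique[rotated])
    then show ?case by (simp add: eq_diff_eq)
  qed
  with l show ?thesis by blast
qed

end

section \<open>The solution operator\<close>

lemma abs_rep_L2: "abs_L2 (rep_L2 v) = v"
  by (rule Quotient3_abs_rep[OF Quotient3_L2])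

lemma L2_eq_rep_L2: "L2_eq (rep_L2 v) (rep_L2 v)"
  by (rule Quotient3_rep_reflp[OF Quotient3_L2])

lemma square_integrable_rep_L2: "square_integrable (rep_L2 v)"
  using L2_eq_rep_L2[of v] by (simp add: L2_eq_def)

lemma AE_rep_abs_L2:
  assumes "square_integrable f"
  shows "AE p in square_measure. rep_L2 (abs_L2 f) p = f p"
proof -
  have "L2_eq f f" using assms by (simp add: L2_eq_def)
  then have "L2_eq (rep_L2 (abs_L2 f)) f"
    by (rule Quotient3_rep_abs[OF Quotient3_L2])
  then show ?thesis by (simp add: L2_eq_def)
qed

lemma norm_L2_power2: "(norm v)\<^sup>2 = (LINT p|square_measure. (norm (rep_L2 v p))\<^sup>2)"
  by (simp add: norm_L2_def inner_L2.rep_eq power2_norm_eq_inner integral_nonneg_AE)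

lemma AE_rep_L2_add: "AE p in square_measure. rep_L2 (v + w) p = rep_L2 v p + rep_L2 w p"
proof -
  have "v + w = abs_L2 (\<lambda>p. rep_L2 v p + rep_L2 w p)"
    using plus_L2.abs_eq[OF L2_eq_rep_L2[of v] L2_eq_rep_L2[of w]] by (simp only: abs_rep_L2)
  then show ?thesis
    by (simp only: AE_rep_abs_L2 square_integrable_add square_integrable_rep_L2)
qed

lemma AE_rep_L2_scaleR: "AE p in square_measure. rep_L2 (c *\<^sub>R v) p = c *\<^sub>R rep_L2 v p"
proof -
  have "c *\<^sub>R v = abs_L2 (\<lambda>p. c *\<^sub>R rep_L2 v p)"
    using scaleR_L2.abs_eq[OF L2_eq_rep_L2[of v], of c] by (simp only: abs_rep_L2)
  then show ?thesis
    by (simp only: AE_rep_abs_L2 square_integrable_scaleR square_integrable_rep_L2)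
qed

lemma AE_rep_L2_lincomb:
  "AE p in square_measure. rep_L2 (a *\<^sub>R v + c *\<^sub>R w) p = a *\<^sub>R rep_L2 v p + c *\<^sub>R rep_L2 w p"
  using AE_rep_L2_add[of "a *\<^sub>R v" "c *\<^sub>R w"] AE_rep_L2_scaleR[of a v] AE_rep_L2_scaleR[of c w]
  by eventually_elim simp

lemma integral_norm_rep_L2_le: "(LINT p|square_measure. norm (rep_L2 v p)) \<le> norm v"
proof (rule power2_le_imp_le)
  show "(LINT p|square_measure. norm (rep_L2 v p))\<^sup>2 \<le> (norm v)\<^sup>2"
    unfolding norm_L2_power2 by (rule square_norm_integral_le[OF square_integrable_rep_L2])
qed simp

text \<open>Used with exponent 1 for L1 bounds and with exponent 2 for squared norms.\<close>

lemma integral_norm_power_cong_AE: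
  fixes f g :: "'b \<Rightarrow> 'a::euclidean_space"
  assumes [measurable]: "f \<in> borel_measurable M" "g \<in> borel_measurable M" and eq: "AE p in M. f p = g p"
  shows "(LINT p|M. norm (f p) ^ k) = (LINT p|M. norm (g p) ^ k)"
proof (rule integral_cong_AE)
  show "AE p in M. norm (f p) ^ k = norm (g p) ^ k"
    using eq by eventually_elim simp
qed measurable

lemma norm_AC02_power2: "(norm z)\<^sup>2 = (LINT p|square_measure. (norm (pdxy (Rep_AC02 z) p))\<^sup>2)"
  by (simp add: norm_AC02_def inner_AC02_def power2_norm_eq_inner integral_nonneg_AE)

lemma AE_pdxy_lincomb:
  "AE p in square_measure. pdxy (Rep_AC02 (a *\<^sub>R z + c *\<^sub>R w)) p
    = a *\<^sub>R pdxy (Rep_AC02 z) p + c *\<^sub>R pdxy (Rep_AC02 w) p"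
  using AE_pdxy_add[of "a *\<^sub>R z" "c *\<^sub>R w"] AE_pdxy_scaleR[of a z] AE_pdxy_scaleR[of c w]
  by eventually_elim simp

lemma Rep_AC02_eq_primitiveI:
  assumes "square_integrable l" "AE p in square_measure. l p = pdxy (Rep_AC02 z) p"
  shows "Rep_AC02 z = primitive l"
proof
  fix p
  have "primitive l p = primitive (pdxy (Rep_AC02 z)) p"
    by (rule primitive_cong_AE) (use assms in \<open>auto simp: square_integrable_def\<close>)
  then show "Rep_AC02 z p = primitive l p" by (simp add: AC02_square_integrable_pdxy(2))
qed

section \<open>Well-posedness and local Lipschitz dependence\<close>

context volterra_data
begin

abbreviation solution :: "(real^'n) L2 \<Rightarrow> (real^'n) AC02" where
  "solution \<equiv> solution_operator f1 f2 A1 A2"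

abbreviation density :: "(real^'n) AC02 \<Rightarrow> real \<times> real \<Rightarrow> real^'n" where
  "density z \<equiv> pdxy (Rep_AC02 z)"

lemma solves_Rep_iff:
  "solves f1 f2 A1 A2 v (Rep_AC02 z) \<longleftrightarrow> (AE p in square_measure. density z p + volterra (density z) p = v p)"
  using solves_primitive_iff[OF AC02_square_integrable_pdxy(1)[of z], of v]
  by (simp add: AC02_square_integrable_pdxy(2))

text \<open>Both solutions obey the a priori bound determined by \<open>v\<close>, so the stability
  estimate applies on that ball, and its right-hand side vanishes.\<close>

lemma volterra_unique:
  assumes sq: "square_integrable l" "square_integrable m" "square_integrable v"
    and eq: "AE p in square_measure. l p + volterra l p = v p" "AE p in square_measure. m p + volterra m p = v p"
  shows "AE p in square_measure. l p = m p"
proof (rule volterra_stability[of "2 * exp (8 * B) * ((LINT q|square_measure. norm (v q)) + (LINT q|square_measure. \<beta> q))"],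
    goal_cases)
  case (1 C)
  note st = 1(2)[OF sq(1,2,3,3) eq volterra_a_priori[OF sq(1,3) eq(1)] volterra_a_priori[OF sq(2,3) eq(2)]]
  from st[THEN conjunct2] show ?case by eventually_elim simp
qed

lemma solves_ex1:
  assumes v: "square_integrable v"
  shows "\<exists>!z. solves f1 f2 A1 A2 v (Rep_AC02 z)"
proof -
  obtain l where l: "square_integrable l" "AE p in square_measure. l p + volterra l p = v p"
    using volterra_solution_exists[OF v] by blast
  then have "Rep_AC02 (Abs_AC02 (primitive l)) = primitive l"
    by (intro Abs_AC02_inverse) blast
  then have ex: "solves f1 f2 A1 A2 v (Rep_AC02 (Abs_AC02 (primitive l)))"
    using l by (simp add: solves_primitive_iff)
  show ?thesis
  proof (rule ex1I[where a = "Abs_AC02 (primitive l)"])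
    show "solves f1 f2 A1 A2 v (Rep_AC02 (Abs_AC02 (primitive l)))" by (rule ex)
  next
    fix z assume "solves f1 f2 A1 A2 v (Rep_AC02 z)"
    then have "AE p in square_measure. l p = density z p"
      unfolding solves_Rep_iff by (rule volterra_unique[OF l(1) AC02_square_integrable_pdxy(1) v l(2)])
    then have "Rep_AC02 z = primitive l"
      by (rule Rep_AC02_eq_primitiveI[OF l(1)])
    then show "z = Abs_AC02 (primitive l)"
      using Rep_AC02_inverse[of z] by simp
  qed
qed

lemma solution_eq: "AE p in square_measure. density (solution v) p + volterra (density (solution v)) p = rep_L2 v p"
  unfolding solves_Rep_iff[symmetric] solution_operator_def
  by (rule theI'[OF solves_ex1[OF square_integrable_rep_L2]])

lemma solution_unique:
  assumes "AE p in square_measure. density z p + volterra (density z) p = rep_L2 v p"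
  shows "solution v = z"
  unfolding solution_operator_def
  by (rule the1_equality[OF solves_ex1[OF square_integrable_rep_L2]]) (simp add: solves_Rep_iff assms)

lemma primitive_solution_le:
  "primitive (\<lambda>p. norm (density (solution v) p)) p \<le> 2 * exp (8 * B) * (norm v + (LINT q|square_measure. \<beta> q))"
proof -
  have "primitive (\<lambda>p. norm (density (solution v) p)) p
      \<le> 2 * exp (8 * B) * ((LINT q|square_measure. norm (rep_L2 v q)) + (LINT q|square_measure. \<beta> q))"
    by (rule volterra_a_priori[OF AC02_square_integrable_pdxy(1) square_integrable_rep_L2 solution_eq])
  also have "\<dots> \<le> 2 * exp (8 * B) * (norm v + (LINT q|square_measure. \<beta> q))"
    using integral_norm_rep_L2_le by simp
  finally show ?thesis .
qed

lemma AE_density_diff: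
  "AE p in square_measure. density (z - w) p = density z p - density w p"
  using AE_pdxy_lincomb[of 1 z "-1" w] by simp

text \<open>The first estimate controls the increment of z uniformly on the square and is what the
  differentiability proof needs; the second, in norm, gives boundedness of the linearized
  operator.\<close>

lemma solution_lipschitz:
  obtains C where "0 \<le> C" "\<And>v w p. norm v \<le> N \<Longrightarrow> norm w \<le> N \<Longrightarrow>
      primitive (\<lambda>p. norm (density (solution v) p - density (solution w) p)) p \<le> C * norm (v - w)"
    "\<And>v w. norm v \<le> N \<Longrightarrow> norm w \<le> N \<Longrightarrow> norm (solution v - solution w) \<le> C * norm (v - w)"
proof -
  define R where "R = 2 * exp (8 * B) * (N + (LINT q|square_measure. \<beta> q))"
  have R: "primitive (\<lambda>p. norm (density (solution v) p)) p \<le> R" if "norm v \<le> N" for v p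
  proof -
    have "2 * exp (8 * B) * (norm v + (LINT q|square_measure. \<beta> q)) \<le> R"
      unfolding R_def using that by simp
    then show ?thesis using primitive_solution_le[of v p] by linarith
  qed
  obtain C where C: "0 \<le> C" "\<And>l m v w. \<lbrakk>square_integrable l; square_integrable m; square_integrable v; square_integrable w;
     AE p in square_measure. l p + volterra l p = v p; AE p in square_measure. m p + volterra m p = w p;
     \<And>p. primitive (\<lambda>p. norm (l p)) p \<le> R; \<And>p. primitive (\<lambda>p. norm (m p)) p \<le> R\<rbrakk> \<Longrightarrow>
     (\<forall>p. primitive (\<lambda>p. norm (l p - m p)) p \<le> C * (LINT p|square_measure. norm (v p - w p))) \<and>
     (AE p in square_measure. norm (l p - m p) \<le> norm (v p - w p) + C * (LINT p|square_measure. norm (v p - w p)))"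
    using volterra_stability by blast
  \<comment> \<open>The square root is the L2 factor from
    \<open>square_norm_integral_bound\<close>.\<close>
  define C' where "C' = max C (sqrt (2 + 2 * C\<^sup>2))"
  show thesis
  proof (rule that)
    show "0 \<le> C'" using C(1) by (simp add: C'_def)
    fix v w :: "(real^'n) L2" assume vw: "norm v \<le> N" "norm w \<le> N"
    let ?d = "\<lambda>p. density (solution v) p - density (solution w) p"
    let ?g = "\<lambda>p. rep_L2 v p - rep_L2 w p"
    note st = C(2)[OF AC02_square_integrable_pdxy(1) AC02_square_integrable_pdxy(1) square_integrable_rep_L2
        square_integrable_rep_L2 solution_eq solution_eq R[OF vw(1)] R[OF vw(2)]]
    have sq: "square_integrable ?d" "square_integrable ?g"
      by (intro square_integrable_diff AC02_square_integrable_pdxy(1) square_integrable_rep_L2)+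
    have gd: "AE p in square_measure. rep_L2 (v - w) p = ?g p"
      using AE_rep_L2_lincomb[of 1 v "-1" w] by simp
    have m: "?g \<in> borel_measurable square_measure" "rep_L2 (v - w) \<in> borel_measurable square_measure"
        "?d \<in> borel_measurable square_measure" "density (solution v - solution w) \<in> borel_measurable square_measure"
      using sq square_integrable_rep_L2[of "v - w"] AC02_square_integrable_pdxy(1)[of "solution v - solution w"]
      by (simp_all only: square_integrable_def)
    have g1: "(LINT p|square_measure. norm (?g p)) \<le> norm (v - w)"
    proof -
      have "(LINT p|square_measure. norm (?g p)) = (LINT p|square_measure. norm (rep_L2 (v - w) p))"
        using integral_norm_power_cong_AE[OF m(2,1) gd, of 1] by simp
      then show ?thesis using integral_norm_rep_L2_le[of "v - w"] by simp
    qed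
    have g2: "(LINT p|square_measure. (norm (?g p))\<^sup>2) = (norm (v - w))\<^sup>2"
      unfolding norm_L2_power2
      by (rule integral_norm_power_cong_AE[OF m(2,1) gd, symmetric])
    have d2: "(norm (solution v - solution w))\<^sup>2 = (LINT p|square_measure. (norm (?d p))\<^sup>2)"
      unfolding norm_AC02_power2
      by (rule integral_norm_power_cong_AE[OF m(4,3) AE_density_diff])
    show "primitive (\<lambda>p. norm (?d p)) p \<le> C' * norm (v - w)" for p
    proof -
      have "primitive (\<lambda>p. norm (?d p)) p \<le> C * (LINT p|square_measure. norm (?g p))"
        using st by blast
      also have "\<dots> \<le> C' * norm (v - w)"
        using g1 C(1) by (intro mult_mono) (auto simp: C'_def)
      finally show ?thesis .
    qed
    have sq_le: "(norm (solution v - solution w))\<^sup>2 \<le> (2 + 2 * C\<^sup>2) * (norm (v - w))\<^sup>2"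
      unfolding d2 g2[symmetric] by (rule square_norm_integral_bound[OF sq C(1)]) (use st in blast)
    have "norm (solution v - solution w) \<le> sqrt (2 + 2 * C\<^sup>2) * norm (v - w)"
      by (rule power2_le_imp_le) (use sq_le in \<open>simp_all add: power_mult_distrib\<close>)
    also have "\<dots> \<le> C' * norm (v - w)"
      by (intro mult_right_mono) (simp_all add: C'_def)
    finally show "norm (solution v - solution w) \<le> C' * norm (v - w)" .
  qed
qed

section \<open>Linear equations\<close>

text \<open>\<open>volterra\<close> sees the density only through its primitive, which does not
  change on modification in a null set.\<close>

lemma volterra_cong_AE:
  assumes l: "square_integrable l" and eq: "AE p in square_measure. l p = m p"
  shows "AE p in square_measure. volterra l p = volterra m p"
proof -
  have "primitive l = primitive m"
    by (intro ext primitive_cong_AE) (use l eq in \<open>auto simp: square_integrable_def\<close>)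
  then have "integrand l q = integrand m q" for q by (simp only: integrand_def)
  then have "integrand l = integrand m" by (rule ext)
  then have "volterra l p = volterra m p" for p
    using \<open>primitive l = primitive m\<close> by (simp only: volterra_def)
  then show ?thesis by simp
qed

lemma volterra_lincomb:
  assumes lin: "AE p in square_measure. linear (f1 p) \<and> linear (f2 p)"
    and l: "square_integrable l" and m: "square_integrable m"
  shows "AE p in square_measure. volterra (\<lambda>p. a *\<^sub>R l p + c *\<^sub>R m p) p = a *\<^sub>R volterra l p + c *\<^sub>R volterra m p"
proof -
  have "AE p in square_measure. integrand (\<lambda>p. a *\<^sub>R l p + c *\<^sub>R m p) p = a *\<^sub>R integrand l p + c *\<^sub>R integrand m p"
    using lin AE_pdx_primitive_lincomb[OF l m, of a c] AE_pdy_primitive_lincomb[OF l m, of a c]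
  proof eventually_elim
    case (elim p)
    note lin2 = linear_add[of "f2 p"] linear_scale[of "f2 p"]
    show ?case
      using elim by (simp add: integrand_def primitive_lincomb l m lin2 matrix_vector_right_distrib
        matrix_vector_mult_scaleR scaleR_add_right)
  qed
  then have eq1: "primitive (integrand (\<lambda>p. a *\<^sub>R l p + c *\<^sub>R m p)) = primitive (\<lambda>p. a *\<^sub>R integrand l p + c *\<^sub>R integrand m p)"
    by (intro ext primitive_cong_AE integrand_measurable square_integrable_lincomb l m)
  have eq: "primitive (integrand (\<lambda>p. a *\<^sub>R l p + c *\<^sub>R m p)) p
      = a *\<^sub>R primitive (integrand l) p + c *\<^sub>R primitive (integrand m) p" for p
    unfolding eq1
    using integrable_integrand[OF l] integrable_integrand[OF m] by (simp add: primitive_add_integrable primitive_scaleR)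
  show ?thesis
    using lin
  proof eventually_elim
    case (elim p)
    note lin1 = linear_add[of "f1 p"] linear_scale[of "f1 p"]
    show ?case
      using elim by (simp add: volterra_def eq primitive_lincomb l m lin1 scaleR_add_right)
  qed
qed

text \<open>Linearity follows from uniqueness. The Lipschitz constant is available on bounded sets
  only, so it is used on the unit ball, at \<open>sgn v\<close>, and homogeneity restores the factor
  \<open>norm v\<close>.\<close>

lemma bounded_linear_solution:
  assumes lin: "AE p in square_measure. linear (f1 p) \<and> linear (f2 p)"
  shows "bounded_linear solution"
proof -
  have comb: "solution (a *\<^sub>R v + c *\<^sub>R w) = a *\<^sub>R solution v + c *\<^sub>R solution w" for a c v w
  proof (rule solution_unique)
    let ?z = "a *\<^sub>R solution v + c *\<^sub>R solution w"
    note sq = AC02_square_integrable_pdxy(1)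
    show "AE p in square_measure. density ?z p + volterra (density ?z) p = rep_L2 (a *\<^sub>R v + c *\<^sub>R w) p"
      using volterra_cong_AE[OF sq AE_pdxy_lincomb[of a "solution v" c "solution w"]]
        AE_pdxy_lincomb[of a "solution v" c "solution w"]
        volterra_lincomb[OF lin sq[of "solution v"] sq[of "solution w"], of a c]
        solution_eq[of v] solution_eq[of w] AE_rep_L2_lincomb[of a v c w]
    proof eventually_elim
      case (elim p)
      show ?case
        by (simp only: elim(1-3,6) elim(4,5)[symmetric] scaleR_add_right add_ac)
    qed
  qed
  have add: "solution (v + w) = solution v + solution w" for v w
    using comb[of 1 v 1 w] by simp
  have scale: "solution (c *\<^sub>R v) = c *\<^sub>R solution v" for c v
    using comb[of c v 0 v] by simp
  obtain C where C: "0 \<le> C" "\<And>v w p. norm v \<le> 1 \<Longrightarrow> norm w \<le> 1 \<Longrightarrow>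
      primitive (\<lambda>p. norm (density (solution v) p - density (solution w) p)) p \<le> C * norm (v - w)"
    "\<And>v w. norm v \<le> 1 \<Longrightarrow> norm w \<le> 1 \<Longrightarrow> norm (solution v - solution w) \<le> C * norm (v - w)"
    by (rule solution_lipschitz[of 1], rule that)
  show ?thesis
  proof (rule bounded_linear_intro[OF add scale])
    fix v
    have "solution 0 = 0" using scale[of 0 0] by simp
    then have "norm (solution (sgn v)) \<le> C * norm (sgn v)"
      using C(3)[of "sgn v" 0] by (simp add: norm_sgn)
    also have "\<dots> \<le> C * 1"
      using C(1) by (intro mult_left_mono) (simp_all add: norm_sgn)
    finally have "norm v * norm (solution (sgn v)) \<le> norm v * C"
      by (intro mult_left_mono) simp_all
    moreover have "solution v = norm v *\<^sub>R solution (sgn v)"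
      using scale[of "norm v" "sgn v"] by (cases "v = 0") (simp_all add: sgn_div_norm)
    ultimately show "norm (solution v) \<le> norm v * C"
      by simp
  qed
qed

end

section \<open>Frechet differentiability\<close>

text \<open>The remainder is divided by a scale \<open>r i\<close> that only dominates the
  increment: at a given point the increment of z may vanish or be much smaller than the perturbation
  of the right-hand side.\<close>

lemma has_derivative_remainder_tendsto:
  fixes f :: "'a::real_normed_vector \<Rightarrow> 'b::real_normed_vector"
  assumes f: "(f has_derivative f') (at x)" and r: "\<And>i. 0 < r i" "r \<longlonglongrightarrow> 0"
    and w: "\<And>i. norm (w i) \<le> C * r i"
  shows "(\<lambda>i. norm (f (x + w i) - f x - f' (w i)) / r i) \<longlonglongrightarrow> 0"
proof (rule LIMSEQ_I)
  fix e :: real assume e: "0 < e"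
  define K where "K = \<bar>C\<bar> + 1"
  have K: "0 < K" "\<And>i. norm (w i) \<le> K * r i"
  proof -
    show "0 < K" by (simp add: K_def)
    fix i
    have "C * r i \<le> K * r i" using r(1)[of i] by (intro mult_right_mono) (auto simp: K_def)
    then show "norm (w i) \<le> K * r i" using w[of i] by linarith
  qed
  have "0 < e / (2 * K)" using e K by simp
  then obtain d where d: "0 < d" "\<And>y. norm (y - x) < d \<Longrightarrow> norm (f y - f x - f' (y - x)) \<le> e / (2 * K) * norm (y - x)"
    using f unfolding has_derivative_at_alt by blast
  have "0 < d / K" using d K by simp
  then obtain n where n: "\<And>i. n \<le> i \<Longrightarrow> r i < d / K"
    using order_tendstoD(2)[OF r(2)] by (auto simp: eventually_sequentially)
  show "\<exists>n. \<forall>i\<ge>n. norm (norm (f (x + w i) - f x - f' (w i)) / r i - 0) < e"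
  proof (intro exI allI impI)
    fix i assume "n \<le> i"
    then have "K * r i < d" using n[of i] K(1) by (simp add: field_simps)
    then have "norm (f (x + w i) - f x - f' (w i)) \<le> e / (2 * K) * norm (w i)"
      using d(2)[of "x + w i"] K(2)[of i] by simp
    also have "\<dots> \<le> e / (2 * K) * (K * r i)"
      using e K by (intro mult_left_mono) auto
    also have "\<dots> = e / 2 * r i" using K(1) by simp
    finally have "norm (f (x + w i) - f x - f' (w i)) / r i \<le> e / 2"
      using r(1)[of i] by (simp add: divide_le_eq)
    then have "norm (f (x + w i) - f x - f' (w i)) / r i < e"
      using e by linarith
    then show "norm (norm (f (x + w i) - f x - f' (w i)) / r i - 0) < e"
      using r(1)[of i] by simp
  qed
qed

text \<open>A limit of difference quotients with steps 1/(i+1), each measurable by superposition. It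
  makes the coefficients of the linearized equation measurable.\<close>

lemma measurable_directional_derivative:
  fixes f D :: "real \<times> real \<Rightarrow> 'a::euclidean_space \<Rightarrow> 'b::euclidean_space"
  assumes f: "\<And>z. (\<lambda>p. f p z) \<in> borel_measurable square_measure"
    and cont: "AE p in square_measure. continuous_on UNIV (f p)"
    and h: "h \<in> borel_measurable square_measure"
    and D: "AE p in square_measure. (f p has_derivative D p) (at (h p))"
  shows "(\<lambda>p. D p z) \<in> borel_measurable square_measure"
proof (rule measurable_square_LIMSEQ)
  let ?r = "\<lambda>i. 1 / real (Suc i)"
  fix i
  have [measurable]: "(\<lambda>p. f p (h p + ?r i *\<^sub>R z)) \<in> borel_measurable square_measure"
      "(\<lambda>p. f p (h p)) \<in> borel_measurable square_measure"
    using h by (intro measurable_superposition[OF f cont]; measurable)+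
  show "(\<lambda>p. real (Suc i) *\<^sub>R (f p (h p + ?r i *\<^sub>R z) - f p (h p))) \<in> borel_measurable square_measure"
    by measurable
next
  let ?r = "\<lambda>i. 1 / real (Suc i)"
  show "AE p in square_measure. (\<lambda>i. real (Suc i) *\<^sub>R (f p (h p + ?r i *\<^sub>R z) - f p (h p))) \<longlonglongrightarrow> D p z"
    using D
  proof eventually_elim
    case (elim p)
    have "(\<lambda>i. norm (f p (h p + ?r i *\<^sub>R z) - f p (h p) - D p (?r i *\<^sub>R z)) / ?r i) \<longlonglongrightarrow> 0"
    proof (rule has_derivative_remainder_tendsto[OF elim])
      show "?r \<longlonglongrightarrow> 0" using LIMSEQ_inverse_real_of_nat by (simp add: inverse_eq_divide)
      show "norm (?r i *\<^sub>R z) \<le> norm z * ?r i" for i by simp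
    qed simp
    moreover have "norm (f p (h p + ?r i *\<^sub>R z) - f p (h p) - D p (?r i *\<^sub>R z)) / ?r i
        = norm (real (Suc i) *\<^sub>R (f p (h p + ?r i *\<^sub>R z) - f p (h p)) - D p z)" for i
    proof -
      have "D p (?r i *\<^sub>R z) = ?r i *\<^sub>R D p z"
        by (rule linear_scale[OF has_derivative_linear[OF elim]])
      then have "real (Suc i) *\<^sub>R (f p (h p + ?r i *\<^sub>R z) - f p (h p)) - D p z
          = real (Suc i) *\<^sub>R (f p (h p + ?r i *\<^sub>R z) - f p (h p) - D p (?r i *\<^sub>R z))"
        by (simp add: scaleR_diff_right)
      then show ?thesis by (simp only: norm_scaleR) simp
    qed
    ultimately show ?case
      by (simp only: LIM_zero_iff tendsto_norm_zero_iff)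
  qed
qed

text \<open>Dominated convergence for the scaled squares, with the constant majorant
  \<open>K\<^sup>2\<close> on a set of finite measure.\<close>

lemma scaled_square_integral_tendsto:
  fixes e :: "nat \<Rightarrow> real \<times> real \<Rightarrow> 'a::euclidean_space"
  assumes [measurable]: "\<And>i. e i \<in> borel_measurable square_measure" and r: "\<And>i. 0 < r i"
    and lim: "AE p in square_measure. (\<lambda>i. norm (e i p) / r i) \<longlonglongrightarrow> 0"
    and bound: "\<And>i. AE p in square_measure. norm (e i p) \<le> K * r i"
  shows "(\<lambda>i. (LINT p|square_measure. (norm (e i p))\<^sup>2) / (r i)\<^sup>2) \<longlonglongrightarrow> 0"
proof -
  have "(\<lambda>i. LINT p|square_measure. (norm (e i p) / r i)\<^sup>2) \<longlonglongrightarrow> (LINT p|square_measure. (0 :: real))"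
  proof (rule integral_dominated_convergence[where w = "\<lambda>p. K\<^sup>2"])
    show "AE p in square_measure. (\<lambda>i. (norm (e i p) / r i)\<^sup>2) \<longlonglongrightarrow> 0"
      using lim
    proof eventually_elim
      case (elim p)
      then show ?case using tendsto_power[OF elim, of 2] by simp
    qed
    show "AE p in square_measure. norm ((norm (e i p) / r i)\<^sup>2) \<le> K\<^sup>2" for i
      using bound[of i]
    proof eventually_elim
      case (elim p)
      then have "norm (e i p) / r i \<le> K" using r[of i] by (simp add: divide_le_eq)
      then have "(norm (e i p) / r i)\<^sup>2 \<le> K\<^sup>2" using r[of i] by (intro power_mono) simp_all
      then show ?case by simp
    qed
  qed simp_all
  then show ?thesis by (simp add: power_divide)
qed

text \<open>The increment \<open>w\<close> of the density solves the linearized equation up to the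
  linearization error \<open>q\<close>, while the candidate \<open>h\<close> solves it exactly.
  Linear stability therefore reduces the claim to showing that \<open>q\<close> is small in L2
  compared with the perturbation.\<close>

lemma solution_operator_has_derivative:
  fixes f1 f2 g1 g2 :: "real \<times> real \<Rightarrow> real^'n \<Rightarrow> real^'n"
  assumes f: "volterra_data f1 f2 A1 A2 B b" and g: "volterra_data g1 g2 A1 A2 B' (\<lambda>p. 0)"
    and lin: "AE p in square_measure. linear (g1 p) \<and> linear (g2 p)"
    and der: "AE p in square_measure.
      (f1 p has_derivative g1 p) (at (Rep_AC02 (solution_operator f1 f2 A1 A2 v) p)) \<and>
      (f2 p has_derivative g2 p) (at (Rep_AC02 (solution_operator f1 f2 A1 A2 v) p))"
  shows "(solution_operator f1 f2 A1 A2 has_derivative solution_operator g1 g2 A1 A2) (at v)"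
proof -
  interpret F: volterra_data f1 f2 A1 A2 B b by (rule f)
  interpret G: volterra_data g1 g2 A1 A2 B' "\<lambda>p. 0" by (rule g)
  \<comment> \<open>Testing along sequences is enough for the limit at 0, and it is the form in
    which dominated convergence applies.\<close>
  have "(\<lambda>i. norm (F.solution (v + X i) - F.solution v - G.solution (X i)) / norm (X i)) \<longlonglongrightarrow> 0"
    if X: "\<And>i. X i \<noteq> 0" "X \<longlonglongrightarrow> 0" for X
  proof -
    define r where "r = (\<lambda>i. norm (X i))"
    have r: "\<And>i. 0 < r i" "r \<longlonglongrightarrow> 0"
      using X(1) tendsto_norm[OF X(2)] by (simp_all add: r_def)
    have "Bseq X" by (rule convergent_imp_Bseq[OF convergentI[OF X(2)]])
    then obtain N where N: "\<And>i. norm (X i) \<le> N" by (auto simp: Bseq_def)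
    define l0 where "l0 = F.density (F.solution v)"
    define l where "l = (\<lambda>i. F.density (F.solution (v + X i)))"
    define w where "w = (\<lambda>i p. l i p - l0 p)"
    define h where "h = (\<lambda>i. G.density (G.solution (X i)))"
    have sq: "square_integrable l0" "square_integrable (l i)" "square_integrable (h i)" for i
      unfolding l0_def l_def h_def by (rule AC02_square_integrable_pdxy(1))+
    have sqw: "square_integrable (w i)" for i
      unfolding w_def by (rule square_integrable_diff[OF sq(2,1)])
    have pw: "primitive (w i) p = primitive (l i) p - primitive l0 p" for i p
      unfolding w_def by (intro primitive_diff_integrable square_integrable_imp_integrable sq)
    have vN: "norm v \<le> norm v + N" "norm (v + X i) \<le> norm v + N" for i
      using N[of i] norm_triangle_ineq[of v "X i"] norm_ge_zero[of "X i"] by linarith+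
    obtain C where C: "0 \<le> C" and wC: "\<And>i p. primitive (\<lambda>p. norm (w i p)) p \<le> C * r i"
    proof (rule F.solution_lipschitz[of "norm v + N"], goal_cases)
      case (1 C)
      show ?case
        by (rule 1(1)[OF 1(2)]) (use 1(3)[OF vN(2,1)] in \<open>simp add: w_def l_def l0_def r_def\<close>)
    qed
    define R where "R = 2 * exp (8 * B) * (norm v + N + (LINT q|square_measure. F.\<beta> q))"
    have R: "norm (primitive l0 p) \<le> R" "norm (primitive (l i) p) \<le> R" for i p
    proof -
      have *: "norm (primitive (F.density (F.solution u)) p) \<le> R" if "norm u \<le> norm v + N" for u
      proof -
        have "2 * exp (8 * B) * (norm u + (LINT q|square_measure. F.\<beta> q)) \<le> R"
          unfolding R_def using that by simp
        then show ?thesis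
          using F.primitive_solution_le[of u p] norm_primitive_le[OF square_integrable_imp_integrable[OF AC02_square_integrable_pdxy(1)[of "F.solution u"]], of p]
          by linarith
      qed
      show "norm (primitive l0 p) \<le> R" "norm (primitive (l i) p) \<le> R"
        unfolding l0_def l_def by (rule *[OF vN(1)], rule *[OF vN(2)])
    qed
    obtain M where M: "AE p in square_measure. \<forall>z w. norm z \<le> R \<longrightarrow> norm w \<le> R \<longrightarrow>
        norm (f1 p z - f1 p w) \<le> M * norm (z - w) \<and> norm (f2 p z - f2 p w) \<le> M * norm (z - w)"
      using F.lipschitz[of R] by blast
    define e1 where "e1 = (\<lambda>i p. f1 p (primitive (l i) p) - f1 p (primitive l0 p) - g1 p (primitive (w i) p))"
    define e2 where "e2 = (\<lambda>i p. f2 p (primitive (l i) p) - f2 p (primitive l0 p) - g2 p (primitive (w i) p))"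
    have e_measurable [measurable]: "e1 i \<in> borel_measurable square_measure" "e2 i \<in> borel_measurable square_measure" for i
      unfolding e1_def e2_def
      by (intro borel_measurable_diff F.f_primitive_measurable G.f_primitive_measurable sq sqw)+
    \<comment> \<open>\<open>M\<close> bounds the increments of \<open>f1\<close> and
      \<open>f2\<close>, \<open>B'\<close> the linearized terms, and \<open>C\<close> the increment
      of z relative to the perturbation.\<close>
    define K where "K = (\<bar>M\<bar> + B') * C"
    have e_bound: "AE p in square_measure. norm (e1 i p) \<le> K * r i \<and> norm (e2 i p) \<le> K * r i" for i
      using M G.growth
    proof eventually_elim
      case (elim p)
      have nw: "norm (primitive (w i) p) \<le> C * r i"
        using norm_primitive_le[OF square_integrable_imp_integrable[OF sqw[of i]], of p] wC[of i p] by linarith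
      have *: "norm (a - c - d) \<le> K * r i"
        if "norm (a - c) \<le> M * norm (primitive (w i) p)" "norm d \<le> B' * norm (primitive (w i) p)" for a c d :: "real^'n"
      proof -
        have "norm (a - c - d) \<le> norm (a - c) + norm d" by (rule norm_triangle_ineq4)
        also have "\<dots> \<le> (M + B') * norm (primitive (w i) p)" using that by (simp add: distrib_right)
        also have "\<dots> \<le> (\<bar>M\<bar> + B') * (C * r i)"
          using nw G.B_pos by (intro mult_mono) auto
        finally show ?thesis by (simp add: K_def mult.assoc)
      qed
      show ?case
        unfolding e1_def e2_def
        by (intro conjI *) (use elim R in \<open>auto simp: pw\<close>)
    qed
    have sqe: "square_integrable (e1 i)" "square_integrable (e2 i)" for i
    proof -
      have E: "AE p in square_measure. norm (e1 i p) \<le> norm (K * r i)" "AE p in square_measure. norm (e2 i p) \<le> norm (K * r i)"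
        by (rule eventually_mono[OF e_bound[of i]], auto)+
      show "square_integrable (e1 i)"
        by (rule square_integrable_bound[OF e_measurable(1) square_integrable_const E(1)])
      show "square_integrable (e2 i)"
        by (rule square_integrable_bound[OF e_measurable(2) square_integrable_const E(2)])
    qed
    have e_lim: "AE p in square_measure. (\<lambda>i. norm (e1 i p) / r i) \<longlonglongrightarrow> 0 \<and> (\<lambda>i. norm (e2 i p) / r i) \<longlonglongrightarrow> 0"
      using der
    proof eventually_elim
      case (elim p)
      have z: "Rep_AC02 (F.solution v) p = primitive l0 p"
        unfolding l0_def by (simp add: AC02_square_integrable_pdxy(2))
      have nw: "norm (primitive (w i) p) \<le> C * r i" for i
        using norm_primitive_le[OF square_integrable_imp_integrable[OF sqw[of i]], of p] wC[of i p] by linarith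
      have eq: "primitive (l i) p = primitive l0 p + primitive (w i) p" for i
        by (simp add: pw)
      show ?case
        unfolding e1_def e2_def eq
        by (intro conjI has_derivative_remainder_tendsto[OF _ r nw]) (use elim z in auto)
    qed
    have e1_tendsto: "(\<lambda>i. (LINT p|square_measure. (norm (e1 i p))\<^sup>2) / (r i)\<^sup>2) \<longlonglongrightarrow> 0"
      by (rule scaled_square_integral_tendsto[OF e_measurable(1) r(1), where K = K])
        (use e_lim e_bound in simp_all)
    have e2_tendsto: "(\<lambda>i. (LINT p|square_measure. (norm (e2 i p))\<^sup>2) / (r i)\<^sup>2) \<longlonglongrightarrow> 0"
      by (rule scaled_square_integral_tendsto[OF e_measurable(2) r(1), where K = K])
        (use e_lim e_bound in simp_all)
    \<comment> \<open>The error of \<open>f1\<close> enters pointwise, that of \<open>f2\<close>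
      under the double integral; the terms with \<open>A1\<close> and \<open>A2\<close> are linear
      and leave no error.\<close>
    define q where "q = (\<lambda>i p. e1 i p + primitive (e2 i) p)"
    have sqq: "square_integrable (q i)" for i
      unfolding q_def by (intro square_integrable_add sqe square_integrable_primitive square_integrable_imp_integrable)
    have split: "AE p in square_measure. F.volterra (l i) p - F.volterra l0 p = G.volterra (w i) p + q i p" for i
    proof -
      have iF: "integrable square_measure (F.integrand (l i))" "integrable square_measure (F.integrand l0)"
          "integrable square_measure (G.integrand (w i))"
        by (intro F.integrable_integrand G.integrable_integrand sq sqw)+
      have "AE p in square_measure. e2 i p = (F.integrand (l i) p - F.integrand l0 p) - G.integrand (w i) p"
        using AE_pdx_primitive_lincomb[OF sq(2)[of i] sq(1), of 1 "-1"] AE_pdy_primitive_lincomb[OF sq(2)[of i] sq(1), of 1 "-1"]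
        by eventually_elim
          (simp add: F.integrand_def G.integrand_def e2_def w_def matrix_vector_mult_diff_distrib)
      then have "primitive (e2 i) p = primitive (\<lambda>p. (F.integrand (l i) p - F.integrand l0 p) - G.integrand (w i) p) p" for p
        by (rule primitive_cong_AE[OF e_measurable(2)])
      then have "primitive (e2 i) p = primitive (F.integrand (l i)) p - primitive (F.integrand l0) p - primitive (G.integrand (w i)) p" for p
        using iF by (simp add: primitive_diff_integrable)
      then show ?thesis
        by (intro AE_I2) (simp add: F.volterra_def G.volterra_def q_def e1_def)
    qed
    define u where "u = (\<lambda>i p. rep_L2 (X i) p - q i p)"
    have squ: "square_integrable (u i)" for i
      unfolding u_def by (rule square_integrable_diff[OF square_integrable_rep_L2 sqq])
    have w_eq: "AE p in square_measure. w i p + G.volterra (w i) p = u i p" for i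
      using F.solution_eq[of "v + X i"] F.solution_eq[of v] AE_rep_L2_add[of v "X i"] split[of i]
    proof eventually_elim
      case (elim p)
      have "rep_L2 (X i) p = (l i p + F.volterra (l i) p) - (l0 p + F.volterra l0 p)"
        using elim(1-3) by (simp add: l_def l0_def)
      also have "\<dots> = w i p + (F.volterra (l i) p - F.volterra l0 p)"
        by (simp add: w_def)
      finally show ?case by (simp add: elim(4) u_def)
    qed
    have h_eq: "AE p in square_measure. h i p + G.volterra (h i) p = rep_L2 (X i) p" for i
      unfolding h_def by (rule G.solution_eq)
    \<comment> \<open>Stability is stated on balls, for the linear equation too, so a common radius
      for all \<open>w i\<close> and \<open>h i\<close> is needed. The first entry serves
      \<open>w\<close>, the second is the a priori bound for \<open>h\<close>.\<close>
    define R' where "R' = max (C * N) (2 * exp (8 * B') * (N + (LINT q|square_measure. G.\<beta> q)))"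
    have wR: "primitive (\<lambda>p. norm (w i p)) p \<le> R'" for i p
    proof -
      have "C * r i \<le> C * N" using N[of i] C by (intro mult_left_mono) (simp_all add: r_def)
      then show ?thesis using wC[of i p] by (simp add: R'_def)
    qed
    have hR: "primitive (\<lambda>p. norm (h i p)) p \<le> R'" for i p
    proof -
      have "2 * exp (8 * B') * (norm (X i) + (LINT q|square_measure. G.\<beta> q)) \<le> R'"
        unfolding R'_def by (rule max.coboundedI2) (simp add: N)
      then show ?thesis using G.primitive_solution_le[of "X i" p] by (simp add: h_def)
    qed
    obtain C' where C': "0 \<le> C'" and wh: "\<And>i. AE p in square_measure. norm (w i p - h i p) \<le>
        norm (u i p - rep_L2 (X i) p) + C' * (LINT p|square_measure. norm (u i p - rep_L2 (X i) p))"
    proof (rule G.volterra_stability[of R'], goal_cases)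
      case (1 C)
      show ?case
        by (rule 1(1)[OF 1(2)])
          (rule 1(3)[OF sqw sq(3) squ square_integrable_rep_L2 w_eq h_eq wR hR, THEN conjunct2])
    qed
    define Z where "Z = (\<lambda>i. F.solution (v + X i) - F.solution v - G.solution (X i))"
    have Z_bound: "(norm (Z i))\<^sup>2 \<le> (2 + 2 * C'\<^sup>2) *
        (2 * (LINT p|square_measure. (norm (e1 i p))\<^sup>2) + 2 * (LINT p|square_measure. (norm (e2 i p))\<^sup>2))" for i
    proof -
      have "AE p in square_measure. pdxy (Rep_AC02 (Z i)) p = w i p - h i p"
        using F.AE_density_diff[of "F.solution (v + X i) - F.solution v" "G.solution (X i)"]
          F.AE_density_diff[of "F.solution (v + X i)" "F.solution v"]
        unfolding Z_def by eventually_elim (simp add: w_def h_def l_def l0_def)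
      moreover have "pdxy (Rep_AC02 (Z i)) \<in> borel_measurable square_measure"
          "(\<lambda>p. w i p - h i p) \<in> borel_measurable square_measure"
        using AC02_square_integrable_pdxy(1)[of "Z i"] square_integrable_diff[OF sqw[of i] sq(3)[of i]]
        by (simp_all only: square_integrable_def)
      ultimately have "(norm (Z i))\<^sup>2 = (LINT p|square_measure. (norm (w i p - h i p))\<^sup>2)"
        unfolding norm_AC02_power2 by (intro integral_norm_power_cong_AE)
      also have "\<dots> \<le> (2 + 2 * C'\<^sup>2) * (LINT p|square_measure. (norm (u i p - rep_L2 (X i) p))\<^sup>2)"
        by (rule square_norm_integral_bound[OF square_integrable_diff[OF sqw sq(3)]
              square_integrable_diff[OF squ square_integrable_rep_L2] C' wh])
      also have "\<dots> = (2 + 2 * C'\<^sup>2) * (LINT p|square_measure. (norm (q i p))\<^sup>2)"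
        by (simp add: u_def)
      finally have Z_le: "(norm (Z i))\<^sup>2 \<le> (2 + 2 * C'\<^sup>2) * (LINT p|square_measure. (norm (q i p))\<^sup>2)" .
      \<comment> \<open>The primitive of \<open>e2 i\<close> never exceeds the L1 norm
        \<open>I\<close> of \<open>e2 i\<close>, and the square of \<open>I\<close> is at most the
        squared L2 norm.\<close>
      have "(LINT p|square_measure. (norm (q i p))\<^sup>2) \<le>
          2 * (LINT p|square_measure. (norm (e1 i p))\<^sup>2) + 2 * (LINT p|square_measure. (norm (e2 i p))\<^sup>2)"
      proof -
        define I where "I = (LINT p|square_measure. norm (e2 i p))"
        have ie1: "integrable square_measure (\<lambda>p. (norm (e1 i p))\<^sup>2)"
          using sqe(1)[of i] by (simp add: square_integrable_def)
        have "(norm (q i p))\<^sup>2 \<le> 2 * (norm (e1 i p))\<^sup>2 + 2 * I\<^sup>2" for p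
        proof -
          have "norm (primitive (e2 i) p) \<le> primitive (\<lambda>p. norm (e2 i p)) p"
            by (rule norm_primitive_le[OF square_integrable_imp_integrable[OF sqe(2)]])
          also have "\<dots> \<le> I"
            unfolding I_def using square_integrable_imp_integrable[OF sqe(2)[of i]] by (intro primitive_le_integral) auto
          finally have "norm (q i p) \<le> norm (e1 i p) + I"
            unfolding q_def using norm_triangle_ineq[of "e1 i p" "primitive (e2 i) p"] by linarith
          then have "(norm (q i p))\<^sup>2 \<le> (norm (e1 i p) + I)\<^sup>2"
            by (intro power_mono) simp_all
          then show ?thesis
            using sum_squares_bound[of "norm (e1 i p)" I] unfolding power2_sum by linarith
        qed
        then have "(LINT p|square_measure. (norm (q i p))\<^sup>2) \<le> (LINT p|square_measure. 2 * (norm (e1 i p))\<^sup>2 + 2 * I\<^sup>2)"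
          using sqq[of i] ie1 by (intro integral_mono) (simp_all add: square_integrable_def)
        also have "\<dots> = 2 * (LINT p|square_measure. (norm (e1 i p))\<^sup>2) + 2 * I\<^sup>2"
          using ie1 by simp
        finally show ?thesis
          using square_norm_integral_le[OF sqe(2)[of i]] unfolding I_def by linarith
      qed
      from mult_left_mono[OF this, of "2 + 2 * C'\<^sup>2"] have "(2 + 2 * C'\<^sup>2) * (LINT p|square_measure. (norm (q i p))\<^sup>2) \<le> (2 + 2 * C'\<^sup>2) *
          (2 * (LINT p|square_measure. (norm (e1 i p))\<^sup>2) + 2 * (LINT p|square_measure. (norm (e2 i p))\<^sup>2))"
        by simp
      with Z_le show ?thesis by (rule order_trans)
    qed
    have "(\<lambda>i. (norm (Z i) / r i)\<^sup>2) \<longlonglongrightarrow> 0"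
    proof (rule tendsto_sandwich[OF always_eventually always_eventually tendsto_const])
      let ?c = "2 + 2 * C'\<^sup>2"
      show "(\<lambda>i. ?c * (2 * ((LINT p|square_measure. (norm (e1 i p))\<^sup>2) / (r i)\<^sup>2)
          + 2 * ((LINT p|square_measure. (norm (e2 i p))\<^sup>2) / (r i)\<^sup>2))) \<longlonglongrightarrow> 0"
        using tendsto_mult_right_zero[OF tendsto_add_zero[OF tendsto_mult_right_zero[OF e1_tendsto, of 2]
              tendsto_mult_right_zero[OF e2_tendsto, of 2]], of ?c] .
      show "\<forall>i. (norm (Z i) / r i)\<^sup>2 \<le> ?c * (2 * ((LINT p|square_measure. (norm (e1 i p))\<^sup>2) / (r i)\<^sup>2)
          + 2 * ((LINT p|square_measure. (norm (e2 i p))\<^sup>2) / (r i)\<^sup>2))"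
      proof
        fix i
        have "(norm (Z i) / r i)\<^sup>2 \<le> (?c * (2 * (LINT p|square_measure. (norm (e1 i p))\<^sup>2)
            + 2 * (LINT p|square_measure. (norm (e2 i p))\<^sup>2))) / (r i)\<^sup>2"
          unfolding power_divide by (intro divide_right_mono Z_bound) simp
        then show "(norm (Z i) / r i)\<^sup>2 \<le> ?c * (2 * ((LINT p|square_measure. (norm (e1 i p))\<^sup>2) / (r i)\<^sup>2)
            + 2 * ((LINT p|square_measure. (norm (e2 i p))\<^sup>2) / (r i)\<^sup>2))"
          by (simp only: times_divide_eq_right add_divide_distrib[symmetric])
      qed
    qed simp
    from tendsto_real_sqrt[OF this]
    have "(\<lambda>i. norm (Z i) / r i) \<longlonglongrightarrow> 0"
      using r(1) by (simp add: less_imp_le)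
    then show ?thesis by (simp only: Z_def r_def)
  qed
  then have "((\<lambda>h. norm (F.solution (v + h) - F.solution v - G.solution h) / norm h) \<longlongrightarrow> 0) (at 0)"
    unfolding tendsto_at_iff_sequentially by (simp add: o_def)
  then show ?thesis
    unfolding has_derivative_at using G.bounded_linear_solution[OF lin] by blast
qed

section \<open>Verification of the hypotheses\<close>

lemma continuously_differentiable_has_frechet_derivative:
  assumes "continuously_differentiable f"
  shows "(f has_derivative frechet_derivative f (at z)) (at z)"
  using assms unfolding continuously_differentiable_def frechet_derivative_works[symmetric] differentiable_def
  by blast

lemma volterra_dataI:
  assumes reg: "regular_data f1 f2 A1 A2" and gr: "growth_bounded f1 f2 A1 A2"
    and db: "derivatives_locally_bounded f1 f2"
  obtains B b where "volterra_data f1 f2 A1 A2 B b"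
proof -
  obtain B b where B: "0 < B" "square_integrable b" "\<And>p. p \<in> unit_square \<Longrightarrow> 0 \<le> b p"
    and AE: "AE p in square_measure.
       (\<forall>z. norm (f1 p z) \<le> B * norm z + b p \<and> norm (f2 p z) \<le> B * norm z + b p) \<and>
       norm (A1 p) \<le> B \<and> norm (A2 p) \<le> B \<and> norm (pdx A1 p) \<le> B \<and> norm (pdy A2 p) \<le> B"
    using gr unfolding growth_bounded_def by blast
  have cd: "AE p in square_measure. continuously_differentiable (f1 p) \<and> continuously_differentiable (f2 p)"
    using reg by (simp add: regular_data_def)
  have "volterra_data f1 f2 A1 A2 B b"
  proof
    show "(\<lambda>p. f1 p z) \<in> borel_measurable square_measure" "(\<lambda>p. f2 p z) \<in> borel_measurable square_measure" for z
      using reg by (simp_all add: regular_data_def)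
    show "A1 \<in> borel_measurable square_measure" "A2 \<in> borel_measurable square_measure"
      using reg by (simp_all add: regular_data_def)
    show "AE p in square_measure. continuous_on UNIV (f1 p) \<and> continuous_on UNIV (f2 p)"
      using cd
    proof eventually_elim
      case (elim p)
      then show ?case
        by (auto intro!: continuous_at_imp_continuous_on has_derivative_continuous
            continuously_differentiable_has_frechet_derivative)
    qed
    show "AE p in square_measure. \<forall>z. norm (f1 p z) \<le> B * norm z + b p \<and> norm (f2 p z) \<le> B * norm z + b p"
      using AE by eventually_elim blast
    show "AE p in square_measure. norm (A1 p) \<le> B \<and> norm (A2 p) \<le> B"
      using AE by eventually_elim blast
    fix R :: real
    \<comment> \<open>\<open>derivatives_locally_bounded\<close> speaks of positive radii, while
      \<open>R\<close> is arbitrary. The larger ball is convex, so the mean value inequality turns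
      the derivative bound into a Lipschitz bound.\<close>
    have "0 < max R 1" by simp
    then obtain M where M: "AE p in square_measure. \<forall>z. norm z \<le> max R 1 \<longrightarrow>
        onorm (frechet_derivative (f1 p) (at z)) \<le> M \<and> onorm (frechet_derivative (f2 p) (at z)) \<le> M"
      using db unfolding derivatives_locally_bounded_def by blast
    have "AE p in square_measure. \<forall>z w. norm z \<le> R \<longrightarrow> norm w \<le> R \<longrightarrow>
        norm (f1 p z - f1 p w) \<le> M * norm (z - w) \<and> norm (f2 p z - f2 p w) \<le> M * norm (z - w)"
      using M cd
    proof eventually_elim
      case (elim p)
      have *: "norm (f z - f w) \<le> M * norm (z - w)"
        if f: "continuously_differentiable f" "\<And>z. norm z \<le> max R 1 \<Longrightarrow> onorm (frechet_derivative f (at z)) \<le> M"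
          and zw: "norm z \<le> R" "norm w \<le> R" for f :: "real^'n \<Rightarrow> real^'n" and z w
      proof (rule differentiable_bound[where S = "cball 0 (max R 1)"])
        fix x :: "real^'n" assume "x \<in> cball 0 (max R 1)"
        then show "onorm (frechet_derivative f (at x)) \<le> M" using f(2) by simp
        show "(f has_derivative frechet_derivative f (at x)) (at x within cball 0 (max R 1))"
          by (rule has_derivative_at_withinI[OF continuously_differentiable_has_frechet_derivative[OF f(1)]])
      qed (use zw in auto)
      show ?case using elim by (intro allI impI conjI *) auto
    qed
    then show "\<exists>M. AE p in square_measure. \<forall>z w. norm z \<le> R \<longrightarrow> norm w \<le> R \<longrightarrow>
        norm (f1 p z - f1 p w) \<le> M * norm (z - w) \<and> norm (f2 p z - f2 p w) \<le> M * norm (z - w)"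
      by (rule exI)
  qed (fact B)+
  then show thesis by (rule that)
qed

text \<open>Boundedness of the base function keeps the derivatives inside one ball of
  \<open>derivatives_locally_bounded\<close>. The linearized terms are then uniformly bounded linear
  maps, so a single constant gives both growth and Lipschitz bounds.\<close>

lemma (in volterra_data) linearized_volterra_data:
  fixes \<zeta> :: "real \<times> real \<Rightarrow> real^'n"
  assumes cd: "AE p in square_measure. continuously_differentiable (f1 p) \<and> continuously_differentiable (f2 p)"
    and db: "derivatives_locally_bounded f1 f2"
    and \<zeta>: "\<zeta> \<in> borel_measurable square_measure" "\<And>p. norm (\<zeta> p) \<le> R"
  obtains B' where "volterra_data (\<lambda>p. frechet_derivative (f1 p) (at (\<zeta> p)))
      (\<lambda>p. frechet_derivative (f2 p) (at (\<zeta> p))) A1 A2 B' (\<lambda>p. 0)"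
proof -
  let ?g1 = "\<lambda>p. frechet_derivative (f1 p) (at (\<zeta> p))" and ?g2 = "\<lambda>p. frechet_derivative (f2 p) (at (\<zeta> p))"
  have "0 < max R 1" by simp
  then obtain M where M: "AE p in square_measure. \<forall>z. norm z \<le> max R 1 \<longrightarrow>
      onorm (frechet_derivative (f1 p) (at z)) \<le> M \<and> onorm (frechet_derivative (f2 p) (at z)) \<le> M"
    using db unfolding derivatives_locally_bounded_def by blast
  have der: "AE p in square_measure. (f1 p has_derivative ?g1 p) (at (\<zeta> p)) \<and> (f2 p has_derivative ?g2 p) (at (\<zeta> p))"
    using cd by eventually_elim (simp add: continuously_differentiable_has_frechet_derivative)
  \<comment> \<open>Keeping \<open>B\<close> in the maximum preserves positivity and the bounds on
    \<open>A1\<close> and \<open>A2\<close>.\<close>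
  define B' where "B' = max B M"
  have bl: "AE p in square_measure. bounded_linear (?g1 p) \<and> bounded_linear (?g2 p)"
    using der by eventually_elim (blast intro: has_derivative_bounded_linear)
  have bound: "AE p in square_measure. \<forall>z. norm (?g1 p z) \<le> B' * norm z \<and> norm (?g2 p z) \<le> B' * norm z"
    using M bl
  proof eventually_elim
    case (elim p)
    have *: "norm (g z) \<le> B' * norm z" if "bounded_linear g" "onorm g \<le> M" for g :: "real^'n \<Rightarrow> real^'n" and z
    proof -
      have "norm (g z) \<le> onorm g * norm z" by (rule onorm[OF that(1)])
      also have "\<dots> \<le> B' * norm z" using that(2) by (intro mult_right_mono) (auto simp: B'_def)
      finally show ?thesis .
    qed
    have "norm (\<zeta> p) \<le> max R 1" using \<zeta>(2)[of p] by simp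
    then show ?case using elim by (intro allI conjI *) auto
  qed
  have "volterra_data ?g1 ?g2 A1 A2 B' (\<lambda>p. 0)"
  proof
    show "(\<lambda>p. ?g1 p z) \<in> borel_measurable square_measure" for z
      by (rule measurable_directional_derivative[where f = f1, OF f_measurable(1) _ \<zeta>(1)]) (use f_continuous der in simp_all)
    show "(\<lambda>p. ?g2 p z) \<in> borel_measurable square_measure" for z
      by (rule measurable_directional_derivative[where f = f2, OF f_measurable(2) _ \<zeta>(1)]) (use f_continuous der in simp_all)
    show "AE p in square_measure. continuous_on UNIV (?g1 p) \<and> continuous_on UNIV (?g2 p)"
      using bl by eventually_elim (simp add: linear_continuous_on)
    show "AE p in square_measure. \<forall>z. norm (?g1 p z) \<le> B' * norm z + 0 \<and> norm (?g2 p z) \<le> B' * norm z + 0"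
      using bound by simp
    show "AE p in square_measure. norm (A1 p) \<le> B' \<and> norm (A2 p) \<le> B'"
      using A_bound by eventually_elim (auto simp: B'_def)
    show "0 < B'" using B_pos by (simp add: B'_def)
    fix R :: real
    have "AE p in square_measure. \<forall>z w. norm z \<le> R \<longrightarrow> norm w \<le> R \<longrightarrow>
        norm (?g1 p z - ?g1 p w) \<le> B' * norm (z - w) \<and> norm (?g2 p z - ?g2 p w) \<le> B' * norm (z - w)"
      using bound bl
    proof eventually_elim
      case (elim p)
      have "?g1 p z - ?g1 p w = ?g1 p (z - w)" "?g2 p z - ?g2 p w = ?g2 p (z - w)" for z w
        using elim(2) by (simp_all add: bounded_linear.linear linear_diff)
      then show ?case using elim(1) by simp
    qed
    then show "\<exists>M. AE p in square_measure. \<forall>z w. norm z \<le> R \<longrightarrow> norm w \<le> R \<longrightarrow>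
        norm (?g1 p z - ?g1 p w) \<le> M * norm (z - w) \<and> norm (?g2 p z - ?g2 p w) \<le> M * norm (z - w)"
      by (rule exI)
  qed (simp_all add: A_measurable)
  then show thesis by (rule that)
qed

theorem theorem3:
  fixes f1 f2 :: "real \<times> real \<Rightarrow> real^'n \<Rightarrow> real^'n"
    and A1 A2 :: "real \<times> real \<Rightarrow> real^'n^'n"
  assumes "regular_data f1 f2 A1 A2"
    and "growth_bounded f1 f2 A1 A2"
    and "derivatives_locally_bounded f1 f2"
  shows "(\<forall>v :: (real^'n) L2. \<exists>!z :: (real^'n) AC02. solves f1 f2 A1 A2 (rep_L2 v) (Rep_AC02 z)) \<and>
    continuous_on UNIV (solution_operator f1 f2 A1 A2) \<and>
    (\<forall>v. solution_operator f1 f2 A1 A2 differentiable (at v))"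
proof -
  obtain B b where data: "volterra_data f1 f2 A1 A2 B b"
    by (rule volterra_dataI[OF assms])
  interpret volterra_data f1 f2 A1 A2 B b by (rule data)
  have cd: "AE p in square_measure. continuously_differentiable (f1 p) \<and> continuously_differentiable (f2 p)"
    using assms(1) by (simp add: regular_data_def)
  have diff: "solution differentiable (at v)" for v
  proof -
    let ?\<zeta> = "Rep_AC02 (solution v)"
    let ?g1 = "\<lambda>p. frechet_derivative (f1 p) (at (?\<zeta> p))" and ?g2 = "\<lambda>p. frechet_derivative (f2 p) (at (?\<zeta> p))"
    note sq = AC02_square_integrable_pdxy(1)[of "solution v"]
    \<comment> \<open>As the primitive of its density, the solution is measurable and inherits the a
      priori bound at every point, which is what the linearization requires of its base
      function.\<close>
    have \<zeta>: "?\<zeta> = primitive (density (solution v))"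
      by (simp add: AC02_square_integrable_pdxy(2))
    have m: "?\<zeta> \<in> borel_measurable square_measure"
      by (subst \<zeta>) (rule measurable_primitive[OF borel_measurable_integrable[OF square_integrable_imp_integrable[OF sq]]])
    have b: "norm (?\<zeta> p) \<le> 2 * exp (8 * B) * (norm v + (LINT q|square_measure. \<beta> q))" for p
      by (subst \<zeta>) (rule order_trans[OF norm_primitive_le[OF square_integrable_imp_integrable[OF sq]] primitive_solution_le])
    obtain B' where lin: "volterra_data ?g1 ?g2 A1 A2 B' (\<lambda>p. 0)"
      by (rule linearized_volterra_data[OF cd assms(3) m b])
    have der: "AE p in square_measure. (f1 p has_derivative ?g1 p) (at (?\<zeta> p)) \<and> (f2 p has_derivative ?g2 p) (at (?\<zeta> p))"
      using cd by eventually_elim (simp add: continuously_differentiable_has_frechet_derivative)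
    then have "AE p in square_measure. linear (?g1 p) \<and> linear (?g2 p)"
      by eventually_elim (blast intro: has_derivative_linear)
    from solution_operator_has_derivative[OF data lin this der]
    show ?thesis unfolding differentiable_def by blast
  qed
  have "continuous_on UNIV solution"
    by (rule continuous_at_imp_continuous_on) (intro ballI, rule differentiable_imp_continuous_within[OF diff])
  with solves_ex1[OF square_integrable_rep_L2] diff show ?thesis by blast
qed

end
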